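(* Let $(A,\mathfrak a)$ be a good pair over $\Bbbk$ and $n\ge1$. With respect to the coproduct $\nabla$ and the product $*$, $S^A(n):=\bigoplus_{d\ge0}S^A(n,d)$ and $T^A_{\mathfrak a}(n):=\bigoplus_{d\ge0}T^A_{\mathfrak a}(n,d)$ are superbialgebras.
   Context: $\Bbbk$ is a commutative domain of characteristic $0$. Superalgebras are $\mathbb Z/2$-graded associative (not necessarily unital) $\Bbbk$-algebras $A=A_{\bar 0}\oplus A_{\bar 1}$; $\bar a$ denotes the parity of a homogeneous element $a$; tensor products of superalgebras carry the product $(x\otimes y)(z\otimes w)=(-1)^{\bar y\bar z}xz\otimes yw$. A good pair $(A,\mathfrak a)$ consists of a superalgebra $A$ with $A_{\bar 0},A_{\bar 1}$ free over $\Bbbk$ and a subalgebra $\mathfrak a\subseteq A_{\bar 0}$ such that $\mathfrak a$ and $A/\mathfrak a$ are free $\Bbbk$-modules. An $(A,\mathfrak a)$-basis is a $\Bbbk$-basis $B=B_{\mathfrak a}\sqcup B_{\mathfrak c}\sqcup B_{\bar 1}$ of $A$, where $B_{\mathfrak a}$, $B_{\mathfrak c}$, $B_{\bar 1}$ are bases of $\mathfrak a$, of a chosen $\Bbbk$-module complement $\mathfrak c$ of $\mathfrak a$ in $A_{\bar 0}$, and of $A_{\bar 1}$, respectively; one such basis is fixed. For $a\in A$ put $\xi^a_{r,s}:=aE_{r,s}\in M_n(A)$ ($E_{r,s}$ the matrix units; $M_n(A)$ is a superalgebra via parities of entries). Write $[1,n]=\{1,\dots,n\}$. The symmetric group $\mathfrak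 S_d$ acts on the right on words by $(x_1\cdots x_d)\sigma=x_{\sigma 1}\cdots x_{\sigma d}$, diagonally on tuples of words, and on $M_n(A)^{\otimes d}$ by superalgebra automorphisms $(\xi^{a_1}_{r_1,s_1}\otimes\cdots\otimes\xi^{a_d}_{r_d,s_d})^\sigma=(-1)^{\langle\sigma;\boldsymbol a\rangle}\xi^{a_{\sigma1}}_{r_{\sigma1},s_{\sigma1}}\otimes\cdots\otimes\xi^{a_{\sigma d}}_{r_{\sigma d},s_{\sigma d}}$ for homogeneous $a_i$, where $\langle\sigma;\boldsymbol a\rangle=\#\{(k,l): k<l,\ \sigma^{-1}k>\sigma^{-1}l,\ a_k,a_l \text{ odd}\}$. Define $S^A(n,d):=(M_n(A)^{\otimes d})^{\mathfrak S_d}$. $\mathrm{Tri}^B(n,d)$ is the set of triples $(\boldsymbol b,\boldsymbol r,\boldsymbol s)\in B^d\times[1,n]^d\times[1,n]^d$ such that for $k\ne l$ the equality $(b_k,r_k,s_k)=(b_l,r_l,s_l)$ holds only if $b_k$ is even. For such a triple let $\xi^{\boldsymbol b}_{\boldsymbol r,\boldsymbol s}:=\sum_\sigma(\xi^{b_1}_{r_1,s_1}\otimes\cdots\otimes\xi^{b_d}_{r_d,s_d})^\sigma\in S^A(n,d)$, with $\sigma$ over representatives of the cosets $\mathfrak S_{\boldsymbol b,\boldsymbol r,\boldsymbol s}\backslash\mathfrak S_d$, where $\mathfrak S_{\boldsymbol b,\boldsymbol r,\boldsymbol s}$ is the stabilizer of the triple. Let $[\boldsymbol b,\boldsymbol r,\boldsymbol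 s]^b_{r,s}:=\#\{k: (b_k,r_k,s_k)=(b,r,s)\}$, $[\boldsymbol b,\boldsymbol r,\boldsymbol s]^!_{\mathfrak c}:=\prod_{b\in B_{\mathfrak c},\,r,s\in[1,n]}[\boldsymbol b,\boldsymbol r,\boldsymbol s]^b_{r,s}!$, and $\eta^{\boldsymbol b}_{\boldsymbol r,\boldsymbol s}:=[\boldsymbol b,\boldsymbol r,\boldsymbol s]^!_{\mathfrak c}\,\xi^{\boldsymbol b}_{\boldsymbol r,\boldsymbol s}$. $T^A_{\mathfrak a}(n,d)$ is the $\Bbbk$-span of all $\eta^{\boldsymbol b}_{\boldsymbol r,\boldsymbol s}$ with $(\boldsymbol b,\boldsymbol r,\boldsymbol s)\in\mathrm{Tri}^B(n,d)$. Star product: for $x\in M_n(A)^{\otimes d}$, $y\in M_n(A)^{\otimes e}$, $x*y:=\sum_\sigma(x\otimes y)^\sigma$, with $\sigma$ over the shortest representatives of the cosets $(\mathfrak S_d\times\mathfrak S_e)\backslash\mathfrak S_{d+e}$; this makes $\bigoplus_{d\ge0}M_n(A)^{\otimes d}$ an associative supercommutative superalgebra with unit $1\in\Bbbk=M_n(A)^{\otimes0}$. Coproduct: $\nabla(\xi_1\otimes\cdots\otimes\xi_d)=\sum_{l=0}^d(\xi_1\otimes\cdots\otimes\xi_l)\otimes(\xi_{l+1}\otimes\cdots\otimes\xi_d)$, with counit the projection onto $M_n(A)^{\otimes0}=\Bbbk$. A superbialgebra is a superalgebra which is also a supercoalgebra whose (even) coproduct is a homomorphism of superalgebras, the tensor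 square carrying the product $(x\otimes y)*(z\otimes w)=(-1)^{\bar y\bar z}(x*z)\otimes(y*w)$. *)

theory Defs
  imports
    "HOL-Analysis.Finite_Cartesian_Product"
    "HOL-Combinatorics.Combinatorics"
    "HOL-Library.Poly_Mapping"
    "HOL-Library.Z2"
begin

section \<open>Linear algebra over a commutative ring\<close>

text \<open>
  A module is a type together with a scalar action satisfying the library locale \<^locale>\<open>module\<close>;
  submodules are subsets of that type. The ground ring is a type.
\<close>

definition direct_sum :: "'v::ab_group_add set \<Rightarrow> 'v set \<Rightarrow> 'v set \<Rightarrow> bool" where
  "direct_sum M X Y \<longleftrightarrow> X \<inter> Y = {0} \<and> M = {x + y | x y. x \<in> X \<and> y \<in> Y}"

definition linear_on ::
  "('k::comm_ring_1 \<Rightarrow> 'v::ab_group_add \<Rightarrow> 'v) \<Rightarrow> 'v set \<Rightarrow> ('k \<Rightarrow> 'w::ab_group_add \<Rightarrow> 'w)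
    \<Rightarrow> ('v \<Rightarrow> 'w) \<Rightarrow> bool" where
  "linear_on sc M sc' f \<longleftrightarrow>
     (\<forall>x\<in>M. \<forall>y\<in>M. f (x + y) = f x + f y) \<and> (\<forall>c. \<forall>x\<in>M. f (sc c x) = sc' c (f x))"

definition bilinear_on ::
  "('k::comm_ring_1 \<Rightarrow> 'v::ab_group_add \<Rightarrow> 'v) \<Rightarrow> 'v set \<Rightarrow> ('k \<Rightarrow> 'w::ab_group_add \<Rightarrow> 'w) \<Rightarrow> 'w set
    \<Rightarrow> ('k \<Rightarrow> 'u::ab_group_add \<Rightarrow> 'u) \<Rightarrow> ('v \<Rightarrow> 'w \<Rightarrow> 'u) \<Rightarrow> bool" where
  "bilinear_on sc M sc' N sc'' f \<longleftrightarrow>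
     (\<forall>y\<in>N. linear_on sc M sc'' (\<lambda>x. f x y)) \<and> (\<forall>x\<in>M. linear_on sc' N sc'' (f x))"

definition basis_of ::
  "('k::comm_ring_1 \<Rightarrow> 'v::ab_group_add \<Rightarrow> 'v) \<Rightarrow> 'v set \<Rightarrow> 'v set \<Rightarrow> bool" where
  "basis_of sc B M \<longleftrightarrow> \<not> module.dependent sc B \<and> module.span sc B = M"

definition free_module :: "('k::comm_ring_1 \<Rightarrow> 'v::ab_group_add \<Rightarrow> 'v) \<Rightarrow> 'v set \<Rightarrow> bool" where
  "free_module sc M \<longleftrightarrow> (\<exists>B. basis_of sc B M)"

text \<open>
  Finitely supported functions \<open>'x \<Rightarrow>\<^sub>0 'k\<close> form the free module on \<open>'x\<close>;
  \<open>lincomb sc g\<close> is the linear map from it which sends the generator \<open>x\<close> to \<open>g x\<close>.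
\<close>

definition free_scale :: "'k::comm_ring_1 \<Rightarrow> ('x \<Rightarrow>\<^sub>0 'k) \<Rightarrow> ('x \<Rightarrow>\<^sub>0 'k)" where
  "free_scale c = Poly_Mapping.map ((*) c)"

definition lincomb ::
  "('k::comm_ring_1 \<Rightarrow> 'v::ab_group_add \<Rightarrow> 'v) \<Rightarrow> ('x \<Rightarrow> 'v) \<Rightarrow> ('x \<Rightarrow>\<^sub>0 'k) \<Rightarrow> 'v" where
  "lincomb sc g f = (\<Sum>x\<in>Poly_Mapping.keys f. sc (Poly_Mapping.lookup f x) (g x))"

text \<open>
  The quotient \<open>M / N\<close> is free: the cosets of the elements of some \<open>C \<subseteq> M\<close> are pairwise distinct and
  form a basis of \<open>M / N\<close>.
\<close>

definition free_quotient ::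
  "('k::comm_ring_1 \<Rightarrow> 'v::ab_group_add \<Rightarrow> 'v) \<Rightarrow> 'v set \<Rightarrow> 'v set \<Rightarrow> bool" where
  "free_quotient sc M N \<longleftrightarrow>
     (\<exists>C\<subseteq>M. module.span sc (C \<union> N) = M \<and>
        (\<forall>f. Poly_Mapping.keys f \<subseteq> C \<and> lincomb sc (\<lambda>x. x) f \<in> N \<longrightarrow> f = 0))"

section \<open>Tensor products\<close>

text \<open>
  The submodule spanned by the family \<open>g\<close> on \<open>X\<close> is the quotient of the free module on \<open>X\<close> by the
  submodule generated by the relations \<open>R\<close>. Tensor products and tensor algebras are specified (up to
  unique isomorphism) by their usual generators and relations.
\<close>

definition presented_by ::
  "('k::comm_ring_1 \<Rightarrow> 'v::ab_group_add \<Rightarrow> 'v) \<Rightarrow> 'x set \<Rightarrow> ('x \<Rightarrow>\<^sub>0 'k) set \<Rightarrow> ('x \<Rightarrow> 'v) \<Rightarrow> bool" where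
  "presented_by sc X R g \<longleftrightarrow> module sc \<and>
     (\<forall>f. Poly_Mapping.keys f \<subseteq> X \<longrightarrow> (lincomb sc g f = 0 \<longleftrightarrow> f \<in> module.span free_scale R))"

abbreviation gen :: "'x \<Rightarrow> ('x \<Rightarrow>\<^sub>0 'k::comm_ring_1)" where
  "gen x \<equiv> Poly_Mapping.single x 1"

definition bilinear_relations ::
  "('k::comm_ring_1 \<Rightarrow> 'v::ab_group_add \<Rightarrow> 'v) \<Rightarrow> 'v set \<Rightarrow> ('k \<Rightarrow> 'w::ab_group_add \<Rightarrow> 'w) \<Rightarrow> 'w set
    \<Rightarrow> ('v \<times> 'w \<Rightarrow>\<^sub>0 'k) set" where
  "bilinear_relations sc M sc' N =
     {gen (x + x', y) - gen (x, y) - gen (x', y) | x x' y. x \<in> M \<and> x' \<in> M \<and> y \<in> N} \<union>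
     {gen (x, y + y') - gen (x, y) - gen (x, y') | x y y'. x \<in> M \<and> y \<in> N \<and> y' \<in> N} \<union>
     {gen (sc c x, y) - free_scale c (gen (x, y)) | c x y. x \<in> M \<and> y \<in> N} \<union>
     {gen (x, sc' c y) - free_scale c (gen (x, y)) | c x y. x \<in> M \<and> y \<in> N}"

definition tensor_span ::
  "('k::comm_ring_1 \<Rightarrow> 'u::ab_group_add \<Rightarrow> 'u) \<Rightarrow> ('v \<Rightarrow> 'w \<Rightarrow> 'u) \<Rightarrow> 'v set \<Rightarrow> 'w set \<Rightarrow> 'u set" where
  "tensor_span sc tn M N = module.span sc {tn x y | x y. x \<in> M \<and> y \<in> N}"

text \<open>\<open>tensor_span sc'' tn M N\<close> with \<open>tn\<close> is a tensor product of the submodules \<open>M\<close> and \<open>N\<close>.\<close>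

definition tensor_product ::
  "('k::comm_ring_1 \<Rightarrow> 'v::ab_group_add \<Rightarrow> 'v) \<Rightarrow> 'v set \<Rightarrow> ('k \<Rightarrow> 'w::ab_group_add \<Rightarrow> 'w) \<Rightarrow> 'w set
    \<Rightarrow> ('k \<Rightarrow> 'u::ab_group_add \<Rightarrow> 'u) \<Rightarrow> ('v \<Rightarrow> 'w \<Rightarrow> 'u) \<Rightarrow> bool" where
  "tensor_product sc M sc' N sc'' tn \<longleftrightarrow>
     presented_by sc'' (M \<times> N) (bilinear_relations sc M sc' N) (\<lambda>(x, y). tn x y)"

text \<open>
  \<open>tn\<close> gives \<open>H \<otimes> H\<close>, and \<open>tnl\<close>, \<open>tnr\<close> give \<open>(H \<otimes> H) \<otimes> H\<close> and \<open>H \<otimes> (H \<otimes> H)\<close>, the last two being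
  realized in the same module with \<open>(x \<otimes> y) \<otimes> z = x \<otimes> (y \<otimes> z)\<close>.
\<close>

definition tensor_square_cube ::
  "('k::comm_ring_1 \<Rightarrow> 'h::ab_group_add \<Rightarrow> 'h) \<Rightarrow> 'h set
    \<Rightarrow> ('k \<Rightarrow> 'u::ab_group_add \<Rightarrow> 'u) \<Rightarrow> ('h \<Rightarrow> 'h \<Rightarrow> 'u)
    \<Rightarrow> ('k \<Rightarrow> 'w::ab_group_add \<Rightarrow> 'w) \<Rightarrow> ('u \<Rightarrow> 'h \<Rightarrow> 'w) \<Rightarrow> ('h \<Rightarrow> 'u \<Rightarrow> 'w) \<Rightarrow> bool" where
  "tensor_square_cube sc H sc2 tn sc3 tnl tnr \<longleftrightarrow>
     tensor_product sc H sc H sc2 tn \<and>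
     tensor_product sc2 (tensor_span sc2 tn H H) sc H sc3 tnl \<and>
     tensor_product sc H sc2 (tensor_span sc2 tn H H) sc3 tnr \<and>
     (\<forall>x\<in>H. \<forall>y\<in>H. \<forall>z\<in>H. tnl (tn x y) z = tnr x (tn y z))"

definition multilinear_relations ::
  "('k::comm_ring_1 \<Rightarrow> 'v::ab_group_add \<Rightarrow> 'v) \<Rightarrow> ('v list \<Rightarrow>\<^sub>0 'k) set" where
  "multilinear_relations sc =
     {gen (u @ [x + y] @ v) - gen (u @ [x] @ v) - gen (u @ [y] @ v) | u v x y. True} \<union>
     {gen (u @ [sc c x] @ v) - free_scale c (gen (u @ [x] @ v)) | c u v x. True}"

text \<open>
  \<open>tens [v\<^sub>1, \<dots>, v\<^sub>d]\<close> is \<open>v\<^sub>1 \<otimes> \<cdots> \<otimes> v\<^sub>d\<close>, and the whole type \<open>'t\<close> is the direct sum of all tensor powers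
  of the module \<open>'v\<close>: the relations preserve the lengths of lists, and in length \<open>d\<close> they present
  the \<open>d\<close>-th tensor power, which is \<open>tensor_power scT tens d\<close>.
\<close>

definition tensor_algebra ::
  "('k::comm_ring_1 \<Rightarrow> 'v::ab_group_add \<Rightarrow> 'v) \<Rightarrow> ('k \<Rightarrow> 't::ab_group_add \<Rightarrow> 't) \<Rightarrow> ('v list \<Rightarrow> 't) \<Rightarrow> bool"
  where
  "tensor_algebra scV scT tens \<longleftrightarrow>
     presented_by scT UNIV (multilinear_relations scV) tens \<and> module.span scT (range tens) = UNIV"

definition tensor_power ::
  "('k::comm_ring_1 \<Rightarrow> 't::ab_group_add \<Rightarrow> 't) \<Rightarrow> ('v list \<Rightarrow> 't) \<Rightarrow> nat \<Rightarrow> 't set" where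
  "tensor_power scT tens d = module.span scT {tens w | w. length w = d}"

section \<open>Superalgebras, supercoalgebras and superbialgebras\<close>

text \<open>
  Parities are elements of \<open>\<int>/2\<close>, i.e. of the type \<open>bit\<close>. The grading is a family \<open>G\<close> of submodules of
  the carrier \<open>H\<close>.
\<close>

definition graded_module ::
  "('k::comm_ring_1 \<Rightarrow> 'h::ab_group_add \<Rightarrow> 'h) \<Rightarrow> 'h set \<Rightarrow> (bit \<Rightarrow> 'h set) \<Rightarrow> bool" where
  "graded_module sc H G \<longleftrightarrow>
     module sc \<and> (\<forall>i. module.subspace sc (G i)) \<and> direct_sum H (G 0) (G 1)"

definition koszul_sign :: "bit \<Rightarrow> bit \<Rightarrow> 'k::comm_ring_1" where
  "koszul_sign i j = (if i = 1 \<and> j = 1 then -1 else 1)"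

text \<open>Superalgebras are associative but not necessarily unital.\<close>

definition superalgebra ::
  "('k::comm_ring_1 \<Rightarrow> 'h::ab_group_add \<Rightarrow> 'h) \<Rightarrow> 'h set \<Rightarrow> (bit \<Rightarrow> 'h set) \<Rightarrow> ('h \<Rightarrow> 'h \<Rightarrow> 'h) \<Rightarrow> bool"
  where
  "superalgebra sc H G mul \<longleftrightarrow>
     graded_module sc H G \<and> bilinear_on sc H sc H sc mul \<and>
     (\<forall>i j. \<forall>x\<in>G i. \<forall>y\<in>G j. mul x y \<in> G (i + j)) \<and>
     (\<forall>x\<in>H. \<forall>y\<in>H. \<forall>z\<in>H. mul (mul x y) z = mul x (mul y z))"

definition tensor_grading ::
  "('k::comm_ring_1 \<Rightarrow> 'u::ab_group_add \<Rightarrow> 'u) \<Rightarrow> ('h \<Rightarrow> 'h \<Rightarrow> 'u) \<Rightarrow> (bit \<Rightarrow> 'h set) \<Rightarrow> bit \<Rightarrow> 'u set" where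
  "tensor_grading sc2 tn G i = module.span sc2 {tn x y | x y. \<exists>j k. j + k = i \<and> x \<in> G j \<and> y \<in> G k}"

definition supercoalgebra ::
  "('k::comm_ring_1 \<Rightarrow> 'h::ab_group_add \<Rightarrow> 'h)
    \<Rightarrow> ('k \<Rightarrow> 'u::ab_group_add \<Rightarrow> 'u) \<Rightarrow> ('h \<Rightarrow> 'h \<Rightarrow> 'u)
    \<Rightarrow> ('k \<Rightarrow> 'w::ab_group_add \<Rightarrow> 'w) \<Rightarrow> ('u \<Rightarrow> 'h \<Rightarrow> 'w) \<Rightarrow> ('h \<Rightarrow> 'u \<Rightarrow> 'w)
    \<Rightarrow> 'h set \<Rightarrow> (bit \<Rightarrow> 'h set) \<Rightarrow> ('h \<Rightarrow> 'u) \<Rightarrow> ('h \<Rightarrow> 'k) \<Rightarrow> bool" where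
  "supercoalgebra sc sc2 tn sc3 tnl tnr H G cop cou \<longleftrightarrow>
     graded_module sc H G \<and> tensor_square_cube sc H sc2 tn sc3 tnl tnr \<and>
     \<comment> \<open>the coproduct and the counit are even linear maps\<close>
     linear_on sc H sc2 cop \<and> (\<forall>i. \<forall>x\<in>G i. cop x \<in> tensor_grading sc2 tn G i) \<and>
     linear_on sc H (*) cou \<and> (\<forall>x\<in>G 1. cou x = 0) \<and>
     \<comment> \<open>coassociativity, with the maps \<open>cop \<otimes> id\<close> and \<open>id \<otimes> cop\<close>\<close>
     (\<exists>cop_id id_cop.
        linear_on sc2 (tensor_span sc2 tn H H) sc3 cop_id \<and>
        linear_on sc2 (tensor_span sc2 tn H H) sc3 id_cop \<and>
        (\<forall>x\<in>H. \<forall>y\<in>H. cop_id (tn x y) = tnl (cop x) y \<and> id_cop (tn x y) = tnr x (cop y)) \<and>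
        (\<forall>x\<in>H. cop_id (cop x) = id_cop (cop x))) \<and>
     \<comment> \<open>counit axioms, with the maps \<open>cou \<otimes> id\<close> and \<open>id \<otimes> cou\<close> to \<open>\<bbbk> \<otimes> H = H = H \<otimes> \<bbbk>\<close>\<close>
     (\<exists>cou_id id_cou.
        linear_on sc2 (tensor_span sc2 tn H H) sc cou_id \<and>
        linear_on sc2 (tensor_span sc2 tn H H) sc id_cou \<and>
        (\<forall>x\<in>H. \<forall>y\<in>H. cou_id (tn x y) = sc (cou x) y \<and> id_cou (tn x y) = sc (cou y) x) \<and>
        (\<forall>x\<in>H. cou_id (cop x) = x \<and> id_cou (cop x) = x))"

text \<open>The product \<open>mul2\<close> below is the one of the tensor square of the superalgebra.\<close>

definition superbialgebra ::
  "('k::comm_ring_1 \<Rightarrow> 'h::ab_group_add \<Rightarrow> 'h)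
    \<Rightarrow> ('k \<Rightarrow> 'u::ab_group_add \<Rightarrow> 'u) \<Rightarrow> ('h \<Rightarrow> 'h \<Rightarrow> 'u)
    \<Rightarrow> ('k \<Rightarrow> 'w::ab_group_add \<Rightarrow> 'w) \<Rightarrow> ('u \<Rightarrow> 'h \<Rightarrow> 'w) \<Rightarrow> ('h \<Rightarrow> 'u \<Rightarrow> 'w)
    \<Rightarrow> 'h set \<Rightarrow> (bit \<Rightarrow> 'h set) \<Rightarrow> ('h \<Rightarrow> 'h \<Rightarrow> 'h) \<Rightarrow> 'h \<Rightarrow> ('h \<Rightarrow> 'u) \<Rightarrow> ('h \<Rightarrow> 'k) \<Rightarrow> bool" where
  "superbialgebra sc sc2 tn sc3 tnl tnr H G mul one cop cou \<longleftrightarrow>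
     superalgebra sc H G mul \<and>
     one \<in> G 0 \<and> (\<forall>x\<in>H. mul one x = x \<and> mul x one = x) \<and>
     supercoalgebra sc sc2 tn sc3 tnl tnr H G cop cou \<and>
     (\<exists>mul2.
        bilinear_on sc2 (tensor_span sc2 tn H H) sc2 (tensor_span sc2 tn H H) sc2 mul2 \<and>
        (\<forall>i j. \<forall>x\<in>H. \<forall>y\<in>G i. \<forall>z\<in>G j. \<forall>w\<in>H.
           mul2 (tn x y) (tn z w) = sc2 (koszul_sign i j) (tn (mul x z) (mul y w))) \<and>
        (\<forall>x\<in>H. \<forall>y\<in>H. cop (mul x y) = mul2 (cop x) (cop y))) \<and>
     cop one = tn one one \<and>
     (\<forall>x\<in>H. \<forall>y\<in>H. cou (mul x y) = cou x * cou y) \<and> cou one = 1"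

section \<open>Good pairs\<close>

definition good_pair ::
  "('k::comm_ring_1 \<Rightarrow> 'a::ring \<Rightarrow> 'a) \<Rightarrow> (bit \<Rightarrow> 'a set) \<Rightarrow> 'a set \<Rightarrow> bool" where
  "good_pair sc A \<aa> \<longleftrightarrow>
     superalgebra sc UNIV A (*) \<and> free_module sc (A 0) \<and> free_module sc (A 1) \<and>
     \<aa> \<subseteq> A 0 \<and> module.subspace sc \<aa> \<and> (\<forall>x\<in>\<aa>. \<forall>y\<in>\<aa>. x * y \<in> \<aa>) \<and>
     free_module sc \<aa> \<and> free_quotient sc UNIV \<aa>"

definition good_pair_basis ::
  "('k::comm_ring_1 \<Rightarrow> 'a::ring \<Rightarrow> 'a) \<Rightarrow> (bit \<Rightarrow> 'a set) \<Rightarrow> 'a set \<Rightarrow> 'a set \<Rightarrow> 'a set \<Rightarrow> 'a set \<Rightarrow> bool"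
  where
  "good_pair_basis sc A \<aa> Ba Bc Bodd \<longleftrightarrow>
     (\<exists>\<cc>. module.subspace sc \<cc> \<and> direct_sum (A 0) \<aa> \<cc> \<and>
        basis_of sc Ba \<aa> \<and> basis_of sc Bc \<cc> \<and> basis_of sc Bodd (A 1))"

section \<open>Tensor powers of the matrix superalgebra\<close>

text \<open>
  Matrices \<open>M\<^sub>n(A)\<close> are indexed by a finite type \<open>'n\<close>, in the role of \<open>{1, \<dots>, n}\<close>. A triple of words
  \<open>(\<^bold>a, \<^bold>r, \<^bold>s)\<close> of length \<open>d\<close> is encoded as one list of triples \<open>(a\<^sub>k, r\<^sub>k, s\<^sub>k)\<close>, and the symmetric
  group \<open>\<SS>\<^sub>d\<close> consists of the permutations of \<open>{..<d}\<close> (positions start from \<open>0\<close>).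
  The right action on words is \<^const>\<open>permute_list\<close>; accordingly the product \<open>\<sigma>\<tau>\<close> in \<open>\<SS>\<^sub>d\<close> is
  \<open>\<sigma> \<circ> \<tau>\<close>.
\<close>

definition mat_scale :: "('k \<Rightarrow> 'a \<Rightarrow> 'a) \<Rightarrow> 'k \<Rightarrow> 'a^'n^'n \<Rightarrow> 'a^'n^'n" where
  "mat_scale sc c M = (\<chi> i j. sc c (M $ i $ j))"

fun xi_mat :: "'a::zero \<times> 'n \<times> 'n \<Rightarrow> 'a^'n^'n" where
  "xi_mat (a, r, s) = (\<chi> i j. if i = r \<and> j = s then a else 0)"

definition mat_grading :: "(bit \<Rightarrow> 'a set) \<Rightarrow> bit \<Rightarrow> ('a^'n^'n) set" where
  "mat_grading A p = {M. \<forall>i j. M $ i $ j \<in> A p}"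

definition tensor_parity ::
  "(bit \<Rightarrow> 'a set) \<Rightarrow> ('k::comm_ring_1 \<Rightarrow> 't::ab_group_add \<Rightarrow> 't) \<Rightarrow> (('a^'n^'n) list \<Rightarrow> 't) \<Rightarrow> bit \<Rightarrow> 't set"
  where
  "tensor_parity A scT tens p =
     module.span scT {tens w | w. \<exists>ps. list_all2 (\<lambda>M q. M \<in> mat_grading A q) w ps \<and> sum_list ps = p}"

definition odd_inversions :: "(bit \<Rightarrow> 'a set) \<Rightarrow> ('a \<times> 'n \<times> 'n) list \<Rightarrow> (nat \<Rightarrow> nat) \<Rightarrow> nat" where
  "odd_inversions A w \<sigma> =
     card {(k, l). k < l \<and> l < length w \<and> inv \<sigma> k > inv \<sigma> l \<and> fst (w ! k) \<in> A 1 \<and> fst (w ! l) \<in> A 1}"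

text \<open>
  The right action of \<open>\<sigma> \<in> \<SS>\<^sub>d\<close> on the \<open>d\<close>-th tensor power, as a linear map on the tensor algebra
  which is \<open>0\<close> on the other tensor powers.
\<close>

definition act ::
  "(bit \<Rightarrow> 'a::ring set) \<Rightarrow> ('k::comm_ring_1 \<Rightarrow> 't::ab_group_add \<Rightarrow> 't) \<Rightarrow> (('a^'n^'n) list \<Rightarrow> 't)
    \<Rightarrow> nat \<Rightarrow> (nat \<Rightarrow> nat) \<Rightarrow> 't \<Rightarrow> 't" where
  "act A scT tens d \<sigma> = (THE f. linear_on scT UNIV scT f \<and>
     (\<forall>w. length w = d \<and> fst ` set w \<subseteq> A 0 \<union> A 1 \<longrightarrow>
        f (tens (map xi_mat w)) =
          scT ((-1) ^ odd_inversions A w \<sigma>) (tens (map xi_mat (permute_list \<sigma> w)))) \<and>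
     (\<forall>v. length v \<noteq> d \<longrightarrow> f (tens v) = 0))"

definition invariants ::
  "(bit \<Rightarrow> 'a::ring set) \<Rightarrow> ('k::comm_ring_1 \<Rightarrow> 't::ab_group_add \<Rightarrow> 't) \<Rightarrow> (('a^'n^'n) list \<Rightarrow> 't)
    \<Rightarrow> nat \<Rightarrow> 't set" where
  "invariants A scT tens d =
     {x \<in> tensor_power scT tens d. \<forall>\<sigma>. \<sigma> permutes {..<d} \<longrightarrow> act A scT tens d \<sigma> x = x}"

subsection \<open>The star product and the coproduct\<close>

definition concat_tensor ::
  "('k::comm_ring_1 \<Rightarrow> 't::ab_group_add \<Rightarrow> 't) \<Rightarrow> ('v list \<Rightarrow> 't) \<Rightarrow> 't \<Rightarrow> 't \<Rightarrow> 't" where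
  "concat_tensor scT tens = (THE f. bilinear_on scT UNIV scT UNIV scT f \<and>
     (\<forall>u v. f (tens u) (tens v) = tens (u @ v)))"

definition perm_length :: "nat \<Rightarrow> (nat \<Rightarrow> nat) \<Rightarrow> nat" where
  "perm_length d \<sigma> = card {(k, l). k < l \<and> l < d \<and> \<sigma> k > \<sigma> l}"

definition young_subgroup :: "nat \<Rightarrow> nat \<Rightarrow> (nat \<Rightarrow> nat) set" where
  "young_subgroup d e = {\<tau>. \<tau> permutes {..<d + e} \<and> \<tau> ` {..<d} = {..<d}}"

text \<open>Shortest elements of the cosets \<open>{\<tau> \<circ> \<sigma> | \<tau> \<in> \<SS>\<^sub>d \<times> \<SS>\<^sub>e}\<close>.\<close>

definition shortest_reps :: "nat \<Rightarrow> nat \<Rightarrow> (nat \<Rightarrow> nat) set" where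
  "shortest_reps d e = {\<sigma>. \<sigma> permutes {..<d + e} \<and>
     (\<forall>\<tau>\<in>young_subgroup d e. perm_length (d + e) \<sigma> \<le> perm_length (d + e) (\<tau> \<circ> \<sigma>))}"

definition star ::
  "(bit \<Rightarrow> 'a::ring set) \<Rightarrow> ('k::comm_ring_1 \<Rightarrow> 't::ab_group_add \<Rightarrow> 't) \<Rightarrow> (('a^'n^'n) list \<Rightarrow> 't)
    \<Rightarrow> 't \<Rightarrow> 't \<Rightarrow> 't" where
  "star A scT tens = (THE f. bilinear_on scT UNIV scT UNIV scT f \<and>
     (\<forall>d e. \<forall>x\<in>tensor_power scT tens d. \<forall>y\<in>tensor_power scT tens e.
        f x y = (\<Sum>\<sigma>\<in>shortest_reps d e. act A scT tens (d + e) \<sigma> (concat_tensor scT tens x y))))"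

definition nabla ::
  "('k::comm_ring_1 \<Rightarrow> 't::ab_group_add \<Rightarrow> 't) \<Rightarrow> ('v list \<Rightarrow> 't)
    \<Rightarrow> ('k \<Rightarrow> 'u::ab_group_add \<Rightarrow> 'u) \<Rightarrow> ('t \<Rightarrow> 't \<Rightarrow> 'u) \<Rightarrow> 't \<Rightarrow> 'u" where
  "nabla scT tens sc2 tn = (THE f. linear_on scT UNIV sc2 f \<and>
     (\<forall>v. f (tens v) = (\<Sum>l\<le>length v. tn (tens (take l v)) (tens (drop l v)))))"

definition counit ::
  "('k::comm_ring_1 \<Rightarrow> 't::ab_group_add \<Rightarrow> 't) \<Rightarrow> ('v list \<Rightarrow> 't) \<Rightarrow> 't \<Rightarrow> 'k" where
  "counit scT tens = (THE f. linear_on scT UNIV (*) f \<and>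
     (\<forall>v. f (tens v) = (if v = [] then 1 else 0)))"

subsection \<open>The algebras \<open>S\<^sup>A(n)\<close> and \<open>T\<^sup>A\<^sub>\<aa>(n)\<close>\<close>

definition Tri :: "(bit \<Rightarrow> 'a set) \<Rightarrow> 'a set \<Rightarrow> ('a \<times> 'n \<times> 'n) list set" where
  "Tri A B = {w. fst ` set w \<subseteq> B \<and>
     (\<forall>k<length w. \<forall>l<length w. k \<noteq> l \<and> w ! k = w ! l \<longrightarrow> fst (w ! k) \<in> A 0)}"

definition stabilizer_cosets :: "'x list \<Rightarrow> (nat \<Rightarrow> nat) set set" where
  "stabilizer_cosets w =
     {{\<tau> \<circ> \<sigma> | \<tau>. \<tau> permutes {..<length w} \<and> permute_list \<tau> w = w} | \<sigma>. \<sigma> permutes {..<length w}}"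

definition xi ::
  "(bit \<Rightarrow> 'a::ring set) \<Rightarrow> ('k::comm_ring_1 \<Rightarrow> 't::ab_group_add \<Rightarrow> 't) \<Rightarrow> (('a^'n^'n) list \<Rightarrow> 't)
    \<Rightarrow> ('a \<times> 'n \<times> 'n) list \<Rightarrow> 't" where
  "xi A scT tens w =
     (\<Sum>C\<in>stabilizer_cosets w. act A scT tens (length w) (SOME \<sigma>. \<sigma> \<in> C) (tens (map xi_mat w)))"

text \<open>
  The product over all \<open>b \<in> B\<^sub>\<cc>\<close> and all \<open>r\<close>, \<open>s\<close> is taken over the triples which occur in the word; the
  other factors are \<open>0! = 1\<close>, and \<open>B\<^sub>\<cc>\<close> may be infinite.
\<close>

definition c_factorial :: "'a set \<Rightarrow> ('a \<times> 'n \<times> 'n) list \<Rightarrow> nat" where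
  "c_factorial Bc w = (\<Prod>x\<in>{x \<in> set w. fst x \<in> Bc}. fact (count_list w x))"

definition eta ::
  "(bit \<Rightarrow> 'a::ring set) \<Rightarrow> 'a set \<Rightarrow> ('k::comm_ring_1 \<Rightarrow> 't::ab_group_add \<Rightarrow> 't)
    \<Rightarrow> (('a^'n^'n) list \<Rightarrow> 't) \<Rightarrow> ('a \<times> 'n \<times> 'n) list \<Rightarrow> 't" where
  "eta A Bc scT tens w = scT (of_nat (c_factorial Bc w)) (xi A scT tens w)"

definition T_degree ::
  "(bit \<Rightarrow> 'a::ring set) \<Rightarrow> 'a set \<Rightarrow> 'a set \<Rightarrow> ('k::comm_ring_1 \<Rightarrow> 't::ab_group_add \<Rightarrow> 't)
    \<Rightarrow> (('a^'n^'n) list \<Rightarrow> 't) \<Rightarrow> nat \<Rightarrow> 't set" where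
  "T_degree A B Bc scT tens d = module.span scT {eta A Bc scT tens w | w. w \<in> Tri A B \<and> length w = d}"

text \<open>Internal direct sums: the degree \<open>d\<close> part is contained in the \<open>d\<close>-th tensor power.\<close>

definition S_total ::
  "(bit \<Rightarrow> 'a::ring set) \<Rightarrow> ('k::comm_ring_1 \<Rightarrow> 't::ab_group_add \<Rightarrow> 't) \<Rightarrow> (('a^'n^'n) list \<Rightarrow> 't) \<Rightarrow> 't set"
  where
  "S_total A scT tens = module.span scT (\<Union>d. invariants A scT tens d)"

definition T_total ::
  "(bit \<Rightarrow> 'a::ring set) \<Rightarrow> 'a set \<Rightarrow> 'a set \<Rightarrow> ('k::comm_ring_1 \<Rightarrow> 't::ab_group_add \<Rightarrow> 't)
    \<Rightarrow> (('a^'n^'n) list \<Rightarrow> 't) \<Rightarrow> 't set" where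
  "T_total A B Bc scT tens = module.span scT (\<Union>d. T_degree A B Bc scT tens d)"

end

theory Submission
  imports Defs
begin

text \<open>
  Let \<open>X\<close> be the homogeneous basis \<open>b E\<^sub>r\<^sub>s\<close> of \<open>M\<^sub>n(A)\<close>. An element of the tensor algebra is a finitely
  supported function \<open>f\<close> on words in \<open>X\<close>. In these coordinates the coproduct sends \<open>f\<close> to
  \<open>(u, v) \<mapsto> f (u v)\<close>, and the star product is the signed shuffle product, determined by
  \<open>(f * g)(1) = f(1) g(1)\<close> and by the fact that stripping the first letter is a superderivation. With
  this recursion the superbialgebra axioms for the whole tensor algebra follow by induction on words.
  The submodule \<open>S\<^sup>A(n)\<close> consists of the \<open>f\<close> which are invariant up to sign under permutations of
  words, and \<open>T\<^sup>A\<^sub>\<aa>(n)\<close> of those for which moreover \<open>[w]\<^sup>!\<^sub>\<cc>\<close> divides \<open>f w\<close> for every word \<open>w\<close>. Both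
  conditions are stable under the star product (divisibility by the Leibniz rule) and under the
  coproduct (because \<open>[u]\<^sup>!\<^sub>\<cc> [v]\<^sup>!\<^sub>\<cc>\<close> divides \<open>[u v]\<^sup>!\<^sub>\<cc>\<close>). Although \<open>T\<^sup>A\<^sub>\<aa>(n)\<close> need not be a direct summand,
  its tensor square and cube embed into those of the tensor algebra: the functionals \<open>f \<mapsto> f w\<close> take
  a diagonal matrix of values, with nonzero entries, on the basis \<open>\<eta>\<^sub>w\<close>, since \<open>\<bbbk>\<close> is a domain of
  characteristic \<open>0\<close>.
\<close>

section \<open>Signed shuffles of functions on words\<close>

text \<open>The product \<open>star\<close> is a sum over shortest coset representatives, while
  \<open>shuf\<close> is a recursion on letters; they meet in a sum over subsets of positions. A
  shortest representative is determined by the positions that receive the letters of the left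
  factor, and the sign of its action counts the pairs of odd letters in which one from the right
  factor precedes one from the left. Tensor algebras and tensor products are given only by
  generators and relations, so coordinates are not at hand: each coordinate functional comes from
  the universal property, and these functionals then show that the spanning words are independent.
  The obstacle for a submodule is that a relation among tensors of its elements may hold in the
  ambient tensor product and yet be derivable only with elements from outside. The claim for T
  requires its own square and cube to be presented by the same \<open>tn\<close>, so plain
  restriction does not suffice. Exact signs matter for the action and for \<open>xi\<close>.
  Vanishing and divisibility do not see signs, and there rearranged words are compared only up to
  sign.\<close>

declare add_bit_eq_xor [simp del] \<comment> \<open>it would unfold sums of parities\<close>

lemma koszul_sign_simps [simp]:
  "koszul_sign 0 j = 1" "koszul_sign i 0 = 1" "koszul_sign 1 1 = -1"
  by (simp_all add: koszul_sign_def)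

lemma koszul_sign_commute: "koszul_sign i j = koszul_sign j i"
  by (simp add: koszul_sign_def conj_commute)

lemma koszul_sign_add_right: "koszul_sign k (i + j) = koszul_sign k i * koszul_sign k j"
  by (cases i; cases j; cases k) simp_all

lemma koszul_sign_square [simp]: "koszul_sign i j * koszul_sign i j = 1"
  by (simp add: koszul_sign_def)

lemma koszul_sign_cases: "koszul_sign i j = 1 \<or> koszul_sign i j = (-1 :: 'k::comm_ring_1)"
  by (simp add: koszul_sign_def)

locale parity =
  fixes par :: "'x \<Rightarrow> bit"
begin

definition wpar :: "'x list \<Rightarrow> bit" where
  "wpar w = sum_list (map par w)"

lemma wpar_simps [simp]:
  "wpar [] = 0" "wpar (a # w) = par a + wpar w" "wpar (u @ v) = wpar u + wpar v"
  by (simp_all add: wpar_def)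

text \<open>The sign from moving a letter of parity \<open>p\<close> past \<open>f\<close>, put on
  each word separately so that \<open>f\<close> need not be homogeneous. For \<open>p = 1\<close>
  this is the grading automorphism.\<close>

definition twist :: "bit \<Rightarrow> ('x list \<Rightarrow> 'k::comm_ring_1) \<Rightarrow> 'x list \<Rightarrow> 'k" where
  "twist p f w = koszul_sign p (wpar w) * f w"

text \<open>
  On coefficient functions of elements of the tensor algebra, \<open>shuf\<close> is the star product: stripping
  the first letter is a superderivation of it.
\<close>

fun shuf :: "('x list \<Rightarrow> 'k::comm_ring_1) \<Rightarrow> ('x list \<Rightarrow> 'k) \<Rightarrow> 'x list \<Rightarrow> 'k" where
  "shuf f g [] = f [] * g []"
| "shuf f g (a # w) = shuf (\<lambda>w. f (a # w)) g w + shuf (twist (par a) f) (\<lambda>w. g (a # w)) w"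

lemma twist_0 [simp]: "twist 0 f = f"
  by (simp add: twist_def fun_eq_iff)

lemma twist_Cons: "twist p f (a # w) = koszul_sign p (par a) * twist p (\<lambda>w. f (a # w)) w"
  by (simp add: twist_def koszul_sign_add_right algebra_simps)

lemma twist_twist: "twist p (twist q f) = twist q (twist p f)"
  by (simp add: twist_def fun_eq_iff algebra_simps)

lemma twist_add: "twist p (\<lambda>w. f w + g w) = (\<lambda>w. twist p f w + twist p g w)"
  by (simp add: twist_def fun_eq_iff algebra_simps)

lemma twist_scale: "twist p (\<lambda>w. c * f w) = (\<lambda>w. c * twist p f w)"
  by (simp add: twist_def fun_eq_iff algebra_simps)

lemma shuf_add_left: "shuf (\<lambda>w. f w + f' w) g w = shuf f g w + shuf f' g w"
  by (induction w arbitrary: f f' g) (simp_all add: algebra_simps twist_add)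

lemma shuf_add_right: "shuf f (\<lambda>w. g w + g' w) w = shuf f g w + shuf f g' w"
  by (induction w arbitrary: f g' g) (simp_all add: algebra_simps)

lemma shuf_scale_left: "shuf (\<lambda>w. c * f w) g w = c * shuf f g w"
  by (induction w arbitrary: f g) (simp_all add: algebra_simps twist_scale)

lemma shuf_scale_right: "shuf f (\<lambda>w. c * g w) w = c * shuf f g w"
  by (induction w arbitrary: f g) (simp_all add: algebra_simps)

text \<open>Only values at subwords of \<open>w\<close> enter. Recording just their letters is
  enough to change \<open>f\<close> and \<open>g\<close> freely on words that contain a letter
  missing from \<open>w\<close>.\<close>

lemma shuf_cong:
  assumes "\<And>v. set v \<subseteq> set w \<Longrightarrow> f v = f' v" "\<And>v. set v \<subseteq> set w \<Longrightarrow> g v = g' v"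
  shows "shuf f g w = shuf f' g' w"
  using assms
proof (induction w arbitrary: f f' g g')
  case (Cons a w)
  have "shuf (\<lambda>w. f (a # w)) g w = shuf (\<lambda>w. f' (a # w)) g' w"
    by (rule Cons.IH) (auto intro!: Cons.prems)
  moreover have "shuf (twist (par a) f) (\<lambda>w. g (a # w)) w
      = shuf (twist (par a) f') (\<lambda>w. g' (a # w)) w"
    by (rule Cons.IH) (auto simp: twist_def intro!: Cons.prems arg_cong2[of _ _ _ _ "(*)"])
  ultimately show ?case by simp
qed simp

text \<open>Signs are multiplicative on concatenated words, so the grading automorphism respects the
  product. This is the rule for a letter that passes two factors at once.\<close>

lemma twist_shuf: "twist p (shuf f g) w = shuf (twist p f) (twist p g) w"
proof (induction w arbitrary: f g)
  case (Cons a w)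
  have "twist p (shuf f g) (a # w) = koszul_sign p (par a) *
     (twist p (shuf (\<lambda>w. f (a # w)) g) w + twist p (shuf (twist (par a) f) (\<lambda>w. g (a # w))) w)"
    by (simp add: twist_def koszul_sign_add_right algebra_simps)
  also have "\<dots> = shuf (twist p f) (twist p g) (a # w)"
    by (simp add: Cons.IH twist_Cons shuf_scale_left shuf_scale_right twist_twist[of p] algebra_simps)
  finally show ?case .
qed (simp add: twist_def)

text \<open>On both sides the first letter is stripped from \<open>f\<close>, from \<open>g\<close>
  past \<open>f\<close>, or from \<open>h\<close> past both; the three terms match by
  induction.\<close>

lemma shuf_assoc: "shuf (shuf f g) h w = shuf f (shuf g h) w"
proof (induction w arbitrary: f g h)
  case (Cons a w)
  have "shuf (shuf f g) h (a # w) = shuf (shuf (\<lambda>w. f (a # w)) g) h w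
      + shuf (shuf (twist (par a) f) (\<lambda>w. g (a # w))) h w
      + shuf (shuf (twist (par a) f) (twist (par a) g)) (\<lambda>w. h (a # w)) w"
    by (simp add: shuf_add_left twist_shuf cong: shuf_cong)
  then show ?case
    by (simp add: shuf_add_right Cons.IH)
qed simp

lemma shuf_unit_left:
  fixes g :: "'x list \<Rightarrow> 'k::comm_ring_1"
  shows "shuf (\<lambda>w. if w = [] then 1 else 0) g w = g w"
proof (induction w arbitrary: g)
  case (Cons a w)
  \<comment> \<open>The unit lives on the empty word, which is even, so twisting leaves it
    unchanged.\<close>
  have *: "twist (par a) (\<lambda>w. if w = [] then 1 else 0) = (\<lambda>w. if w = [] then 1 else 0)"
    by (auto simp: twist_def)
  have **: "shuf (\<lambda>w. 0) g w = 0" for g :: "'x list \<Rightarrow> 'k" and w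
    using shuf_scale_left[of 0 "\<lambda>w. 0" g w] by simp
  show ?case by (simp add: * ** Cons.IH)
qed simp

lemma shuf_unit_right:
  fixes f :: "'x list \<Rightarrow> 'k::comm_ring_1"
  shows "shuf f (\<lambda>w. if w = [] then 1 else 0) w = f w"
proof (induction w arbitrary: f)
  case (Cons a w)
  have **: "shuf g (\<lambda>w. 0) w = 0" for g :: "'x list \<Rightarrow> 'k" and w
    using shuf_scale_right[of g 0 "\<lambda>w. 0" w] by simp
  show ?case by (simp add: ** Cons.IH)
qed simp

section \<open>Parity of shuffles and the tensor square\<close>

definition homogeneous :: "bit \<Rightarrow> ('x list \<Rightarrow> 'k::comm_ring_1) \<Rightarrow> bool" where
  "homogeneous p f \<longleftrightarrow> (\<forall>w. f w \<noteq> 0 \<longrightarrow> wpar w = p)"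

lemma bit_add_cancel: "x + y = z \<longleftrightarrow> y = z + x" for x y z :: bit
  by (cases x; cases y; cases z) simp_all

lemma homogeneous_Cons: "homogeneous p f \<Longrightarrow> homogeneous (p + par a) (\<lambda>w. f (a # w))"
  by (auto simp: homogeneous_def bit_add_cancel)

lemma shuf_homogeneous:
  assumes "homogeneous p f" "homogeneous q g"
  shows "homogeneous (p + q) (shuf f g)"
proof -
  have "wpar w = p + q" if "shuf f g w \<noteq> 0" for w
    using assms that
  proof (induction w arbitrary: f g p q)
    case Nil
    then have "f [] \<noteq> 0" "g [] \<noteq> 0" by auto
    then have "p = wpar []" "q = wpar []" using Nil(1,2) unfolding homogeneous_def by metis+
    then show ?case by simp
  next
    case (Cons a w)
    have t: "homogeneous p (twist (par a) f)"
      using Cons.prems(1) unfolding homogeneous_def twist_def by (metis mult_zero_right)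
    consider "shuf (\<lambda>w. f (a # w)) g w \<noteq> 0" | "shuf (twist (par a) f) (\<lambda>w. g (a # w)) w \<noteq> 0"
      using Cons.prems(3) by (metis add.right_neutral shuf.simps(2))
    then show ?case
    proof cases
      case 1
      have "wpar w = (p + par a) + q"
        by (rule Cons.IH[OF homogeneous_Cons[OF Cons.prems(1)] Cons.prems(2) 1])
      then show ?thesis by (simp add: bit_add_cancel ac_simps)
    next
      case 2
      have "wpar w = p + (q + par a)"
        by (rule Cons.IH[OF t homogeneous_Cons[OF Cons.prems(2)] 2])
      then show ?thesis by (simp add: bit_add_cancel ac_simps)
    qed
  qed
  then show ?thesis by (simp add: homogeneous_def)
qed

text \<open>The product on the tensor square, on coefficient functions of pairs of words.\<close>

fun shuf2 :: "('x list \<Rightarrow> 'x list \<Rightarrow> 'k::comm_ring_1) \<Rightarrow> ('x list \<Rightarrow> 'x list \<Rightarrow> 'k)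
    \<Rightarrow> 'x list \<Rightarrow> 'x list \<Rightarrow> 'k" where
  "shuf2 P Q [] v = shuf (P []) (Q []) v"
| "shuf2 P Q (a # u) v = shuf2 (\<lambda>u. P (a # u)) Q u v
     + shuf2 (\<lambda>u v. koszul_sign (par a) (wpar (u @ v)) * P u v) (\<lambda>u. Q (a # u)) u v"

text \<open>With the coproduct read as the map from \<open>f\<close> to its values at
  \<open>u @ v\<close>, this is multiplicativity of the coproduct. Both sides obey the same
  recursion in \<open>u\<close>, because the twist sign involves the parity of the whole word
  \<open>u @ v\<close>.\<close>

lemma shuf_append: "shuf f g (u @ v) = shuf2 (\<lambda>u v. f (u @ v)) (\<lambda>u v. g (u @ v)) u v"
  by (induction u arbitrary: f g) (simp_all add: twist_def[abs_def])

lemma shuf2_add_left: "shuf2 (\<lambda>u v. P u v + P' u v) Q u v = shuf2 P Q u v + shuf2 P' Q u v"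
  by (induction u arbitrary: P P' Q) (simp_all add: shuf_add_left algebra_simps)

lemma shuf2_add_right: "shuf2 P (\<lambda>u v. Q u v + Q' u v) u v = shuf2 P Q u v + shuf2 P Q' u v"
  by (induction u arbitrary: P Q' Q) (simp_all add: shuf_add_right algebra_simps)

lemma shuf2_scale_left: "shuf2 (\<lambda>u v. c * P u v) Q u v = c * shuf2 P Q u v"
proof (induction u arbitrary: P Q)
  case (Cons a u)
  show ?case using Cons.IH[of "\<lambda>u. P (a # u)" Q]
      Cons.IH[of "\<lambda>u v. koszul_sign (par a) (wpar (u @ v)) * P u v" "\<lambda>u. Q (a # u)"]
    by (simp add: algebra_simps)
qed (simp add: shuf_scale_left)

lemma shuf2_scale_right: "shuf2 P (\<lambda>u v. c * Q u v) u v = c * shuf2 P Q u v"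
  by (induction u arbitrary: P Q) (simp_all add: shuf_scale_right algebra_simps)

text \<open>A letter stripped from \<open>f'\<close> has to pass both \<open>f\<close> and
  \<open>g\<close>. Passing \<open>f\<close> is the twist inside \<open>shuf f f'\<close>; passing
  \<open>g\<close> gives a constant sign because \<open>g\<close> is homogeneous, and these
  constants accumulate to \<open>koszul_sign p q\<close>.\<close>

lemma shuf2_tensor:
  fixes f :: "'x list \<Rightarrow> 'k::comm_ring_1"
  assumes "homogeneous p g" "homogeneous q f'"
  shows "shuf2 (\<lambda>u v. f u * g v) (\<lambda>u v. f' u * g' v) u v
    = koszul_sign p q * (shuf f f' u * shuf g g' v)"
  using assms
proof (induction u arbitrary: f f' q)
  case Nil
  \<comment> \<open>If \<open>f' []\<close> is nonzero, then \<open>q\<close> is the parity of the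
    empty word and the sign is 1.\<close>
  have "f' [] = koszul_sign p q * f' []"
    using Nil.prems(2) by (cases "f' [] = 0") (auto simp: homogeneous_def)
  then have eq: "f [] * f' [] * shuf g g' v = f [] * (koszul_sign p q * f' []) * shuf g g' v"
    by metis
  have "shuf2 (\<lambda>u v. f u * g v) (\<lambda>u v. f' u * g' v) [] v = f [] * f' [] * shuf g g' v"
    by (simp add: shuf_scale_left shuf_scale_right algebra_simps)
  also note eq
  finally show ?case
    by (simp add: algebra_simps)
next
  case (Cons a u)
  \<comment> \<open>Where \<open>g y\<close> is nonzero, \<open>y\<close> has parity
    \<open>p\<close>; elsewhere both sides vanish.\<close>
  have "koszul_sign (par a) (wpar (x @ y)) * (f x * g y)
      = koszul_sign (par a) p * (twist (par a) f x * g y)" for x y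
    using Cons.prems(1) by (cases "g y = 0")
      (auto simp: homogeneous_def twist_def koszul_sign_add_right algebra_simps)
  then have "shuf2 (\<lambda>u v. f u * g v) (\<lambda>u v. f' u * g' v) (a # u) v
     = koszul_sign p q * (shuf (\<lambda>w. f (a # w)) f' u * shuf g g' v)
     + koszul_sign (par a) p * (koszul_sign p (q + par a)
         * (shuf (twist (par a) f) (\<lambda>w. f' (a # w)) u * shuf g g' v))"
    by (simp add: shuf2_scale_left Cons.IH[OF Cons.prems]
        Cons.IH[OF Cons.prems(1) homogeneous_Cons[OF Cons.prems(2)]] del: wpar_simps)
  also have "\<dots> = koszul_sign p q * (shuf (\<lambda>w. f (a # w)) f' u * shuf g g' v)
     + (koszul_sign (par a) p * koszul_sign p (q + par a))
         * (shuf (twist (par a) f) (\<lambda>w. f' (a # w)) u * shuf g g' v)"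
    by (simp only: mult.assoc)
  \<comment> \<open>Without its first letter \<open>f'\<close> has parity \<open>q + par a\<close>,
    and the two contributions of \<open>a\<close> cancel.\<close>
  also have "koszul_sign (par a) p * koszul_sign p (q + par a) = (koszul_sign p q :: 'k)"
    by (cases p; cases q; cases "par a") simp_all
  finally show ?case
    by (simp add: algebra_simps)
qed

text \<open>Invariance under the symmetric group, expressed by adjacent transpositions.\<close>

definition adjinv :: "('x list \<Rightarrow> 'k::comm_ring_1) \<Rightarrow> bool" where
  "adjinv f \<longleftrightarrow>
     (\<forall>u a b v. f (u @ a # b # v) = koszul_sign (par a) (par b) * f (u @ b # a # v))"

lemma adjinvD: "adjinv f \<Longrightarrow> f (u @ a # b # v) = koszul_sign (par a) (par b) * f (u @ b # a # v)"
  unfolding adjinv_def by blast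

lemma adjinv_append: "adjinv f \<Longrightarrow> adjinv (\<lambda>w. f (u @ w))"
  unfolding adjinv_def by (metis append.assoc)

lemma adjinv_Cons: "adjinv f \<Longrightarrow> adjinv (\<lambda>w. f (a # w))"
  using adjinv_append[of f "[a]"] by simp

lemma adjinv_twist:
  assumes "adjinv f"
  shows "adjinv (twist p f)"
  unfolding adjinv_def
proof (intro allI)
  fix u a b v
  show "twist p f (u @ a # b # v) = koszul_sign (par a) (par b) * twist p f (u @ b # a # v)"
    using adjinvD[OF assms, of u a b v] by (simp add: twist_def algebra_simps)
qed

text \<open>Stripping a common prefix leads to the same claim for other invariant functions. Two
  leading letters are then distributed in four ways: if one factor takes both, its own invariance
  applies, and the two mixed terms are exchanged by the swap.\<close>

lemma adjinv_shuf:
  fixes f :: "'x list \<Rightarrow> 'k::comm_ring_1"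
  assumes "adjinv f" "adjinv g"
  shows "adjinv (shuf f g)"
proof -
  have "shuf f g (u @ a # b # v) = koszul_sign (par a) (par b) * shuf f g (u @ b # a # v)"
    for u a b v
    using assms
  proof (induction u arbitrary: f g)
    case Nil
    let ?k = "koszul_sign (par a) (par b) :: 'k"
    have 1: "(\<lambda>w. f (a # b # w)) = (\<lambda>w. ?k * f (b # a # w))"
      "(\<lambda>w. g (a # b # w)) = (\<lambda>w. ?k * g (b # a # w))"
      using adjinvD[OF Nil(1), of "[]" a b] adjinvD[OF Nil(2), of "[]" a b] by (simp_all only: append_Nil)
    have 2: "?k * (?k * x) = x" for x
      by (simp flip: mult.assoc)
    show ?case
      by (simp add: twist_Cons shuf_scale_left shuf_scale_right 1 algebra_simps 2
          twist_twist[of "par b"] koszul_sign_commute[of "par b"] flip: mult.assoc)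
  next
    case (Cons x u)
    then show ?case
      by (simp add: adjinv_twist adjinv_Cons algebra_simps)
  qed
  then show ?thesis unfolding adjinv_def by blast
qed

lemma adjinv_move:
  assumes "adjinv f"
  shows "f (u @ a # v) = koszul_sign (par a) (wpar u) * f (a # u @ v)"
  using assms
proof (induction u arbitrary: f)
  case (Cons b u)
  have "f (b # u @ a # v) = koszul_sign (par a) (wpar u) * f (b # a # u @ v)"
    by (rule Cons.IH[OF adjinv_Cons[OF Cons.prems]])
  also have "f (b # a # u @ v) = koszul_sign (par a) (par b) * f (a # b # u @ v)"
    using adjinvD[OF Cons.prems, of "[]" b a "u @ v"]
    by (simp only: append_Nil koszul_sign_commute[of "par b"])
  finally show ?case by (simp add: koszul_sign_add_right algebra_simps)
qed simp

text \<open>Agreement up to a sign suffices for vanishing and for divisibility, so the sign of the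
  rearrangement need not be tracked.\<close>

lemma adjinv_mset:
  fixes f :: "'x list \<Rightarrow> 'k::comm_ring_1"
  assumes "adjinv f" "mset w = mset w'"
  shows "f w = f w' \<or> f w = - f w'"
  using assms
proof (induction w arbitrary: w' f)
  case (Cons a w)
  then have "a \<in> set w'" by (metis list.set_intros(1) mset_eq_setD)
  then obtain u v where w': "w' = u @ a # v" by (meson split_list)
  have "mset w = mset (u @ v)" using Cons.prems(2) by (simp add: w')
  from Cons.IH[OF adjinv_Cons[OF Cons.prems(1)] this]
  have "f (a # w) = f (a # u @ v) \<or> f (a # w) = - f (a # u @ v)" .
  moreover have "f w' = f (a # u @ v) \<or> f w' = - f (a # u @ v)"
    unfolding w' adjinv_move[OF Cons.prems(1), of u a v]
    using koszul_sign_cases[of "par a" "wpar u", where 'a='k] by (metis mult_1 mult_minus1)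
  ultimately show ?case by auto
qed simp

text \<open>Two equal odd letters brought to the front are swapped with sign -1, so the value equals
  its own negative and is 0 in characteristic 0.\<close>

lemma adjinv_odd_repeat:
  fixes f :: "'x list \<Rightarrow> 'k::{idom,ring_char_0}"
  assumes "adjinv f" "par a = 1" "count (mset w) a \<ge> 2"
  shows "f w = 0"
proof -
  have "{#a, a#} \<subseteq># mset w"
    using assms(3) by (auto simp: subseteq_mset_def)
  then obtain M where M: "mset w = {#a, a#} + M" by (auto simp: mset_subset_eq_exists_conv)
  obtain v where v: "mset v = M" using ex_mset by blast
  have "f (a # a # v) = - f (a # a # v)"
    using adjinvD[OF assms(1), of "[]" a a v] assms(2) by simp
  then have "f (a # a # v) = 0" by simp
  moreover have "f w = f (a # a # v) \<or> f w = - f (a # a # v)"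
    by (rule adjinv_mset[OF assms(1)]) (simp add: M v)
  ultimately show ?thesis by auto
qed

lemma adjinv_add: "adjinv f \<Longrightarrow> adjinv g \<Longrightarrow> adjinv (\<lambda>w. f w + g w)"
  unfolding adjinv_def by (metis distrib_left)

lemma adjinv_scale: "adjinv f \<Longrightarrow> adjinv (\<lambda>w. c * f w)"
  unfolding adjinv_def by (metis mult.left_commute)

lemma adjinv_append_right:
  assumes "adjinv f"
  shows "adjinv (\<lambda>w. f (w @ v))"
  unfolding adjinv_def
proof (intro allI)
  fix u a b v'
  from adjinvD[OF assms, of u a b "v' @ v"]
  show "f ((u @ a # b # v') @ v) = koszul_sign (par a) (par b) * f ((u @ b # a # v') @ v)"
    by (simp only: append_assoc append_Cons)
qed

lemma wpar_mset: "mset u = mset v \<Longrightarrow> wpar u = wpar v"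
  unfolding wpar_def by (metis mset_map sum_mset_sum_list)

end

subsection \<open>Divisibility\<close>

text \<open>A set of letters replaces the set of algebra elements in \<open>c_factorial\<close>. For
  empty \<open>D\<close> the value is 1, which lets the undivided invariants be treated in the same
  way.\<close>

definition letter_factorial :: "'x set \<Rightarrow> 'x list \<Rightarrow> nat" where
  "letter_factorial D w = (\<Prod>x\<in>set w \<inter> D. fact (count_list w x))"

lemma letter_factorial_mset:
  assumes "mset w = mset w'"
  shows "letter_factorial D w = letter_factorial D w'"
proof -
  have "count_list w = count_list w'"
    using assms by (simp add: fun_eq_iff flip: count_mset)
  then show ?thesis
    using mset_eq_setD[OF assms] by (simp add: letter_factorial_def)
qed

lemma letter_factorial_pos: "letter_factorial D w > 0"
  by (auto simp: letter_factorial_def intro!: prod_pos)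

lemma letter_factorial_superset:
  assumes "finite S" "set w \<subseteq> S"
  shows "letter_factorial D w = (\<Prod>x\<in>S \<inter> D. fact (count_list w x))"
  unfolding letter_factorial_def using assms
  by (intro prod.mono_neutral_left) (auto, metis One_nat_def count_list_0_iff fact_0)

text \<open>Multiplicities of letters add under concatenation, and \<open>i! j!\<close> divides
  \<open>(i + j)!\<close>.\<close>

lemma letter_factorial_append_dvd:
  "letter_factorial D u * letter_factorial D v dvd letter_factorial D (u @ v)"
proof -
  have "letter_factorial D u * letter_factorial D v
      = (\<Prod>x\<in>set (u @ v) \<inter> D. fact (count_list u x) * fact (count_list v x))"
    by (simp add: letter_factorial_superset[of "set (u @ v)" u]
        letter_factorial_superset[of "set (u @ v)" v] prod.distrib)
  also have "\<dots> dvd letter_factorial D (u @ v)"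
    unfolding letter_factorial_def
    by (rule prod_dvd_prod) (simp add: fact_fact_dvd_fact)
  finally show ?thesis .
qed

lemma count_list_replicate: "count_list (replicate i x) y = (if x = y then i else 0)"
  by (induction i) auto

lemma letter_factorial_replicate:
  assumes "x \<in> D" "x \<notin> set v"
  shows "letter_factorial D (replicate i x @ v) = fact i * letter_factorial D v"
proof -
  let ?S = "insert x (set v)"
  have "letter_factorial D (replicate i x @ v)
      = (\<Prod>y\<in>?S \<inter> D. fact (count_list (replicate i x @ v) y))"
    by (rule letter_factorial_superset) auto
  also have "?S \<inter> D = insert x (set v \<inter> D)" using assms by auto
  also have "(\<Prod>y\<in>insert x (set v \<inter> D). fact (count_list (replicate i x @ v) y))
      = fact (count_list (replicate i x @ v) x)
        * (\<Prod>y\<in>set v \<inter> D. fact (count_list (replicate i x @ v) y))"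
    using assms by (intro prod.insert) auto
  also have "(\<Prod>y\<in>set v \<inter> D. fact (count_list (replicate i x @ v) y)) = letter_factorial D v"
    unfolding letter_factorial_def using assms
    by (intro prod.cong) (auto simp: count_list_replicate)
  finally show ?thesis
    using assms by (simp add: count_list_replicate count_list_0_iff)
qed

text \<open>Pascal's rule, shaped for one more step of the Leibniz rule: \<open>h i j\<close> stands
  for \<open>i\<close> strippings of the left factor and \<open>j\<close> of the right one.\<close>

lemma sum_binomial_Suc:
  fixes h :: "nat \<Rightarrow> nat \<Rightarrow> 'k::comm_ring_1"
  shows "(\<Sum>i\<le>Suc m. of_nat (Suc m choose i) * h i (Suc m - i))
    = (\<Sum>i\<le>m. of_nat (m choose i) * h (Suc i) (m - i))
      + (\<Sum>i\<le>m. of_nat (m choose i) * h i (Suc (m - i)))"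
proof -
  \<comment> \<open>The added summand at \<open>i = Suc m\<close> has coefficient 0.\<close>
  have "(\<Sum>i\<le>m. of_nat (m choose i) * h i (Suc (m - i)))
      = (\<Sum>i\<le>Suc m. of_nat (m choose i) * h i (Suc m - i))"
    by (simp add: Suc_diff_le binomial_eq_0)
  also have "\<dots> = h 0 (Suc m) + (\<Sum>i\<le>m. of_nat (m choose Suc i) * h (Suc i) (m - i))"
    by (simp only: sum.atMost_Suc_shift) simp
  finally show ?thesis
    by (simp only: sum.atMost_Suc_shift) (simp add: sum.distrib algebra_simps)
qed

context parity
begin

text \<open>For an even letter the twist is the identity, so stripping it is a derivation without
  signs and the ordinary Leibniz rule iterates.\<close>

lemma shuf_replicate:
  assumes "par x = 0"
  shows "shuf f g (replicate m x @ w) = (\<Sum>i\<le>m. of_nat (m choose i) *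
    shuf (\<lambda>w. f (replicate i x @ w)) (\<lambda>w. g (replicate (m - i) x @ w)) w)"
proof (induction m arbitrary: f g)
  case (Suc m)
  let ?h = "\<lambda>i j. shuf (\<lambda>w. f (replicate i x @ w)) (\<lambda>w. g (replicate j x @ w)) w"
  have "shuf f g (replicate (Suc m) x @ w) =
     shuf (\<lambda>w. f (x # w)) g (replicate m x @ w) + shuf f (\<lambda>w. g (x # w)) (replicate m x @ w)"
    by (simp add: assms)
  also have "\<dots> = (\<Sum>i\<le>m. of_nat (m choose i) * ?h (Suc i) (m - i))
      + (\<Sum>i\<le>m. of_nat (m choose i) * ?h i (Suc (m - i)))"
    by (simp add: Suc.IH)
  also have "\<dots> = (\<Sum>i\<le>Suc m. of_nat (Suc m choose i) * ?h i (Suc m - i))"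
    by (rule sum_binomial_Suc[symmetric])
  finally show ?case .
qed simp

text \<open>\<open>F\<close> is \<open>f\<close> after stripping \<open>i\<close> copies of
  \<open>x\<close>, divided by \<open>i!\<close>. Invariance and divisibility pass to the quotient
  because \<open>i!\<close> is nonzero in a domain of characteristic 0 and can be cancelled.\<close>

lemma adjinv_divided:
  fixes f :: "'x list \<Rightarrow> 'k::{idom,ring_char_0}"
  assumes f: "adjinv f" "\<And>w. of_nat (letter_factorial D w) dvd f w" and x: "x \<in> D"
  shows "\<exists>F. adjinv F \<and> (\<forall>w. of_nat (letter_factorial D w) dvd F w) \<and>
    (\<forall>v. x \<notin> set v \<longrightarrow> f (replicate i x @ v) = of_nat (fact i) * F v)"
proof -
  have "of_nat (fact i) dvd f (replicate i x @ v)" if "x \<notin> set v" for v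
    using f(2)[of "replicate i x @ v"] letter_factorial_replicate[OF x that, of i]
    by (metis dvd_mult_left of_nat_mult)
  then have "\<forall>v. \<exists>c. x \<notin> set v \<longrightarrow> f (replicate i x @ v) = of_nat (fact i) * c"
    by (meson dvdE)
  then obtain G where G: "x \<notin> set v \<Longrightarrow> f (replicate i x @ v) = of_nat (fact i) * G v" for v
    by metis
  \<comment> \<open>The value 0 on words that contain \<open>x\<close> keeps \<open>F\<close>
    invariant everywhere: an adjacent swap does not change the set of letters.\<close>
  define F where "F v = (if x \<in> set v then 0 else G v)" for v
  have F: "f (replicate i x @ v) = of_nat (fact i) * F v" if "x \<notin> set v" for v
    using G that by (simp add: F_def)
  have nz: "of_nat (fact i) \<noteq> (0::'k)" by simp
  have "F (u @ a # b # v) = koszul_sign (par a) (par b) * F (u @ b # a # v)" for u a b v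
  proof (cases "x \<in> set (u @ a # b # v)")
    case False
    then have F2: "x \<notin> set (u @ b # a # v)" by auto
    have "of_nat (fact i) * F (u @ a # b # v) = f (replicate i x @ u @ a # b # v)"
      using F[OF False] by simp
    also have "\<dots> = koszul_sign (par a) (par b) * f (replicate i x @ u @ b # a # v)"
      using adjinvD[OF f(1), of "replicate i x @ u" a b v] by simp
    also have "\<dots> = of_nat (fact i) * (koszul_sign (par a) (par b) * F (u @ b # a # v))"
      unfolding F[OF F2] by (simp only: ac_simps)
    finally show ?thesis using nz by (metis mult_left_cancel)
  qed (auto simp: F_def)
  then have "adjinv F" unfolding adjinv_def by blast
  moreover have "of_nat (letter_factorial D v) dvd F v" for v
  proof (cases "x \<in> set v")
    case False
    have "of_nat (fact i) * of_nat (letter_factorial D v) dvd of_nat (fact i) * F v"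
      using f(2)[of "replicate i x @ v"] letter_factorial_replicate[OF x False, of i] F[OF False]
      by (metis of_nat_mult)
    then show ?thesis using nz by (metis dvd_mult_cancel_left)
  qed (simp add: F_def)
  ultimately show ?thesis using F by blast
qed

text \<open>
  Collecting the \<open>m\<close> occurrences of an even letter \<open>x\<close> in front, the Leibniz rule gives
  coefficients \<open>m choose i\<close>, and \<open>(m choose i) i! (m - i)! = m!\<close>.
\<close>

lemma shuf_dvd:
  fixes f g :: "'x list \<Rightarrow> 'k::{idom,ring_char_0}"
  assumes D: "\<And>x. x \<in> D \<Longrightarrow> par x = 0"
    and "adjinv f" "\<And>w. of_nat (letter_factorial D w) dvd f w"
    and "adjinv g" "\<And>w. of_nat (letter_factorial D w) dvd g w"
  shows "of_nat (letter_factorial D w) dvd shuf f g w"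
  using assms(2-)
\<comment> \<open>Removing all copies of one letter of \<open>D\<close> shortens the word, while
  \<open>f\<close> and \<open>g\<close> are replaced by their divided versions; hence both stay
  arbitrary.\<close>
proof (induction "length w" arbitrary: w f g rule: less_induct)
  case less
  show ?case
  proof (cases "set w \<inter> D = {}")
    case True
    then show ?thesis by (simp add: letter_factorial_def)
  next
    case False
    then obtain x where x: "x \<in> set w" "x \<in> D" by auto
    define m where "m = count (mset w) x"
    define w' where "w' = filter (\<lambda>y. y \<noteq> x) w"
    have ms: "mset w = mset (replicate m x @ w')"
      by (rule multiset_eqI) (simp add: m_def w'_def)
    have "m > 0" using x by (simp add: m_def)
    moreover have "length w = m + length w'"
      using arg_cong[OF ms, of size] by simp
    ultimately have len: "length w' < length w" by simp
    have xw': "x \<notin> set w'" by (simp add: w'_def)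
    obtain F where F: "\<And>i. adjinv (F i)" "\<And>i w. of_nat (letter_factorial D w) dvd F i w"
      "\<And>i v. x \<notin> set v \<Longrightarrow> f (replicate i x @ v) = of_nat (fact i) * F i v"
      using adjinv_divided[OF less.prems(1,2) x(2)] by metis
    obtain G where G: "\<And>i. adjinv (G i)" "\<And>i w. of_nat (letter_factorial D w) dvd G i w"
      "\<And>i v. x \<notin> set v \<Longrightarrow> g (replicate i x @ v) = of_nat (fact i) * G i v"
      using adjinv_divided[OF less.prems(3,4) x(2)] by metis
    have "shuf (\<lambda>w. f (replicate i x @ w)) (\<lambda>w. g (replicate j x @ w)) w'
        = of_nat (fact i) * (of_nat (fact j) * shuf (F i) (G j) w')" for i j
    proof -
      \<comment> \<open>\<open>w'\<close> is free of \<open>x\<close>, so only those values occur to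
        which the defining property of \<open>F\<close> and \<open>G\<close> applies.\<close>
      have "shuf (\<lambda>w. f (replicate i x @ w)) (\<lambda>w. g (replicate j x @ w)) w'
          = shuf (\<lambda>w. of_nat (fact i) * F i w) (\<lambda>w. of_nat (fact j) * G j w) w'"
        by (rule shuf_cong) (use F(3) G(3) xw' in blast)+
      then show ?thesis by (simp add: shuf_scale_left shuf_scale_right)
    qed
    then have "shuf f g (replicate m x @ w') = (\<Sum>i\<le>m. of_nat (m choose i) *
        (of_nat (fact i) * (of_nat (fact (m - i)) * shuf (F i) (G (m - i)) w')))"
      by (simp add: shuf_replicate[OF D[OF x(2)]])
    also have "\<dots> = (\<Sum>i\<le>m. of_nat (fact m) * shuf (F i) (G (m - i)) w')"
    proof (rule sum.cong)
      fix i assume "i \<in> {..m}"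
      then have "fact i * fact (m - i) * (m choose i) = (fact m :: nat)"
        by (simp add: binomial_fact_lemma)
      then have e: "of_nat (fact i) * of_nat (fact (m - i)) * of_nat (m choose i) = (of_nat (fact m) :: 'k)"
        by (metis of_nat_mult)
      show "of_nat (m choose i) *
          (of_nat (fact i) * (of_nat (fact (m - i)) * shuf (F i) (G (m - i)) w'))
          = of_nat (fact m) * shuf (F i) (G (m - i)) w'"
        unfolding e[symmetric] by (simp only: ac_simps)
    qed simp
    finally have eq: "shuf f g (replicate m x @ w')
      = of_nat (fact m) * (\<Sum>i\<le>m. shuf (F i) (G (m - i)) w')"
      by (simp add: sum_distrib_left)
    have "of_nat (letter_factorial D w') dvd (\<Sum>i\<le>m. shuf (F i) (G (m - i)) w')"
      by (intro dvd_sum less.hyps[OF len] F G)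
    then have "of_nat (letter_factorial D (replicate m x @ w')) dvd shuf f g (replicate m x @ w')"
      unfolding eq letter_factorial_replicate[OF x(2) xw'] of_nat_mult by (rule mult_dvd_mono[OF dvd_refl])
    moreover have "letter_factorial D w = letter_factorial D (replicate m x @ w')"
      by (rule letter_factorial_mset[OF ms])
    \<comment> \<open>Collecting the copies of \<open>x\<close> in front rearranges
      \<open>w\<close>; the sign this causes is harmless for divisibility.\<close>
    moreover have "shuf f g w = shuf f g (replicate m x @ w') \<or> shuf f g w = - shuf f g (replicate m x @ w')"
      by (rule adjinv_mset[OF adjinv_shuf[OF less.prems(1,3)] ms])
    ultimately show ?thesis by auto
  qed
qed

subsection \<open>Shuffles as sums over subsets of positions\<close>

text \<open>\<open>I\<close> marks the letters that go to the left factor. Moving them to the front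
  takes each past the earlier unmarked letters, and every odd pair contributes -1.\<close>

definition ssign :: "nat set \<Rightarrow> 'x list \<Rightarrow> 'k::comm_ring_1" where
  "ssign I w = (-1) ^ card {(i, j). i < j \<and> j < length w \<and> i \<notin> I \<and> j \<in> I \<and>
     par (w ! i) = 1 \<and> par (w ! j) = 1}"

lemma koszul_sign_odd_nths:
  "koszul_sign 1 (wpar (nths w J)) = (-1) ^ card {j. j < length w \<and> j \<in> J \<and> par (w ! j) = 1}"
proof (induction w arbitrary: J)
  case (Cons a w)
  let ?J = "{j. Suc j \<in> J}"
  have "{j. j < length (a # w) \<and> j \<in> J \<and> par ((a # w) ! j) = 1}
    = (if 0 \<in> J \<and> par a = 1 then {0} else {}) \<union>
      Suc ` {j. j < length w \<and> j \<in> ?J \<and> par (w ! j) = 1}" (is "?L = ?R")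
  proof (rule set_eqI)
    show "i \<in> ?L \<longleftrightarrow> i \<in> ?R" for i by (cases i) auto
  qed
  then have "card {j. j < length (a # w) \<and> j \<in> J \<and> par ((a # w) ! j) = 1}
    = (if 0 \<in> J \<and> par a = 1 then 1 else 0) + card {j. j < length w \<and> j \<in> ?J \<and> par (w ! j) = 1}"
    by (auto simp: card_image card_insert_if)
  then show ?case
    by (cases "par a") (simp_all add: nths_Cons Cons.IH koszul_sign_add_right)
qed simp

text \<open>Position 0 can only be the left entry of a counted pair. It contributes nothing when
  marked; otherwise, if \<open>a\<close> is odd, it contributes one pair for each marked odd letter
  behind it.\<close>

lemma ssign_Cons:
  "ssign I (a # w) = (if 0 \<in> I then 1 else koszul_sign (par a) (wpar (nths w {j. Suc j \<in> I})))
     * ssign {j. Suc j \<in> I} w"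
proof -
  let ?J = "{j. Suc j \<in> I}"
  let ?S = "\<lambda>I w. {(i, j). i < j \<and> j < length w \<and> i \<notin> I \<and> j \<in> I \<and> par (w ! i) = 1 \<and> par (w ! j) = 1}"
  let ?X = "if 0 \<notin> I \<and> par a = 1
    then (\<lambda>j. (0 :: nat, Suc j)) ` {j. j < length w \<and> j \<in> ?J \<and> par (w ! j) = 1} else {}"
  let ?Y = "(\<lambda>(i, j). (Suc i, Suc j)) ` ?S ?J w"
  have fin: "finite (?S ?J w)"
    by (rule finite_subset[of _ "{..<length w} \<times> {..<length w}"]) auto
  have eq: "?S I (a # w) = ?X \<union> ?Y"
  proof (rule set_eqI)
    fix p :: "nat \<times> nat"
    obtain i j where p: "p = (i, j)" by force
    show "p \<in> ?S I (a # w) \<longleftrightarrow> p \<in> ?X \<union> ?Y"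
      unfolding p by (cases i; cases j) (auto simp: image_iff)
  qed
  have "card (?S I (a # w)) = card ?X + card ?Y"
    unfolding eq by (rule card_Un_disjoint) (use fin in auto)
  moreover have "card ?Y = card (?S ?J w)"
    by (rule card_image) (auto simp: inj_on_def)
  moreover have "card ?X = (if 0 \<notin> I \<and> par a = 1
      then card {j. j < length w \<and> j \<in> ?J \<and> par (w ! j) = 1} else 0)"
    by (auto simp: card_image inj_on_def)
  ultimately show ?thesis
    by (cases "par a") (auto simp: ssign_def power_add koszul_sign_odd_nths)
qed

lemma sum_Pow_Suc:
  "(\<Sum>I\<in>Pow {..<Suc n}. h I) = (\<Sum>J\<in>Pow {..<n}. h (insert 0 (Suc ` J))) + (\<Sum>J\<in>Pow {..<n}. h (Suc ` J))"
proof -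
  let ?P = "Pow {..<n}"
  have eq: "Pow {..<Suc n} = (\<lambda>J. insert 0 (Suc ` J)) ` ?P \<union> (`) Suc ` ?P" (is "?L = ?R")
  proof
    show "?R \<subseteq> ?L" by auto
    show "?L \<subseteq> ?R"
    proof
      fix I assume I: "I \<in> ?L"
      let ?J = "{j. Suc j \<in> I}"
      have "?J \<in> ?P" using I by auto
      moreover have "I = (if 0 \<in> I then insert 0 (Suc ` ?J) else Suc ` ?J)"
      proof (rule set_eqI)
        show "i \<in> I \<longleftrightarrow> i \<in> (if 0 \<in> I then insert 0 (Suc ` ?J) else Suc ` ?J)" for i
          by (cases i) auto
      qed
      ultimately show "I \<in> ?R" by (metis (no_types, lifting) UnCI image_eqI)
    qed
  qed
  have inj1: "inj_on (\<lambda>J. insert 0 (Suc ` J)) ?P"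
  proof (rule inj_onI)
    fix J K :: "nat set" assume "insert 0 (Suc ` J) = insert 0 (Suc ` K)"
    then have "Suc ` J = Suc ` K" by auto
    then show "J = K" by (simp add: inj_image_eq_iff)
  qed
  have inj2: "inj_on ((`) Suc) ?P"
    by (auto simp: inj_on_def inj_image_eq_iff)
  show ?thesis
    unfolding eq by (subst sum.union_disjoint) (auto simp: sum.reindex[OF inj1] sum.reindex[OF inj2])
qed

text \<open>Unfolding the recursion decides for each position which factor takes its letter. A
  letter taken by \<open>g\<close> is twisted past what \<open>f\<close> still receives, that is,
  past the later marked letters, and this is the sign in \<open>ssign\<close>.\<close>

lemma shuf_subsets:
  "shuf f g w = (\<Sum>I\<in>Pow {..<length w}. ssign I w * (f (nths w I) * g (nths w (- I))))"
proof (induction w arbitrary: f g)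
  case Nil
  show ?case by (simp add: ssign_def)
next
  case (Cons a w)
  have [simp]: "{j. Suc j \<in> Suc ` J} = J" "{j. Suc j \<in> insert 0 (Suc ` J)} = J"
    "{j. Suc j \<notin> Suc ` J} = - J" for J by auto
  show ?case
    by (simp add: sum_Pow_Suc Cons.IH ssign_Cons nths_Cons twist_def algebra_simps)
qed

lemma shuf_length:
  assumes "\<And>v. f v \<noteq> 0 \<Longrightarrow> length v = d" "\<And>v. g v \<noteq> 0 \<Longrightarrow> length v = e" "length w \<noteq> d + e"
  shows "shuf f g w = 0"
  unfolding shuf_subsets
proof (rule sum.neutral, rule ballI)
  fix I
  have "length (nths w I) + length (nths w (- I)) = card ({i. i < length w \<and> i \<in> I} \<union> {i. i < length w \<and> i \<in> - I})"
    unfolding length_nths by (rule card_Un_disjoint[symmetric]) auto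
  also have "{i. i < length w \<and> i \<in> I} \<union> {i. i < length w \<and> i \<in> - I} = {..<length w}" by auto
  finally have "length (nths w I) \<noteq> d \<or> length (nths w (- I)) \<noteq> e" using assms(3) by auto
  then have "f (nths w I) = 0 \<or> g (nths w (- I)) = 0" using assms(1,2) by blast
  then show "ssign I w * (f (nths w I) * g (nths w (- I))) = 0" by auto
qed

end

section \<open>Permutations of words\<close>

text \<open>As products over one fixed set of pairs, signs for different sets \<open>E\<close> can
  be multiplied factor by factor.\<close>

lemma minus_one_power_card:
  assumes "finite A" "E \<subseteq> A"
  shows "(-1 :: 'k::comm_ring_1) ^ card E = (\<Prod>p\<in>A. if p \<in> E then -1 else 1)"
proof -
  have "(\<Prod>p\<in>A. if p \<in> E then -1 else 1) = (\<Prod>p\<in>A \<inter> E. -1 :: 'k)"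
    using assms by (simp add: prod.If_cases Int_absorb1)
  then show ?thesis using assms by (simp add: Int_absorb1)
qed

lemma transpose_adjacent_inversion:
  fixes k l :: nat
  assumes "k < l"
  shows "transpose i (Suc i) k > transpose i (Suc i) l \<longleftrightarrow> k = i \<and> l = Suc i"
  using assms by (auto simp: transpose_def)

context parity
begin

text \<open>The exponent is \<langle>\<sigma>; a\<rangle> from the right action, with a parity
  function in place of membership in the odd part.\<close>

definition psign :: "'x list \<Rightarrow> (nat \<Rightarrow> nat) \<Rightarrow> 'k::comm_ring_1" where
  "psign w \<sigma> = (-1) ^ card {(k, l). k < l \<and> l < length w \<and> inv \<sigma> k > inv \<sigma> l \<and>
     par (w ! k) = 1 \<and> par (w ! l) = 1}"

lemma psign_id [simp]: "psign w id = 1"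
proof -
  have "{(k, l). k < l \<and> l < length w \<and> inv id k > inv id l \<and>
     par (w ! k) = 1 \<and> par (w ! l) = 1} = {}" by auto
  then show ?thesis by (simp only: psign_def card.empty power_0)
qed

text \<open>The cocycle identity behind the right action. A pair of odd positions is inverted by the
  composite when exactly one of two things happens: \<open>\<sigma>\<close> inverts it, or
  \<open>\<tau>\<close> inverts the pair that it has become.\<close>

lemma psign_comp:
  assumes \<sigma>: "\<sigma> permutes {..<length w}" and \<tau>: "\<tau> permutes {..<length w}"
  shows "psign w (\<sigma> \<circ> \<tau>) = psign w \<sigma> * (psign (permute_list \<sigma> w) \<tau> :: 'k::comm_ring_1)"
proof -
  let ?n = "length w"
  define s where "s = inv \<sigma>"
  define t where "t = inv \<tau>"
  define A where "A = {(k, l). k < l \<and> l < ?n \<and> par (w ! k) = 1 \<and> par (w ! l) = 1}"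
  define E1 where "E1 = {(k, l). (k, l) \<in> A \<and> s k > s l}"
  \<comment> \<open>Pairs of \<open>w\<close> whose images under \<open>inv \<sigma>\<close>, put in
    increasing order, are inverted by \<open>inv \<tau>\<close>; the equivalence covers both orders
    of \<open>s k\<close> and \<open>s l\<close>.\<close>
  define E2 where "E2 = {(k, l). (k, l) \<in> A \<and> (s k < s l \<longleftrightarrow> t (s k) > t (s l))}"
  define E12 where "E12 = {(k, l). (k, l) \<in> A \<and> t (s k) > t (s l)}"
  define F where "F = {(k, l). k < l \<and> l < length (permute_list \<sigma> w) \<and> t k > t l \<and>
     par (permute_list \<sigma> w ! k) = 1 \<and> par (permute_list \<sigma> w ! l) = 1}"
  have fin: "finite A"
    by (rule finite_subset[of _ "{..<?n} \<times> {..<?n}"]) (auto simp: A_def)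
  have inv: "inv (\<sigma> \<circ> \<tau>) = t \<circ> s"
    unfolding s_def t_def using \<sigma> \<tau> by (simp add: o_inv_distrib permutes_bij)
  have s\<sigma>: "s (\<sigma> k) = k" "\<sigma> (s k) = k" for k
    using \<sigma> by (simp_all add: s_def permutes_inverses)
  have injs: "s k = s l \<longleftrightarrow> k = l" for k l by (metis s\<sigma>(2))
  have injt: "t k = t l \<longleftrightarrow> k = l" for k l
    using \<tau> unfolding t_def by (metis permutes_inverses(1))
  have \<sigma>lt: "\<sigma> k < ?n \<longleftrightarrow> k < ?n" for k
    using permutes_in_image[OF \<sigma>] by simp
  \<comment> \<open>Positions of the permuted word are carried to positions of \<open>w\<close> as
    unordered pairs, hence \<open>min\<close> and \<open>max\<close>.\<close>
  have "bij_betw (\<lambda>(k, l). (min (\<sigma> k) (\<sigma> l), max (\<sigma> k) (\<sigma> l))) F E2"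
  proof (rule bij_betwI[where g = "\<lambda>(k, l). (min (s k) (s l), max (s k) (s l))"])
    show "(\<lambda>(k, l). (min (\<sigma> k) (\<sigma> l), max (\<sigma> k) (\<sigma> l))) \<in> F \<rightarrow> E2"
    proof (clarify)
      fix k l assume "(k, l) \<in> F"
      then have kl: "k < l" "l < ?n" "t k > t l" "par (w ! \<sigma> k) = 1" "par (w ! \<sigma> l) = 1"
        by (auto simp: F_def permute_list_nth[OF \<sigma>])
      have "\<sigma> k \<noteq> \<sigma> l" using kl(1) s\<sigma>(1) by (metis less_irrefl)
      then show "(min (\<sigma> k) (\<sigma> l), max (\<sigma> k) (\<sigma> l)) \<in> E2"
        using kl by (cases "\<sigma> k < \<sigma> l") (auto simp: E2_def A_def s\<sigma> \<sigma>lt)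
    qed
    show "(\<lambda>(k, l). (min (s k) (s l), max (s k) (s l))) \<in> E2 \<rightarrow> F"
    proof (clarify)
      fix k l assume "(k, l) \<in> E2"
      then have kl: "k < l" "l < ?n" "par (w ! k) = 1" "par (w ! l) = 1"
        "s k < s l \<longleftrightarrow> t (s k) > t (s l)"
        by (auto simp: E2_def A_def)
      have "s k \<noteq> s l" using kl(1) injs by simp
      moreover have "t (s k) \<noteq> t (s l)" using calculation injt by simp
      moreover have "s k < ?n" "s l < ?n" using kl \<sigma>lt s\<sigma>(2) by (metis less_trans)+
      ultimately show "(min (s k) (s l), max (s k) (s l)) \<in> F"
        using kl by (cases "s k < s l") (auto simp: F_def permute_list_nth[OF \<sigma>] s\<sigma>)
    qed
    show "(\<lambda>(k, l). (min (s k) (s l), max (s k) (s l)))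
        ((\<lambda>(k, l). (min (\<sigma> k) (\<sigma> l), max (\<sigma> k) (\<sigma> l))) p) = p" if "p \<in> F" for p
      using that by (auto simp: F_def s\<sigma> min_def max_def)
    show "(\<lambda>(k, l). (min (\<sigma> k) (\<sigma> l), max (\<sigma> k) (\<sigma> l)))
        ((\<lambda>(k, l). (min (s k) (s l), max (s k) (s l))) p) = p" if "p \<in> E2" for p
      using that by (auto simp: E2_def A_def s\<sigma> min_def max_def)
  qed
  then have "card F = card E2" by (rule bij_betw_same_card)
  then have 2: "psign (permute_list \<sigma> w) \<tau> = (\<Prod>p\<in>A. if p \<in> E2 then -1 else 1 :: 'k)"
    unfolding psign_def F_def[unfolded t_def, symmetric]
    by (simp add: t_def[symmetric]) (rule minus_one_power_card[OF fin], auto simp: E2_def)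
  have "E1 = {(k, l). k < l \<and> l < ?n \<and> inv \<sigma> k > inv \<sigma> l \<and> par (w ! k) = 1 \<and> par (w ! l) = 1}"
    by (auto simp: E1_def A_def s_def)
  then have 1: "psign w \<sigma> = (\<Prod>p\<in>A. if p \<in> E1 then -1 else 1 :: 'k)"
    unfolding psign_def using minus_one_power_card[OF fin, of E1] by (auto simp: E1_def)
  have "E12 = {(k, l). k < l \<and> l < ?n \<and> inv (\<sigma> \<circ> \<tau>) k > inv (\<sigma> \<circ> \<tau>) l \<and>
      par (w ! k) = 1 \<and> par (w ! l) = 1}"
    by (auto simp: E12_def A_def inv)
  then have 12: "psign w (\<sigma> \<circ> \<tau>) = (\<Prod>p\<in>A. if p \<in> E12 then -1 else 1 :: 'k)"
    unfolding psign_def using minus_one_power_card[OF fin, of E12] by (auto simp: E12_def)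
  have "(if p \<in> E12 then -1 else 1 :: 'k) = (if p \<in> E1 then -1 else 1) * (if p \<in> E2 then -1 else 1)"
    if "p \<in> A" for p
  proof -
    obtain k l where p: "p = (k, l)" by force
    have "s k \<noteq> s l" using that by (auto simp: p A_def injs)
    then show ?thesis using that by (auto simp: p E1_def E2_def E12_def)
  qed
  then show ?thesis
    unfolding 1 2 12 by (simp flip: prod.distrib)
qed

lemma psign_adjacent:
  assumes "Suc i < length w"
  shows "psign w (transpose i (Suc i)) = koszul_sign (par (w ! i)) (par (w ! Suc i))"
proof -
  let ?\<sigma> = "transpose i (Suc i)"
  have "{(k, l). k < l \<and> l < length w \<and> inv ?\<sigma> k > inv ?\<sigma> l \<and> par (w ! k) = 1 \<and> par (w ! l) = 1}
    = (if par (w ! i) = 1 \<and> par (w ! Suc i) = 1 then {(i, Suc i)} else {})"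
    using assms by (auto simp: transpose_adjacent_inversion)
  then show ?thesis
    unfolding psign_def by (auto simp: koszul_sign_def)
qed

lemma permute_list_adjacent:
  "permute_list (transpose (length u) (Suc (length u))) (u @ a # b # v) = u @ b # a # v"
proof (rule nth_equalityI)
  let ?w = "u @ a # b # v"
  fix i assume "i < length (permute_list (transpose (length u) (Suc (length u))) ?w)"
  moreover have "transpose (length u) (Suc (length u)) permutes {..<length ?w}"
    by (rule permutes_swap_id) auto
  ultimately show "permute_list (transpose (length u) (Suc (length u))) ?w ! i = (u @ b # a # v) ! i"
    by (auto simp: permute_list_nth transpose_def nth_append nth_Cons')
qed simp

lemma split_adjacent:
  assumes "Suc i < length w"
  obtains u a b v where "w = u @ a # b # v" "length u = i" "a = w ! i" "b = w ! Suc i"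
proof
  show "w = take i w @ w ! i # w ! Suc i # drop (Suc (Suc i)) w"
    using assms by (simp add: Cons_nth_drop_Suc Suc_lessD)
  show "length (take i w) = i" using assms by simp
qed auto

text \<open>Adjacent transpositions generate the symmetric group, and \<open>psign_comp\<close>
  carries the relation from two permutations to their composite.\<close>

lemma adjinv_iff_permute:
  fixes f :: "'x list \<Rightarrow> 'k::comm_ring_1"
  shows "adjinv f \<longleftrightarrow>
    (\<forall>w \<sigma>. \<sigma> permutes {..<length w} \<longrightarrow> f (permute_list \<sigma> w) = psign w \<sigma> * f w)"
proof
  assume *: "\<forall>w \<sigma>. \<sigma> permutes {..<length w} \<longrightarrow> f (permute_list \<sigma> w) = psign w \<sigma> * f w"
  show "adjinv f" unfolding adjinv_def
  proof (intro allI)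
    fix u v :: "'x list" and a b
    let ?w = "u @ b # a # v" and ?\<sigma> = "transpose (length u) (Suc (length u))"
    have "?\<sigma> permutes {..<length ?w}" by (rule permutes_swap_id) auto
    then have "f (permute_list ?\<sigma> ?w) = psign ?w ?\<sigma> * f ?w" using * by blast
    then show "f (u @ a # b # v) = koszul_sign (par a) (par b) * f (u @ b # a # v)"
      using psign_adjacent[of "length u" ?w, where 'a = 'k]
      by (simp add: permute_list_adjacent koszul_sign_commute nth_append)
  qed
next
  assume f: "adjinv f"
  define good where "good n \<sigma> \<longleftrightarrow> (\<forall>w. length w = n \<longrightarrow> f (permute_list \<sigma> w) = psign w \<sigma> * f w)"
    for n \<sigma>
  have comp: "good n (\<sigma> \<circ> \<tau>)"
    if "\<sigma> permutes {..<n}" "\<tau> permutes {..<n}" "good n \<sigma>" "good n \<tau>" for n \<sigma> \<tau>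
    using that by (auto simp: good_def permute_list_compose psign_comp)
  have adj: "good n (transpose i (Suc i))" if "Suc i < n" for i n
    unfolding good_def
  proof (intro allI impI)
    fix w :: "'x list" assume n: "length w = n"
    with that have "Suc i < length w" by simp
    then obtain u a b v where w: "w = u @ a # b # v" "length u = i" "a = w ! i" "b = w ! Suc i"
      by (rule split_adjacent)
    have "f (permute_list (transpose i (Suc i)) w) = f (u @ b # a # v)"
      using permute_list_adjacent[of u a b v] w(1,2) by metis
    also have "\<dots> = koszul_sign (par b) (par a) * f w"
      unfolding w(1) by (rule adjinvD[OF f])
    finally show "f (permute_list (transpose i (Suc i)) w) = psign w (transpose i (Suc i)) * f w"
      unfolding psign_adjacent[OF \<open>Suc i < length w\<close>] w(3,4) koszul_sign_commute[of "par (w ! Suc i)"] .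
  qed
  have trans: "good n (transpose i j)" if "i < j" "j < n" for i j n
    using that
  proof (induction j)
    case (Suc j)
    show ?case
    proof (cases "i = j")
      case False
      let ?t = "transpose j (Suc j)"
      \<comment> \<open>Conjugation by the adjacent transposition \<open>?t\<close> reduces to two
        points that are one step closer.\<close>
      have eq: "transpose i (Suc j) = ?t \<circ> (transpose i j \<circ> ?t)"
        using False Suc.prems by (auto simp: fun_eq_iff transpose_def)
      have p: "?t permutes {..<n}" "transpose i j permutes {..<n}"
        using Suc.prems by (auto intro!: permutes_swap_id)
      have "good n (transpose i j)" using Suc False by auto
      then show ?thesis
        unfolding eq using p Suc.prems by (intro comp permutes_compose adj) auto
    qed (use Suc.prems adj in simp)
  qed simp
  show "\<forall>w \<sigma>. \<sigma> permutes {..<length w} \<longrightarrow> f (permute_list \<sigma> w) = psign w \<sigma> * f w"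
  proof (intro allI impI)
    fix w :: "'x list" and \<sigma> assume \<sigma>: "\<sigma> permutes {..<length w}"
    have "good (length w) \<sigma>" using \<sigma> finite_lessThan
    proof (induction rule: permutes_induct)
      case id show ?case unfolding good_def permute_list_id psign_id mult_1 by simp
    next
      case (swap a b p)
      then have "good (length w) (transpose a b)"
        using trans[of a b "length w"] trans[of b a "length w"]
        by (cases "a < b") (auto simp: transpose_commute)
      then show ?case using swap by (intro comp permutes_swap_id) auto
    qed
    then show "f (permute_list \<sigma> w) = psign w \<sigma> * f w" by (simp add: good_def)
  qed
qed

text \<open>Odd letters of \<open>w\<close> are pairwise distinct, so a permutation that stabilizes
  \<open>w\<close> fixes every odd position and inverts no odd pair.\<close>

lemma psign_stabilizer:
  assumes "\<tau> permutes {..<length w}" "permute_list \<tau> w = w"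
    and "\<And>k l. k < length w \<Longrightarrow> l < length w \<Longrightarrow> k \<noteq> l \<Longrightarrow> w ! k = w ! l \<Longrightarrow> par (w ! k) = 0"
  shows "psign w \<tau> = 1"
proof -
  have "inv \<tau> k = k" if "k < length w" "par (w ! k) = 1" for k
  proof -
    let ?l = "inv \<tau> k"
    have l: "?l < length w"
      using permutes_in_image[OF permutes_inv[OF assms(1)], of k] that by simp
    have "w ! ?l = w ! k"
      using permute_list_nth[OF assms(1) l] assms(2) permutes_inverses(1)[OF assms(1)] by simp
    then show ?thesis using assms(3)[OF l that(1)] that(2) by auto
  qed
  then have "{(k, l). k < l \<and> l < length w \<and> inv \<tau> k > inv \<tau> l \<and>
     par (w ! k) = 1 \<and> par (w ! l) = 1} = {}"
    by (auto dest: order.strict_trans)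
  then show ?thesis unfolding psign_def by (simp only: card.empty power_0)
qed

text \<open>The two permutations differ by an element of the stabilizer, which has sign 1. This
  makes sums over cosets independent of the representatives.\<close>

lemma psign_eq:
  assumes "\<sigma> permutes {..<length w}" "\<sigma>' permutes {..<length w}"
    and "permute_list \<sigma> w = permute_list \<sigma>' w"
    and "\<And>k l. k < length w \<Longrightarrow> l < length w \<Longrightarrow> k \<noteq> l \<Longrightarrow> w ! k = w ! l \<Longrightarrow> par (w ! k) = 0"
  shows "psign w \<sigma>' = (psign w \<sigma> :: 'k::comm_ring_1)"
proof -
  let ?\<tau> = "\<sigma>' \<circ> inv \<sigma>"
  have \<tau>: "?\<tau> permutes {..<length w}"
    by (rule permutes_compose[OF permutes_inv[OF assms(1)] assms(2)])
  have "permute_list ?\<tau> w = permute_list (inv \<sigma>) (permute_list \<sigma> w)"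
    using permute_list_compose[OF permutes_inv[OF assms(1)], of \<sigma>'] assms(3) by simp
  also have "\<dots> = permute_list (\<sigma> \<circ> inv \<sigma>) w"
    using permute_list_compose[OF permutes_inv[OF assms(1)], of \<sigma>] by simp
  finally have fix_w: "permute_list ?\<tau> w = w"
    using permutes_inv_o(1)[OF assms(1)] by simp
  have "?\<tau> \<circ> \<sigma> = \<sigma>'"
    using permutes_inv_o(2)[OF assms(1)] by (simp add: comp_assoc)
  then have "psign w \<sigma>' = psign w ?\<tau> * (psign w \<sigma> :: 'k)"
    using psign_comp[OF \<tau> assms(1)] fix_w by simp
  moreover have "psign w ?\<tau> = (1 :: 'k)"
    by (rule psign_stabilizer[OF \<tau> fix_w]) (use assms(4) in blast)
  ultimately show ?thesis by simp
qed

end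

lemma permute_list_inv:
  assumes "\<sigma> permutes {..<length w}"
  shows "permute_list (inv \<sigma>) (permute_list \<sigma> w) = w" "permute_list \<sigma> (permute_list (inv \<sigma>) w) = w"
  using permute_list_compose[OF permutes_inv[OF assms], of \<sigma>] permute_list_compose[OF assms, of "inv \<sigma>"]
    permutes_inv_o[OF assms] by simp_all

lemma permute_list_inj:
  assumes "\<sigma> permutes {..<length w}" "length w = length w'"
  shows "permute_list \<sigma> w = permute_list \<sigma> w' \<longleftrightarrow> w = w'"
  using permute_list_inv(1)[OF assms(1)] permute_list_inv(1)[of \<sigma> w'] assms by metis

lemma permute_list_lists:
  "\<sigma> permutes {..<length w} \<Longrightarrow> w \<in> lists X \<Longrightarrow> permute_list \<sigma> w \<in> lists X"
  using set_permute_list[of \<sigma> w] by auto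

text \<open>A coset consists of the permutations that produce one particular rearrangement, so sums
  over cosets become sums over the distinct rearrangements of \<open>w\<close>.\<close>

lemma stabilizer_coset:
  assumes "\<sigma> permutes {..<length w}"
  shows "{\<tau> \<circ> \<sigma> | \<tau>. \<tau> permutes {..<length w} \<and> permute_list \<tau> w = w}
    = {\<rho>. \<rho> permutes {..<length w} \<and> permute_list \<rho> w = permute_list \<sigma> w}"
proof (intro subset_antisym subsetI)
  fix \<rho> assume "\<rho> \<in> {\<tau> \<circ> \<sigma> | \<tau>. \<tau> permutes {..<length w} \<and> permute_list \<tau> w = w}"
  then obtain \<tau> where "\<rho> = \<tau> \<circ> \<sigma>" "\<tau> permutes {..<length w}" "permute_list \<tau> w = w" by blast
  then show "\<rho> \<in> {\<rho>. \<rho> permutes {..<length w} \<and> permute_list \<rho> w = permute_list \<sigma> w}"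
    using assms permutes_compose[OF assms] permute_list_compose[OF assms, of \<tau>] by simp
next
  fix \<rho> assume "\<rho> \<in> {\<rho>. \<rho> permutes {..<length w} \<and> permute_list \<rho> w = permute_list \<sigma> w}"
  then have \<rho>: "\<rho> permutes {..<length w}" "permute_list \<rho> w = permute_list \<sigma> w" by auto
  have inv: "inv \<sigma> permutes {..<length w}" by (rule permutes_inv[OF assms])
  have "permute_list (\<rho> \<circ> inv \<sigma>) w = permute_list (inv \<sigma>) (permute_list \<sigma> w)"
    using permute_list_compose[OF inv, of \<rho>] \<rho>(2) by simp
  also have "\<dots> = permute_list (\<sigma> \<circ> inv \<sigma>) w"
    using permute_list_compose[OF inv, of \<sigma>] by simp
  finally have "permute_list (\<rho> \<circ> inv \<sigma>) w = w"
    using permutes_inv_o(1)[OF assms] by simp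
  moreover have "\<rho> = (\<rho> \<circ> inv \<sigma>) \<circ> \<sigma>"
    using permutes_inv_o(2)[OF assms] by (simp add: comp_assoc)
  ultimately show "\<rho> \<in> {\<tau> \<circ> \<sigma> | \<tau>. \<tau> permutes {..<length w} \<and> permute_list \<tau> w = w}"
    using permutes_compose[OF inv \<rho>(1)] by blast
qed

subsection \<open>Shortest coset representatives\<close>

text \<open>Since \<open>inv \<sigma>\<close> increases on both blocks, an inversion of
  \<open>\<sigma>\<close> has its larger value in the second block and its smaller value in the
  first. A permutation that preserves the blocks keeps this order, so no inversion is lost.\<close>

lemma perm_length_mono:
  assumes "strict_mono_on {..<d} (inv \<sigma>)" "strict_mono_on {d..<d + e} (inv \<sigma>)"
    and \<sigma>: "\<sigma> permutes {..<d + e}" and "\<tau> \<in> young_subgroup d e"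
  shows "perm_length (d + e) \<sigma> \<le> perm_length (d + e) (\<tau> \<circ> \<sigma>)"
proof -
  have \<tau>: "\<tau> permutes {..<d + e}" "\<tau> ` {..<d} = {..<d}"
    using assms(4) by (auto simp: young_subgroup_def)
  have \<tau>d: "\<tau> x < d \<longleftrightarrow> x < d" for x
    using \<tau>(2) permutes_inj[OF \<tau>(1)] by (metis image_iff inj_eq lessThan_iff)
  have "(\<tau> \<circ> \<sigma>) k > (\<tau> \<circ> \<sigma>) l" if "k < l" "l < d + e" "\<sigma> k > \<sigma> l" for k l
  proof -
    have lt: "\<sigma> k < d + e" "\<sigma> l < d + e"
      using permutes_in_image[OF \<sigma>, of k] permutes_in_image[OF \<sigma>, of l] that by auto
    have inv: "inv \<sigma> (\<sigma> k) = k" "inv \<sigma> (\<sigma> l) = l" using \<sigma> by (simp_all add: permutes_inverses)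
    have "\<not> \<sigma> k < d"
      using that strict_mono_onD[OF assms(1), of "\<sigma> l" "\<sigma> k"] inv by auto
    moreover have "\<not> \<sigma> l \<ge> d"
      using that lt strict_mono_onD[OF assms(2), of "\<sigma> l" "\<sigma> k"] inv by auto
    ultimately have "\<tau> (\<sigma> l) < d" "\<not> \<tau> (\<sigma> k) < d" by (simp_all add: \<tau>d)
    then show ?thesis by simp
  qed
  then have "{(k, l). k < l \<and> l < d + e \<and> \<sigma> k > \<sigma> l}
      \<subseteq> {(k, l). k < l \<and> l < d + e \<and> (\<tau> \<circ> \<sigma>) k > (\<tau> \<circ> \<sigma>) l}" by auto
  then show ?thesis unfolding perm_length_def
    by (rule card_mono[rotated])
      (rule finite_subset[of _ "{..<d + e} \<times> {..<d + e}"], auto)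
qed

text \<open>If the value \<open>Suc i\<close> occurs before \<open>i\<close>, exchanging them
  removes this inversion and creates none, because only the relative order of these two values
  changes.\<close>

lemma perm_length_adjacent:
  assumes \<sigma>: "\<sigma> permutes {..<n}" and "Suc i < n" "inv \<sigma> (Suc i) < inv \<sigma> i"
  shows "perm_length n (transpose i (Suc i) \<circ> \<sigma>) < perm_length n \<sigma>"
proof -
  let ?t = "transpose i (Suc i)"
  have inj: "\<sigma> x = \<sigma> y \<longleftrightarrow> x = y" for x y using permutes_inj[OF \<sigma>] by (simp add: inj_eq)
  have inv: "\<sigma> (inv \<sigma> x) = x" for x using \<sigma> by (simp add: permutes_inverses)
  let ?E = "{(k, l). k < l \<and> l < n \<and> \<sigma> k > \<sigma> l}"
  let ?F = "{(k, l). k < l \<and> l < n \<and> (?t \<circ> \<sigma>) k > (?t \<circ> \<sigma>) l}"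
  have "\<sigma> k > \<sigma> l" if kl: "k < l" "l < n" "?t (\<sigma> k) > ?t (\<sigma> l)" for k l
  proof (rule ccontr)
    assume "\<not> \<sigma> k > \<sigma> l"
    then have "\<sigma> k < \<sigma> l" using kl inj[of k l] by auto
    then have "\<sigma> k = i \<and> \<sigma> l = Suc i" using kl(3) by (simp add: transpose_adjacent_inversion)
    then have "k = inv \<sigma> i" "l = inv \<sigma> (Suc i)" using \<sigma> by (metis permutes_inverses(2))+
    then show False using kl(1) assms(3) by simp
  qed
  then have "?F \<subseteq> ?E" by auto
  moreover have "(inv \<sigma> (Suc i), inv \<sigma> i) \<in> ?E"
    using assms permutes_in_image[OF permutes_inv[OF \<sigma>], of i] by (simp add: inv)
  moreover have "(inv \<sigma> (Suc i), inv \<sigma> i) \<notin> ?F" by (simp add: inv)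
  ultimately have "?F \<subset> ?E" by blast
  moreover have "finite ?E" by (rule finite_subset[of _ "{..<n} \<times> {..<n}"]) auto
  ultimately show ?thesis unfolding perm_length_def by (rule psubset_card_mono[rotated])
qed

lemma strict_mono_on_adjacent:
  fixes f :: "nat \<Rightarrow> nat"
  assumes "\<And>i. a \<le> i \<Longrightarrow> Suc i < b \<Longrightarrow> f i < f (Suc i)"
  shows "strict_mono_on {a..<b} f"
proof (rule strict_mono_onI)
  fix r s assume "r \<in> {a..<b}" "s \<in> {a..<b}" "r < s"
  then show "f r < f s"
  proof (induction s)
    case (Suc s)
    then show ?case
      using assms[of s] by (cases "r = s") (auto intro: less_trans)
  qed simp
qed

text \<open>One inclusion is \<open>perm_length_mono\<close>. For the other, a descent of
  \<open>inv \<sigma>\<close> inside a block could be removed by an adjacent transposition from the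
  Young subgroup, which would shorten \<open>\<sigma>\<close>.\<close>

lemma shortest_reps_eq:
  "shortest_reps d e = {\<sigma>. \<sigma> permutes {..<d + e} \<and>
     strict_mono_on {..<d} (inv \<sigma>) \<and> strict_mono_on {d..<d + e} (inv \<sigma>)}"
proof (intro subset_antisym subsetI CollectI)
  fix \<sigma> assume "\<sigma> \<in> shortest_reps d e"
  then have \<sigma>: "\<sigma> permutes {..<d + e}"
    and short: "\<And>\<tau>. \<tau> \<in> young_subgroup d e \<Longrightarrow> perm_length (d + e) \<sigma> \<le> perm_length (d + e) (\<tau> \<circ> \<sigma>)"
    by (auto simp: shortest_reps_def)
  \<comment> \<open>\<open>Suc i \<noteq> d\<close> says that \<open>i\<close> and
    \<open>Suc i\<close> lie in the same block.\<close>
  have "inv \<sigma> i < inv \<sigma> (Suc i)" if "Suc i < d + e" "Suc i \<noteq> d" for i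
  proof (rule ccontr)
    assume "\<not> inv \<sigma> i < inv \<sigma> (Suc i)"
    moreover have "inv \<sigma> i \<noteq> inv \<sigma> (Suc i)"
      using permutes_inj[OF permutes_inv[OF \<sigma>]] by (simp add: inj_eq)
    ultimately have "perm_length (d + e) (transpose i (Suc i) \<circ> \<sigma>) < perm_length (d + e) \<sigma>"
      using perm_length_adjacent[OF \<sigma> that(1)] by simp
    moreover have "transpose i (Suc i) \<in> young_subgroup d e"
    proof -
      have "transpose i (Suc i) permutes {..<d + e}"
        using that by (intro permutes_swap_id) auto
      moreover have "transpose i (Suc i) ` {..<d} = {..<d}"
        using that by (intro transpose_image_eq) auto
      ultimately show ?thesis by (simp add: young_subgroup_def)
    qed
    ultimately show False using short by fastforce
  qed
  then show "\<sigma> permutes {..<d + e} \<and>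
     strict_mono_on {..<d} (inv \<sigma>) \<and> strict_mono_on {d..<d + e} (inv \<sigma>)"
    using \<sigma> strict_mono_on_adjacent[of 0 d "inv \<sigma>"] strict_mono_on_adjacent[of d "d + e" "inv \<sigma>"]
    by (auto simp: lessThan_atLeast0)
next
  fix \<sigma> assume "\<sigma> \<in> {\<sigma>. \<sigma> permutes {..<d + e} \<and>
     strict_mono_on {..<d} (inv \<sigma>) \<and> strict_mono_on {d..<d + e} (inv \<sigma>)}"
  then show "\<sigma> \<in> shortest_reps d e"
    using perm_length_mono unfolding shortest_reps_def by blast
qed

lemma nths_eq_map_filter: "nths w I = map ((!) w) (filter (\<lambda>i. i \<in> I) [0..<length w])"
proof -
  have "zip w [0..<length w] = map (\<lambda>i. (w ! i, i)) [0..<length w]"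
    by (rule nth_equalityI) auto
  then show ?thesis
    by (simp add: nths_def filter_map comp_def)
qed

lemma map_strict_mono_eq_filter:
  assumes "strict_mono_on {a..<b} f" "f ` {a..<b} = I \<inter> {..<n}"
  shows "map f [a..<b] = filter (\<lambda>i. i \<in> I) [0..<n]"
proof (rule strict_sorted_equal)
  have "sorted_wrt (\<lambda>x y. f x < f y) [a..<b]"
    by (rule sorted_wrt_mono_rel[OF _ sorted_wrt_upt[of a b]])
      (use assms(1) in \<open>auto simp: strict_mono_on_def\<close>)
  then show "sorted_wrt (<) (map f [a..<b])" by (simp add: sorted_wrt_map)
  show "sorted_wrt (<) (filter (\<lambda>i. i \<in> I) [0..<n])"
    by (rule sorted_wrt_filter) simp
  show "set (map f [a..<b]) = set (filter (\<lambda>i. i \<in> I) [0..<n])"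
    using assms(2) by auto
qed

text \<open>In one-line notation \<open>inv \<sigma>\<close> lists the set \<open>I\<close>
  increasingly, and then its complement.\<close>

lemma shortest_reps_lists:
  assumes "\<sigma> \<in> shortest_reps d e"
  defines "I \<equiv> inv \<sigma> ` {..<d}"
  shows "map (inv \<sigma>) [0..<d] = filter (\<lambda>i. i \<in> I) [0..<d + e]"
    and "map (inv \<sigma>) [d..<d + e] = filter (\<lambda>i. i \<in> - I) [0..<d + e]"
    and "I \<subseteq> {..<d + e}" and "card I = d"
proof -
  have \<sigma>: "\<sigma> permutes {..<d + e}"
    and mono: "strict_mono_on {..<d} (inv \<sigma>)" "strict_mono_on {d..<d + e} (inv \<sigma>)"
    using assms by (auto simp: shortest_reps_eq)
  have p: "inv \<sigma> permutes {..<d + e}" by (rule permutes_inv[OF \<sigma>])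
  have img: "inv \<sigma> ` {..<d + e} = {..<d + e}" by (rule permutes_image[OF p])
  then show I: "I \<subseteq> {..<d + e}" by (auto simp: I_def)
  show "card I = d"
    unfolding I_def using permutes_inj[OF p] by (simp add: card_image inj_on_subset)
  show "map (inv \<sigma>) [0..<d] = filter (\<lambda>i. i \<in> I) [0..<d + e]"
    by (rule map_strict_mono_eq_filter) (use mono I in \<open>auto simp: lessThan_atLeast0 I_def\<close>)
  have "inv \<sigma> ` {d..<d + e} = inv \<sigma> ` ({..<d + e} - {..<d})"
    by (rule arg_cong[of _ _ "(`) (inv \<sigma>)"]) auto
  also have "\<dots> = {..<d + e} - I"
    unfolding I_def image_set_diff[OF permutes_inj[OF p]] img ..
  finally show "map (inv \<sigma>) [d..<d + e] = filter (\<lambda>i. i \<in> - I) [0..<d + e]"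
    by (intro map_strict_mono_eq_filter mono) auto
qed

lemma shortest_reps_surj:
  assumes I: "I \<subseteq> {..<d + e}" "card I = d"
  shows "\<exists>\<sigma>\<in>shortest_reps d e. inv \<sigma> ` {..<d} = I"
proof -
  let ?A = "filter (\<lambda>i. i \<in> I) [0..<d + e]" and ?B = "filter (\<lambda>i. i \<notin> I) [0..<d + e]"
  \<comment> \<open>\<open>\<pi>\<close> is the inverse of the representative sought: first
    \<open>I\<close>, then its complement, both in increasing order. Outside the range it is the
    identity, as \<open>permutes\<close> demands.\<close>
  define \<pi> where "\<pi> i = (if i < d + e then (?A @ ?B) ! i else i)" for i
  have setA: "set ?A = I" and setB: "set ?B = {..<d + e} - I" using I by auto
  have lenA: "length ?A = d" using I setA distinct_card[of ?A] by simp
  have "card ({..<d + e} - I) = e"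
    using I card_Diff_subset[of I "{..<d + e}"] finite_subset[of I "{..<d + e}"] by simp
  then have lenB: "length ?B = e" using setB distinct_card[of ?B] by simp
  have \<pi>: "\<pi> permutes {..<d + e}"
  proof (rule bij_imp_permutes)
    have "bij_betw ((!) (?A @ ?B)) {..<length (?A @ ?B)} (set (?A @ ?B))"
      by (rule bij_betw_nth) (auto simp: setA setB)
    moreover have "set (?A @ ?B) = {..<d + e}" using I by (simp only: set_append setA setB) auto
    ultimately have "bij_betw ((!) (?A @ ?B)) {..<d + e} {..<d + e}"
      by (simp only: length_append lenA lenB)
    then show "bij_betw \<pi> {..<d + e} {..<d + e}"
      by (rule bij_betw_cong[THEN iffD1, rotated]) (simp add: \<pi>_def)
  qed (simp add: \<pi>_def)
  have invinv: "inv (inv \<pi>) = \<pi>" by (rule permutes_inv_inv[OF \<pi>])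
  have sA: "sorted_wrt (<) ?A" and sB: "sorted_wrt (<) ?B"
    by (rule sorted_wrt_filter, simp)+
  have \<pi>A: "\<pi> i = ?A ! i" if "i < d" for i using that lenA by (simp add: \<pi>_def nth_append)
  have \<pi>B: "\<pi> i = ?B ! (i - d)" if "d \<le> i" "i < d + e" for i
    using that lenA by (simp add: \<pi>_def nth_append)
  have "strict_mono_on {..<d} \<pi>"
  proof (rule strict_mono_onI)
    fix r s assume "r \<in> {..<d}" "s \<in> {..<d}" "r < s"
    then show "\<pi> r < \<pi> s"
      using sorted_wrt_nth_less[OF sA, of r s] by (simp only: \<pi>A lenA lessThan_iff)
  qed
  moreover have "strict_mono_on {d..<d + e} \<pi>"
  proof (rule strict_mono_onI)
    fix r s assume rs: "r \<in> {d..<d + e}" "s \<in> {d..<d + e}" "r < s"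
    then have "?B ! (r - d) < ?B ! (s - d)"
      by (intro sorted_wrt_nth_less[OF sB]) (simp_all only: lenB, auto)
    then show "\<pi> r < \<pi> s" using rs \<pi>B by (simp only: atLeastLessThan_iff)
  qed
  ultimately have "inv \<pi> \<in> shortest_reps d e"
    by (simp add: shortest_reps_eq invinv permutes_inv[OF \<pi>])
  moreover have "inv (inv \<pi>) ` {..<d} = I"
  proof -
    have "\<pi> ` {..<d} = (!) ?A ` {..<d}" by (rule image_cong) (simp_all add: \<pi>A)
    also have "\<dots> = set ?A" using lenA by (auto simp: set_conv_nth)
    finally show ?thesis by (simp only: invinv setA)
  qed
  ultimately show ?thesis by blast
qed

lemma bij_betw_shortest_reps:
  "bij_betw (\<lambda>\<sigma>. inv \<sigma> ` {..<d}) (shortest_reps d e) {I. I \<subseteq> {..<d + e} \<and> card I = d}"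
  (is "bij_betw ?f _ ?Y")
proof (rule bij_betw_imageI)
  show "inj_on ?f (shortest_reps d e)"
  proof (rule inj_onI)
    fix \<sigma> \<sigma>' assume *: "\<sigma> \<in> shortest_reps d e" "\<sigma>' \<in> shortest_reps d e"
      and "inv \<sigma> ` {..<d} = inv \<sigma>' ` {..<d}"
    then have "map (inv \<sigma>) ([0..<d] @ [d..<d + e]) = map (inv \<sigma>') ([0..<d] @ [d..<d + e])"
      using shortest_reps_lists(1,2)[OF *(1)] shortest_reps_lists(1,2)[OF *(2)] by simp
    then have "inv \<sigma> i = inv \<sigma>' i" if "i < d + e" for i
      using that by (auto simp: not_less)
    moreover have p: "\<sigma> permutes {..<d + e}" "\<sigma>' permutes {..<d + e}"
      using * by (auto simp: shortest_reps_def)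
    moreover have "inv \<sigma> i = inv \<sigma>' i" if "\<not> i < d + e" for i
      using that p by (metis lessThan_iff permutes_inv permutes_not_in)
    ultimately have "inv \<sigma> = inv \<sigma>'" by blast
    then show "\<sigma> = \<sigma>'" using p by (metis permutes_inv_inv)
  qed
  show "?f ` shortest_reps d e = ?Y"
  proof
    show "?f ` shortest_reps d e \<subseteq> ?Y"
      using shortest_reps_lists(3,4)[of _ d e] by blast
    show "?Y \<subseteq> ?f ` shortest_reps d e"
    proof
      fix I assume "I \<in> ?Y"
      then have "\<exists>\<sigma>\<in>shortest_reps d e. inv \<sigma> ` {..<d} = I"
        by (intro shortest_reps_surj) simp_all
      then show "I \<in> ?f ` shortest_reps d e" by (metis image_eqI)
    qed
  qed
qed

section \<open>Sums over shortest representatives as signed shuffles\<close>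

context parity
begin

text \<open>An inversion of \<open>inv \<sigma>\<close> joins a position of the first block to one
  of the second. Their images in \<open>w\<close> are a marked position and an earlier unmarked one,
  and these are the pairs counted by \<open>ssign\<close>.\<close>

lemma psign_shortest:
  assumes \<sigma>: "\<sigma> \<in> shortest_reps d e" and len: "length w = d + e"
  shows "psign (permute_list (inv \<sigma>) w) \<sigma> = (ssign (inv \<sigma> ` {..<d}) w :: 'k::comm_ring_1)"
proof -
  let ?\<pi> = "inv \<sigma>" and ?I = "inv \<sigma> ` {..<d}"
  have p: "\<sigma> permutes {..<d + e}"
    and mono: "strict_mono_on {..<d} ?\<pi>" "strict_mono_on {d..<d + e} ?\<pi>"
    using \<sigma> by (auto simp: shortest_reps_eq)
  have pi: "?\<pi> permutes {..<length w}" using permutes_inv[OF p] len by simp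
  have inv: "\<sigma> (?\<pi> x) = x" "?\<pi> (\<sigma> x) = x" for x using p by (simp_all add: permutes_inverses)
  have lt: "?\<pi> x < d + e \<longleftrightarrow> x < d + e" "\<sigma> x < d + e \<longleftrightarrow> x < d + e" for x
    using permutes_in_image[OF pi, of x] permutes_in_image[OF p, of x] len by simp_all
  have I: "x \<in> ?I \<longleftrightarrow> \<sigma> x < d" for x
    using inv by (metis imageE image_eqI lessThan_iff)
  let ?E = "{(k, l). k < l \<and> l < length (permute_list ?\<pi> w) \<and> ?\<pi> k > ?\<pi> l \<and>
     par (permute_list ?\<pi> w ! k) = 1 \<and> par (permute_list ?\<pi> w ! l) = 1}"
  let ?F = "{(i, j). i < j \<and> j < length w \<and> i \<notin> ?I \<and> j \<in> ?I \<and> par (w ! i) = 1 \<and> par (w ! j) = 1}"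
  have "bij_betw (\<lambda>(k, l). (?\<pi> l, ?\<pi> k)) ?E ?F"
  proof (rule bij_betwI[where g = "\<lambda>(i, j). (\<sigma> j, \<sigma> i)"])
    show "(\<lambda>(k, l). (?\<pi> l, ?\<pi> k)) \<in> ?E \<rightarrow> ?F"
    proof
      fix p assume "p \<in> ?E"
      then obtain k l where p: "p = (k, l)" and kl: "k < l" "l < length (permute_list ?\<pi> w)" "?\<pi> k > ?\<pi> l"
        "par (permute_list ?\<pi> w ! k) = 1" "par (permute_list ?\<pi> w ! l) = 1"
        by blast
      have "\<not> l < d" using kl strict_mono_onD[OF mono(1), of k l] by auto
      moreover have "\<not> d \<le> k" using kl len strict_mono_onD[OF mono(2), of k l] by auto
      ultimately show "(\<lambda>(k, l). (?\<pi> l, ?\<pi> k)) p \<in> ?F"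
        using kl len by (simp add: p I inv lt permute_list_nth[OF pi] del: image_iff)
    qed
    show "(\<lambda>(i, j). (\<sigma> j, \<sigma> i)) \<in> ?F \<rightarrow> ?E"
    proof
      fix p assume "p \<in> ?F"
      then obtain i j where p: "p = (i, j)" and ij: "i < j" "j < length w" "i \<notin> ?I" "j \<in> ?I"
        "par (w ! i) = 1" "par (w ! j) = 1"
        by blast
      then have "i < d + e" "j < d + e" using len by simp_all
      then show "(\<lambda>(i, j). (\<sigma> j, \<sigma> i)) p \<in> ?E"
        using ij len by (simp add: p I inv lt permute_list_nth[OF pi] del: image_iff)
    qed
  qed (auto simp: inv)
  then have "card ?E = card ?F" by (rule bij_betw_same_card)
  then show ?thesis unfolding psign_def ssign_def by (simp only:)
qed

lemma take_drop_shortest: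
  assumes \<sigma>: "\<sigma> \<in> shortest_reps d e" and len: "length w = d + e"
  shows "take d (permute_list (inv \<sigma>) w) = nths w (inv \<sigma> ` {..<d})"
    and "drop d (permute_list (inv \<sigma>) w) = nths w (- (inv \<sigma> ` {..<d}))"
proof -
  have eq: "permute_list (inv \<sigma>) w = map ((!) w) (map (inv \<sigma>) [0..<d] @ map (inv \<sigma>) [d..<d + e])"
    using upt_add_eq_append[of 0 d e] by (simp add: permute_list_def len)
  show "take d (permute_list (inv \<sigma>) w) = nths w (inv \<sigma> ` {..<d})"
    unfolding eq nths_eq_map_filter len shortest_reps_lists(1)[OF \<sigma>, symmetric] by simp
  show "drop d (permute_list (inv \<sigma>) w) = nths w (- (inv \<sigma> ` {..<d}))"
    unfolding eq nths_eq_map_filter len shortest_reps_lists(2)[OF \<sigma>, symmetric] by simp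
qed

text \<open>The summand is the coordinate at \<open>w\<close> of a permuted tensor: the factors are
  read off from the first \<open>d\<close> and the last \<open>e\<close> letters of
  \<open>permute_list (inv \<sigma>) w\<close>.\<close>

lemma sum_shortest_reps:
  assumes len: "length w = d + e" and f: "\<And>v. f v \<noteq> 0 \<Longrightarrow> length v = d"
  shows "(\<Sum>\<sigma>\<in>shortest_reps d e. psign (permute_list (inv \<sigma>) w) \<sigma> *
     (f (take d (permute_list (inv \<sigma>) w)) * g (drop d (permute_list (inv \<sigma>) w)))) = shuf f g w"
proof -
  let ?h = "\<lambda>I. ssign I w * (f (nths w I) * g (nths w (- I)))"
  have "(\<Sum>\<sigma>\<in>shortest_reps d e. psign (permute_list (inv \<sigma>) w) \<sigma> *
     (f (take d (permute_list (inv \<sigma>) w)) * g (drop d (permute_list (inv \<sigma>) w))))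
     = (\<Sum>\<sigma>\<in>shortest_reps d e. ?h (inv \<sigma> ` {..<d}))"
    by (intro sum.cong refl) (simp only: psign_shortest[OF _ len] take_drop_shortest[OF _ len])
  also have "\<dots> = (\<Sum>I\<in>{I. I \<subseteq> {..<d + e} \<and> card I = d}. ?h I)"
    by (rule sum.reindex_bij_betw[OF bij_betw_shortest_reps])
  \<comment> \<open>Subsets of another size contribute 0, since \<open>f\<close> is supported on
    words of length \<open>d\<close>.\<close>
  also have "\<dots> = (\<Sum>I\<in>Pow {..<length w}. ?h I)"
  proof (rule sum.mono_neutral_left)
    show "\<forall>I\<in>Pow {..<length w} - {I. I \<subseteq> {..<d + e} \<and> card I = d}. ?h I = 0"
    proof
      fix I assume I: "I \<in> Pow {..<length w} - {I. I \<subseteq> {..<d + e} \<and> card I = d}"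
      then have "{i. i < length w \<and> i \<in> I} = I" by auto
      then have "length (nths w I) \<noteq> d" using I len by (simp add: length_nths)
      then show "?h I = 0" using f[of "nths w I"] by (cases "f (nths w I) = 0") auto
    qed
  qed (auto simp: len)
  finally show ?thesis by (simp add: shuf_subsets)
qed

end

section \<open>Linear maps, presentations and coordinates\<close>

lemma module_mult: "module ((*) :: 'k::comm_ring_1 \<Rightarrow> 'k \<Rightarrow> 'k)"
  by unfold_locales (simp_all add: algebra_simps)

lemma linear_onI:
  assumes "\<And>x y. x \<in> M \<Longrightarrow> y \<in> M \<Longrightarrow> f (x + y) = f x + f y"
    and "\<And>c x. x \<in> M \<Longrightarrow> f (sc c x) = sc' c (f x)"
  shows "linear_on sc M sc' f"
  using assms by (simp add: linear_on_def)

lemma linear_onD: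
  assumes "linear_on sc M sc' f"
  shows "x \<in> M \<Longrightarrow> y \<in> M \<Longrightarrow> f (x + y) = f x + f y"
    and "x \<in> M \<Longrightarrow> f (sc c x) = sc' c (f x)"
  using assms by (simp_all add: linear_on_def)

lemma linear_on_subset: "linear_on sc M sc' f \<Longrightarrow> N \<subseteq> M \<Longrightarrow> linear_on sc N sc' f"
  unfolding linear_on_def by (meson subsetD)

lemma bilinear_onD:
  assumes "bilinear_on sc M sc' N sc'' f"
  shows "y \<in> N \<Longrightarrow> linear_on sc M sc'' (\<lambda>x. f x y)"
    and "x \<in> M \<Longrightarrow> linear_on sc' N sc'' (f x)"
  using assms by (simp_all add: bilinear_on_def)

lemma bilinear_on_subset:
  assumes "bilinear_on sc M sc' N sc'' f" "M' \<subseteq> M" "N' \<subseteq> N"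
  shows "bilinear_on sc M' sc' N' sc'' f"
  unfolding bilinear_on_def
proof (intro conjI ballI)
  show "linear_on sc M' sc'' (\<lambda>x. f x y)" if "y \<in> N'" for y
    using linear_on_subset[OF bilinear_onD(1)[OF assms(1)] assms(2)] assms(3) that by blast
  show "linear_on sc' N' sc'' (f x)" if "x \<in> M'" for x
    using linear_on_subset[OF bilinear_onD(2)[OF assms(1)] assms(3)] assms(2) that by blast
qed

context
  fixes sc :: "'k::comm_ring_1 \<Rightarrow> 'v::ab_group_add \<Rightarrow> 'v" and sc' :: "'k \<Rightarrow> 'w::ab_group_add \<Rightarrow> 'w"
  assumes sc: "module sc" and sc': "module sc'"
begin

interpretation V: module sc by (rule sc)
interpretation W: module sc' by (rule sc')

lemma linear_on_0: "linear_on sc M sc' f \<Longrightarrow> 0 \<in> M \<Longrightarrow> f 0 = 0"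
  using linear_onD(1)[of sc M sc' f 0 0] by simp

lemma linear_on_diff:
  assumes "linear_on sc M sc' f" "V.subspace M" "x \<in> M" "y \<in> M"
  shows "f (x - y) = f x - f y"
  using linear_onD(1)[OF assms(1), of "x - y" y] assms by (simp add: V.subspace_diff)

lemma linear_on_sum:
  assumes f: "linear_on sc M sc' f" and M: "V.subspace M" and g: "\<And>i. i \<in> I \<Longrightarrow> g i \<in> M"
  shows "f (sum g I) = (\<Sum>i\<in>I. f (g i))"
proof (cases "finite I")
  case True
  then show ?thesis using g
  proof (induction I)
    case empty
    then show ?case using linear_on_0[OF f] M by (simp add: V.subspace_0)
  next
    case (insert i I)
    then show ?case
      using linear_onD(1)[OF f, of "g i" "sum g I"] V.subspace_sum[OF M, of I g] by simp
  qed
qed (use linear_on_0[OF f] M in \<open>simp add: V.subspace_0\<close>)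

lemma linear_on_image_span:
  assumes f: "linear_on sc M sc' f" and M: "V.subspace M" "S \<subseteq> M"
    and N: "W.subspace N" "\<And>x. x \<in> S \<Longrightarrow> f x \<in> N" and x: "x \<in> V.span S"
  shows "f x \<in> N"
proof -
  have SM: "V.span S \<subseteq> M" using M by (simp add: V.span_minimal)
  \<comment> \<open>Membership in the span is carried along because \<open>f\<close> is linear only
    on \<open>M\<close>.\<close>
  have "x \<in> V.span S \<and> f x \<in> N"
    using x
  proof (induction rule: V.span_induct_alt)
    case base
    show ?case using linear_on_0[OF f] M(1) N(1) by (simp add: V.span_zero V.subspace_0 W.subspace_0)
  next
    case (step c x y)
    have "x \<in> M" "y \<in> M" using step M SM by auto
    then have "f (sc c x + y) = sc' c (f x) + f y"
      using M by (simp add: linear_onD[OF f] V.subspace_scale)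
    then show ?case
      using step N by (simp add: V.span_add V.span_scale V.span_base W.subspace_add W.subspace_scale)
  qed
  then show ?thesis by simp
qed

lemma linear_on_eq_on_span:
  assumes f: "linear_on sc M sc' f" and g: "linear_on sc M sc' g" and M: "V.subspace M" "S \<subseteq> M"
    and eq: "\<And>x. x \<in> S \<Longrightarrow> f x = g x" and x: "x \<in> V.span S"
  shows "f x = g x"
proof -
  have "linear_on sc M sc' (\<lambda>x. f x - g x)"
    by (rule linear_onI) (simp_all add: linear_onD[OF f] linear_onD[OF g] W.scale_right_diff_distrib)
  from linear_on_image_span[OF this M W.subspace_single_0 _ x] eq show ?thesis by simp
qed

end

lemma bilinear_on_eq_on_span:
  assumes m: "module sc" "module sc'" "module sc''"
    and f: "bilinear_on sc M sc' N sc'' f" and g: "bilinear_on sc M sc' N sc'' g"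
    and M: "module.subspace sc M" "S \<subseteq> M" and N: "module.subspace sc' N" "R \<subseteq> N"
    and eq: "\<And>x y. x \<in> S \<Longrightarrow> y \<in> R \<Longrightarrow> f x y = g x y"
    and x: "x \<in> module.span sc S" and y: "y \<in> module.span sc' R"
  shows "f x y = g x y"
proof -
  have y': "y \<in> N" using y N module.span_minimal[OF m(2)] by blast
  show ?thesis
  proof (rule linear_on_eq_on_span[OF m(1,3) bilinear_onD(1)[OF f y'] bilinear_onD(1)[OF g y'] M _ x])
    fix x assume x: "x \<in> S"
    then have "x \<in> M" using M by auto
    then show "f x y = g x y"
      using linear_on_eq_on_span[OF m(2,3) bilinear_onD(2)[OF f] bilinear_onD(2)[OF g] N eq[OF x] y]
      by blast
  qed
qed

section \<open>Free modules and the universal property of a presentation\<close>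

lemma lookup_free_scale [simp]:
  "Poly_Mapping.lookup (free_scale c p) x = c * Poly_Mapping.lookup p x"
  unfolding free_scale_def by (transfer) (simp add: when_def)

lemma keys_free_scale: "Poly_Mapping.keys (free_scale c p) \<subseteq> Poly_Mapping.keys p"
  by (auto simp: in_keys_iff)

lemma module_free_scale: "module free_scale"
  by unfold_locales (auto intro!: poly_mapping_eqI simp: lookup_add algebra_simps)

context
begin

interpretation F: module free_scale by (rule module_free_scale)

lemma subspace_keys: "F.subspace {p :: 'x \<Rightarrow>\<^sub>0 'k::comm_ring_1. Poly_Mapping.keys p \<subseteq> X}"
proof (rule F.subspaceI)
  show "p + q \<in> {p. Poly_Mapping.keys p \<subseteq> X}"
    if "p \<in> {p. Poly_Mapping.keys p \<subseteq> X}" "q \<in> {p. Poly_Mapping.keys p \<subseteq> X}" for p q :: "'x \<Rightarrow>\<^sub>0 'k"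
    using that keys_add[of p q] by auto
  show "free_scale c p \<in> {p. Poly_Mapping.keys p \<subseteq> X}"
    if "p \<in> {p. Poly_Mapping.keys p \<subseteq> X}" for c and p :: "'x \<Rightarrow>\<^sub>0 'k"
    using that keys_free_scale[of c p] by blast
qed simp

lemma span_gen: "F.span (gen ` X) = {p :: 'x \<Rightarrow>\<^sub>0 'k::comm_ring_1. Poly_Mapping.keys p \<subseteq> X}"
proof
  show "F.span (gen ` X) \<subseteq> {p :: 'x \<Rightarrow>\<^sub>0 'k::comm_ring_1. Poly_Mapping.keys p \<subseteq> X}"
    by (rule F.span_minimal[OF _ subspace_keys]) auto
  show "{p :: 'x \<Rightarrow>\<^sub>0 'k::comm_ring_1. Poly_Mapping.keys p \<subseteq> X} \<subseteq> F.span (gen ` X)"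
  proof
    fix p :: "'x \<Rightarrow>\<^sub>0 'k" assume "p \<in> {p. Poly_Mapping.keys p \<subseteq> X}"
    then have "(\<Sum>x\<in>Poly_Mapping.keys p. free_scale (Poly_Mapping.lookup p x) (gen x)) \<in> F.span (gen ` X)"
      by (intro F.span_sum F.span_scale F.span_base) auto
    also have "(\<Sum>x\<in>Poly_Mapping.keys p. free_scale (Poly_Mapping.lookup p x) (gen x)) = p"
      by (rule poly_mapping_eqI)
        (simp add: lookup_sum lookup_single when_def in_keys_iff if_distrib cong: if_cong)
    finally show "p \<in> F.span (gen ` X)" .
  qed
qed

end

context
  fixes sc :: "'k::comm_ring_1 \<Rightarrow> 'v::ab_group_add \<Rightarrow> 'v"
  assumes sc: "module sc"
begin

interpretation V: module sc by (rule sc)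
interpretation F: module free_scale by (rule module_free_scale)

lemma lincomb_superset:
  assumes "finite S" "Poly_Mapping.keys p \<subseteq> S"
  shows "lincomb sc g p = (\<Sum>x\<in>S. sc (Poly_Mapping.lookup p x) (g x))"
  unfolding lincomb_def using assms
  by (intro sum.mono_neutral_left) (auto simp: in_keys_iff)

lemma linear_lincomb:
  fixes g :: "'x \<Rightarrow> 'v"
  shows "linear_on free_scale UNIV sc (lincomb sc g)"
proof (rule linear_onI)
  fix p q :: "'x \<Rightarrow>\<^sub>0 'k"
  let ?S = "Poly_Mapping.keys p \<union> Poly_Mapping.keys q"
  have "Poly_Mapping.keys (p + q) \<subseteq> ?S" by (rule keys_add)
  then show "lincomb sc g (p + q) = lincomb sc g p + lincomb sc g q"
    by (simp add: lincomb_superset[of ?S] lookup_add V.scale_left_distrib sum.distrib)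
next
  fix c and p :: "'x \<Rightarrow>\<^sub>0 'k"
  from keys_free_scale[of c p] show "lincomb sc g (free_scale c p) = sc c (lincomb sc g p)"
    by (simp add: lincomb_superset[of "Poly_Mapping.keys p"] V.scale_sum_right)
qed

lemma lincomb_gen [simp]: "lincomb sc g (gen x) = g x"
  by (simp add: lincomb_superset[of "{x}"])

lemma lincomb_diff: "lincomb sc g (p - q) = lincomb sc g p - lincomb sc g q"
  by (rule linear_on_diff[OF module_free_scale sc linear_lincomb]) auto

lemma lincomb_scale: "lincomb sc g (free_scale c p) = sc c (lincomb sc g p)"
  by (rule linear_onD(2)[OF linear_lincomb]) simp

lemma lincomb_add: "lincomb sc g (p + q) = lincomb sc g p + lincomb sc g q"
  by (rule linear_onD(1)[OF linear_lincomb]) simp_all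

lemma lincomb_span:
  fixes g :: "'x \<Rightarrow> 'v"
  shows "{lincomb sc g p | p. Poly_Mapping.keys p \<subseteq> X} = V.span (g ` X)"
proof -
  interpret hom: module_hom free_scale sc "lincomb sc g"
    by unfold_locales (simp_all add: lincomb_add lincomb_scale)
  have "{lincomb sc g p | p. Poly_Mapping.keys p \<subseteq> X} = lincomb sc g ` F.span (gen ` X)"
    unfolding span_gen by auto
  also have "\<dots> = V.span (lincomb sc g ` gen ` X)" by (rule hom.span_image[symmetric])
  also have "lincomb sc g ` gen ` X = g ` X" by (simp add: image_image)
  finally show ?thesis .
qed

end

text \<open>The value at \<open>y\<close> is computed from any preimage in the free module. Two
  preimages differ by an element of the span of \<open>R\<close>, which \<open>h\<close>
  kills.\<close>

lemma presented_by_lift: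
  assumes pres: "presented_by sc X R g" and sc': "module sc'"
    and R: "\<And>r. r \<in> R \<Longrightarrow> lincomb sc' h r = 0"
  shows "\<exists>f. linear_on sc (module.span sc (g ` X)) sc' f \<and> (\<forall>x\<in>X. f (g x) = h x)"
proof -
  interpret F: module free_scale by (rule module_free_scale)
  have sc: "module sc" using pres by (simp add: presented_by_def)
  interpret V: module sc by (rule sc)
  interpret W: module sc' by (rule sc')
  have kill: "lincomb sc' h r = 0" if "r \<in> F.span R" for r
    using linear_on_image_span[OF module_free_scale sc' linear_lincomb[OF sc'] F.subspace_UNIV _
        W.subspace_single_0 _ that] R by auto
  define P where "P y p \<longleftrightarrow> Poly_Mapping.keys p \<subseteq> X \<and> lincomb sc g p = y" for y p
  have wd: "lincomb sc' h p = lincomb sc' h q" if "P y p" "P y q" for y p q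
  proof -
    have "Poly_Mapping.keys (p - q) \<subseteq> X" using that keys_diff[of p q] by (auto simp: P_def)
    moreover have "lincomb sc g (p - q) = 0" using that by (simp add: P_def lincomb_diff[OF sc])
    ultimately have "p - q \<in> F.span R" using pres by (simp add: presented_by_def)
    from kill[OF this] show ?thesis by (simp add: lincomb_diff[OF sc'])
  qed
  define f where "f y = lincomb sc' h (SOME p. P y p)" for y
  have f: "f y = lincomb sc' h p" if "P y p" for y p
    unfolding f_def using that by (metis wd someI)
  have ex: "\<exists>p. P y p" if "y \<in> V.span (g ` X)" for y
    using that unfolding lincomb_span[OF sc, symmetric] P_def by auto
  have "linear_on sc (V.span (g ` X)) sc' f"
  proof (rule linear_onI)
    fix x y assume "x \<in> V.span (g ` X)" "y \<in> V.span (g ` X)"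
    then obtain p q where pq: "P x p" "P y q" using ex by blast
    then have "P (x + y) (p + q)" using keys_add[of p q] by (auto simp: P_def lincomb_add[OF sc])
    then show "f (x + y) = f x + f y" using pq by (simp add: f lincomb_add[OF sc'])
  next
    fix c x assume "x \<in> V.span (g ` X)"
    then obtain p where p: "P x p" using ex by blast
    then have "P (sc c x) (free_scale c p)"
      using keys_free_scale[of c p] by (auto simp: P_def lincomb_scale[OF sc])
    then show "f (sc c x) = sc' c (f x)" using p by (simp add: f lincomb_scale[OF sc'])
  qed
  moreover have "f (g x) = h x" if "x \<in> X" for x
  proof -
    have "P (g x) (gen x)" using that by (simp add: P_def lincomb_gen[OF sc])
    then show ?thesis by (simp add: f lincomb_gen[OF sc'])
  qed
  ultimately show ?thesis by blast
qed

lemma independent_Un: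
  assumes m: "module sc" and "\<not> module.dependent sc X" "\<not> module.dependent sc Y"
    and 0: "module.span sc X \<inter> module.span sc Y = {0}"
  shows "\<not> module.dependent sc (X \<union> Y)"
proof
  interpret module sc by (rule m)
  assume "dependent (X \<union> Y)"
  then obtain t u v where t: "finite t" "t \<subseteq> X \<union> Y" "(\<Sum>v\<in>t. sc (u v) v) = 0" "v \<in> t" "u v \<noteq> 0"
    unfolding dependent_explicit by blast
  let ?x = "\<Sum>v\<in>t \<inter> X. sc (u v) v" and ?y = "\<Sum>v\<in>t - X. sc (u v) v"
  have xy: "?x + ?y = 0" using t(1,3) sum.Int_Diff[of t "\<lambda>v. sc (u v) v" X] by simp
  have "?x \<in> span X" by (intro span_sum span_scale span_base) auto
  moreover have y: "?y \<in> span Y" using t(2) by (intro span_sum span_scale span_base) auto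
  moreover have "?x = - ?y" using xy by (simp add: eq_neg_iff_add_eq_0)
  ultimately have "?x \<in> span X \<inter> span Y" by (metis IntI span_neg)
  then have "?x = 0" using 0 by blast
  moreover from this have "?y = 0" using xy by simp
  moreover have "v \<in> t \<inter> X \<or> v \<in> t - X" using t(4) by auto
  ultimately have "dependent X \<or> dependent Y"
    unfolding dependent_explicit using t(1,2,5)
    by (metis (no_types, lifting) Diff_subset_conv finite_Diff finite_Int inf_le2)
  then show False using assms by auto
qed

subsection \<open>Tensor products\<close>

lemma tensor_span_eq: "tensor_span sc tn M N = module.span sc ((\<lambda>(x, y). tn x y) ` (M \<times> N))"
  unfolding tensor_span_def by (rule arg_cong[of _ _ "module.span sc"]) auto

lemma bilinear_relations_lincomb:
  assumes "module scW" "bilinear_on sc M sc' N scW \<phi>" "r \<in> bilinear_relations sc M sc' N"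
    "module.subspace sc M" "module.subspace sc' N" "module sc" "module sc'"
  shows "lincomb scW (\<lambda>(x, y). \<phi> x y) r = 0"
proof -
  note b = linear_onD[OF bilinear_onD(1)[OF assms(2)]] linear_onD[OF bilinear_onD(2)[OF assms(2)]]
  show ?thesis
    using assms(3) unfolding bilinear_relations_def
    by (auto simp: lincomb_diff[OF assms(1)] lincomb_gen[OF assms(1)] lincomb_scale[OF assms(1)] b)
qed

lemma tensor_product_module: "tensor_product sc M sc' N sc'' tn \<Longrightarrow> module sc''"
  by (simp add: tensor_product_def presented_by_def)

lemma tensor_lift:
  assumes "tensor_product sc M sc' N sc'' tn" "module sc" "module sc'" "module scW"
    and "module.subspace sc M" "module.subspace sc' N"
    and "bilinear_on sc M sc' N scW \<phi>"
  shows "\<exists>f. linear_on sc'' (tensor_span sc'' tn M N) scW f \<and> (\<forall>x\<in>M. \<forall>y\<in>N. f (tn x y) = \<phi> x y)"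
  using presented_by_lift[OF assms(1)[unfolded tensor_product_def] assms(4)
      bilinear_relations_lincomb[OF assms(4,7) _ assms(5,6,2,3)]]
  unfolding tensor_span_eq by auto

text \<open>Because \<open>M\<close> and \<open>N\<close> are submodules, the bilinear relations are
  supported on pairs in \<open>M \<times> N\<close>; the presentation therefore applies to them and
  gives 0.\<close>

lemma tensor_bilinear:
  fixes sc :: "'k::comm_ring_1 \<Rightarrow> 'v::ab_group_add \<Rightarrow> 'v" and sc' :: "'k \<Rightarrow> 'w::ab_group_add \<Rightarrow> 'w"
  assumes t: "tensor_product sc M sc' N sc'' tn" and m: "module sc" "module sc'"
    and s: "module.subspace sc M" "module.subspace sc' N"
  shows "bilinear_on sc M sc' N sc'' tn"
proof -
  interpret F: module free_scale by (rule module_free_scale)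
  interpret V: module sc by (rule m(1))
  interpret W: module sc' by (rule m(2))
  have m'': "module sc''" by (rule tensor_product_module[OF t])
  interpret U: module sc'' by (rule m'')
  let ?R = "bilinear_relations sc M sc' N"
  have "Poly_Mapping.keys r \<subseteq> M \<times> N" if "r \<in> ?R" for r
    using that V.subspace_add[OF s(1)] V.subspace_scale[OF s(1)] W.subspace_add[OF s(2)]
      W.subspace_scale[OF s(2)] unfolding bilinear_relations_def
    by (auto simp: in_keys_iff lookup_minus lookup_single when_def split: if_splits)
  then have 0: "lincomb sc'' (\<lambda>(x, y). tn x y) r = 0" if "r \<in> ?R" for r
    using t F.span_base[OF that] that unfolding tensor_product_def presented_by_def by blast
  note l = lincomb_diff[OF m''] lincomb_gen[OF m''] lincomb_scale[OF m'']
  have 1: "tn (x + x') y - tn x y - tn x' y = 0" if "x \<in> M" "x' \<in> M" "y \<in> N" for x x' y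
  proof -
    have "gen (x + x', y) - gen (x, y) - gen (x', y) \<in> ?R"
      using that unfolding bilinear_relations_def by blast
    from 0[OF this] show ?thesis by (simp add: l)
  qed
  have 2: "tn x (y + y') - tn x y - tn x y' = 0" if "x \<in> M" "y \<in> N" "y' \<in> N" for x y y'
  proof -
    have "gen (x, y + y') - gen (x, y) - gen (x, y') \<in> ?R"
      using that unfolding bilinear_relations_def by blast
    from 0[OF this] show ?thesis by (simp add: l)
  qed
  have 3: "tn (sc c x) y = sc'' c (tn x y)" "tn x (sc' c y) = sc'' c (tn x y)"
    if "x \<in> M" "y \<in> N" for c x y
  proof -
    have "gen (sc c x, y) - free_scale c (gen (x, y)) \<in> ?R"
      "gen (x, sc' c y) - free_scale c (gen (x, y)) \<in> ?R"
      using that unfolding bilinear_relations_def by blast+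
    from this[THEN 0] show "tn (sc c x) y = sc'' c (tn x y)" "tn x (sc' c y) = sc'' c (tn x y)"
      by (simp_all add: l)
  qed
  show ?thesis unfolding bilinear_on_def linear_on_def
    using 1 2 3 by (auto simp: diff_eq_eq add.commute)
qed

text \<open>The map \<open>F\<close> is bilinear modulo \<open>S\<close>.\<close>

lemma bilinear_generators:
  assumes m: "module sc" "module sc'" "module sc''" and S: "module.subspace sc'' S"
    and "\<And>x x' y. x \<in> M \<Longrightarrow> x' \<in> M \<Longrightarrow> y \<in> N \<Longrightarrow> F (x + x') y - F x y - F x' y \<in> S"
    and "\<And>x y y'. x \<in> M \<Longrightarrow> y \<in> N \<Longrightarrow> y' \<in> N \<Longrightarrow> F x (y + y') - F x y - F x y' \<in> S"
    and "\<And>c x y. x \<in> M \<Longrightarrow> y \<in> N \<Longrightarrow> F (sc c x) y - sc'' c (F x y) \<in> S"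
    and "\<And>c x y. x \<in> M \<Longrightarrow> y \<in> N \<Longrightarrow> F x (sc' c y) - sc'' c (F x y) \<in> S"
    and XY: "\<And>x y. x \<in> X \<Longrightarrow> y \<in> Y \<Longrightarrow> F x y \<in> S"
    and M: "M = module.span sc X" and N: "N = module.span sc' Y"
    and x: "x \<in> M" and y: "y \<in> N"
  shows "F x y \<in> S"
proof -
  interpret V: module sc by (rule m(1))
  interpret W: module sc' by (rule m(2))
  interpret U: module sc'' by (rule m(3))
  have diff: "a \<in> S" if "a - b \<in> S" "b \<in> S" for a b
    using U.subspace_add[OF S that] by simp
  have 1: "F (x + x') y \<in> S" if "x \<in> M" "x' \<in> M" "y \<in> N" "F x y \<in> S" "F x' y \<in> S" for x x' y
    using assms(5)[OF that(1-3)] that(4,5) diff by blast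
  have 2: "F x (y + y') \<in> S" if "x \<in> M" "y \<in> N" "y' \<in> N" "F x y \<in> S" "F x y' \<in> S" for x y y'
    using assms(6)[OF that(1-3)] that(4,5) diff by blast
  have 3: "F (sc c x) y \<in> S" if "x \<in> M" "y \<in> N" "F x y \<in> S" for c x y
    using assms(7)[OF that(1-2), of c] that(3) diff U.subspace_scale[OF S] by blast
  have 4: "F x (sc' c y) \<in> S" if "x \<in> M" "y \<in> N" "F x y \<in> S" for c x y
    using assms(8)[OF that(1-2), of c] that(3) diff U.subspace_scale[OF S] by blast
  have 00: "F x 0 \<in> S" if "x \<in> M" for x
    using assms(8)[OF that, of 0 0] W.span_zero N by simp
  have 01: "F 0 y \<in> S" if "y \<in> N" for y
    using assms(7)[OF _ that, of 0 0] V.span_zero M by simp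
  have xX: "F x y \<in> S" if "x \<in> X" "y \<in> N" for x y
  proof -
    have xM: "x \<in> M" using that M V.span_base by blast
    have "y \<in> N \<and> F x y \<in> S"
      using that(2) unfolding N
    proof (induction rule: W.span_induct_alt)
      case base
      then show ?case using 00[OF xM] W.span_zero by simp
    next
      case (step c y z)
      then show ?case
        using 2[OF xM, of "sc' c y" z] 4[OF xM, of y c] XY[OF that(1)] N
        by (simp add: W.span_base W.span_scale W.span_add)
    qed
    then show ?thesis by simp
  qed
  have "x \<in> M \<and> F x y \<in> S"
    using x unfolding M
  proof (induction rule: V.span_induct_alt)
    case base
    then show ?case using 01[OF y] V.span_zero by simp
  next
    case (step c x z)
    then show ?case
      using 1[of "sc c x" z y] 3[of x y c] xX[of x y] y M
      by (simp add: V.span_base V.span_scale V.span_add)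
  qed
  then show ?thesis by simp
qed

text \<open>
  A spanning family of \<open>M \<subseteq> M\<^sub>0\<close> which is diagonalized by functionals on \<open>M\<^sub>0\<close>; in particular \<open>M\<close> is
  free, but it need not be a direct summand of \<open>M\<^sub>0\<close>.
\<close>

definition diag_family ::
  "('k::comm_ring_1 \<Rightarrow> 'v::ab_group_add \<Rightarrow> 'v) \<Rightarrow> 'v set \<Rightarrow> 'v set \<Rightarrow> 'i set \<Rightarrow> ('i \<Rightarrow> 'v)
    \<Rightarrow> ('i \<Rightarrow> 'v \<Rightarrow> 'k) \<Rightarrow> bool" where
  "diag_family sc M0 M I b \<phi> \<longleftrightarrow> module.subspace sc M0 \<and> M \<subseteq> M0 \<and> M = module.span sc (b ` I) \<and>
     (\<forall>i\<in>I. linear_on sc M0 (*) (\<phi> i)) \<and> (\<forall>i\<in>I. \<forall>j\<in>I. \<phi> i (b j) \<noteq> 0 \<longleftrightarrow> i = j)"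

lemma tensor_span_mono:
  assumes "module sc" "M \<subseteq> M'" "N \<subseteq> N'"
  shows "tensor_span sc tn M N \<subseteq> tensor_span sc tn M' N'"
  unfolding tensor_span_def using assms(2,3) by (intro module.span_mono[OF assms(1)]) blast

text \<open>Modulo the bilinear relations, an element of the free module on
  \<open>M \<times> N\<close> reduces to pairs \<open>(b i, b' j)\<close>. The functionals
  \<open>\<phi> i \<otimes> \<phi>' j\<close> live on the ambient tensor product and isolate each
  coefficient up to a factor that is nonzero in a domain, so no further relations hold. They are
  returned in order that the result can be applied again to the tensor product.\<close>

lemma diag_family_tensor:
  fixes sc :: "'k::idom \<Rightarrow> 'v::ab_group_add \<Rightarrow> 'v" and sc' :: "'k \<Rightarrow> 'w::ab_group_add \<Rightarrow> 'w"
    and sc'' :: "'k \<Rightarrow> 'u::ab_group_add \<Rightarrow> 'u"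
  assumes m: "module sc" "module sc'" and t: "tensor_product sc M0 sc' N0 sc'' tn"
    and dM: "diag_family sc M0 M I b \<phi>" and dN: "diag_family sc' N0 N J b' \<phi>'"
  shows "tensor_product sc M sc' N sc'' tn"
    and "\<exists>\<psi>. diag_family sc'' (tensor_span sc'' tn M0 N0) (tensor_span sc'' tn M N) (I \<times> J)
        (\<lambda>(i, j). tn (b i) (b' j)) \<psi> \<and>
      (\<forall>i\<in>I. \<forall>j\<in>J. \<forall>x\<in>M0. \<forall>y\<in>N0. \<psi> (i, j) (tn x y) = \<phi> i x * \<phi>' j y)"
proof -
  interpret F: module free_scale by (rule module_free_scale)
  interpret V: module sc by (rule m(1))
  interpret W: module sc' by (rule m(2))
  have m'': "module sc''" by (rule tensor_product_module[OF t])
  interpret U: module sc'' by (rule m'')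
  have M: "V.subspace M0" "M \<subseteq> M0" "M = V.span (b ` I)" "\<And>i. i \<in> I \<Longrightarrow> linear_on sc M0 (*) (\<phi> i)"
    "\<And>i j. i \<in> I \<Longrightarrow> j \<in> I \<Longrightarrow> \<phi> i (b j) \<noteq> 0 \<longleftrightarrow> i = j"
    using dM by (auto simp: diag_family_def)
  have N: "W.subspace N0" "N \<subseteq> N0" "N = W.span (b' ` J)" "\<And>i. i \<in> J \<Longrightarrow> linear_on sc' N0 (*) (\<phi>' i)"
    "\<And>i j. i \<in> J \<Longrightarrow> j \<in> J \<Longrightarrow> \<phi>' i (b' j) \<noteq> 0 \<longleftrightarrow> i = j"
    using dN by (auto simp: diag_family_def)
  have bM: "b i \<in> M" if "i \<in> I" for i using that M(3) V.span_base by blast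
  have bN: "b' j \<in> N" if "j \<in> J" for j using that N(3) W.span_base by blast
  have bil: "bilinear_on sc M0 sc' N0 sc'' tn" by (rule tensor_bilinear[OF t m M(1) N(1)])
  note b = linear_onD[OF bilinear_onD(1)[OF bil]] linear_onD[OF bilinear_onD(2)[OF bil]]
  have "\<exists>f. linear_on sc'' (tensor_span sc'' tn M0 N0) (*) f \<and>
      (\<forall>x\<in>M0. \<forall>y\<in>N0. f (tn x y) = \<phi> i x * \<phi>' j y)" if "i \<in> I" "j \<in> J" for i j
  proof (rule tensor_lift[OF t m module_mult M(1) N(1)])
    show "bilinear_on sc M0 sc' N0 (*) (\<lambda>x y. \<phi> i x * \<phi>' j y)"
      unfolding bilinear_on_def linear_on_def
      by (simp add: linear_onD[OF M(4)[OF that(1)]] linear_onD[OF N(4)[OF that(2)]] algebra_simps)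
  qed
  then have "\<forall>ij\<in>I \<times> J. \<exists>f. linear_on sc'' (tensor_span sc'' tn M0 N0) (*) f \<and>
      (\<forall>x\<in>M0. \<forall>y\<in>N0. f (tn x y) = \<phi> (fst ij) x * \<phi>' (snd ij) y)"
    by auto
  from bchoice[OF this] obtain \<psi> where
    \<psi>: "\<And>ij. ij \<in> I \<times> J \<Longrightarrow> linear_on sc'' (tensor_span sc'' tn M0 N0) (*) (\<psi> ij)"
      "\<And>i j x y. i \<in> I \<Longrightarrow> j \<in> J \<Longrightarrow> x \<in> M0 \<Longrightarrow> y \<in> N0 \<Longrightarrow> \<psi> (i, j) (tn x y) = \<phi> i x * \<phi>' j y"
    by fastforce
  have \<psi>b: "\<psi> (i, j) (tn (b i') (b' j')) \<noteq> 0 \<longleftrightarrow> i = i' \<and> j = j'"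
    if "i \<in> I" "j \<in> J" "i' \<in> I" "j' \<in> J" for i j i' j'
  proof -
    have "b i' \<in> M0" "b' j' \<in> N0" using that bM bN M(2) N(2) by auto
    then have "\<psi> (i, j) (tn (b i') (b' j')) = \<phi> i (b i') * \<phi>' j (b' j')"
      by (rule \<psi>(2)[OF that(1,2)])
    then show ?thesis
      using M(5)[OF that(1,3)] N(5)[OF that(2,4)] by (metis mult_eq_0_iff)
  qed
  let ?B = "(\<lambda>(i, j). tn (b i) (b' j)) ` (I \<times> J)"
  have gens: "tn x y \<in> U.span ?B" if "x \<in> M" "y \<in> N" for x y
    by (rule bilinear_generators[OF m m'' U.subspace_span _ _ _ _ _ M(3) N(3) that])
      (use M(2) N(2) U.span_zero in \<open>auto simp: b subset_iff intro: U.span_base\<close>)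
  have span: "tensor_span sc'' tn M N = U.span ?B"
  proof
    show "tensor_span sc'' tn M N \<subseteq> U.span ?B"
      unfolding tensor_span_def by (rule U.span_minimal) (use gens in auto)
    show "U.span ?B \<subseteq> tensor_span sc'' tn M N"
      unfolding tensor_span_def by (rule U.span_mono) (use bM bN in auto)
  qed
  have "diag_family sc'' (tensor_span sc'' tn M0 N0) (tensor_span sc'' tn M N) (I \<times> J)
        (\<lambda>(i, j). tn (b i) (b' j)) \<psi>"
    unfolding diag_family_def
  proof (intro conjI)
    show "U.subspace (tensor_span sc'' tn M0 N0)" by (simp add: tensor_span_def)
    show "tensor_span sc'' tn M N \<subseteq> tensor_span sc'' tn M0 N0"
      by (rule tensor_span_mono[OF m'' M(2) N(2)])
  qed (use span \<psi>(1) \<psi>b in auto)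
  then show "\<exists>\<psi>. diag_family sc'' (tensor_span sc'' tn M0 N0) (tensor_span sc'' tn M N) (I \<times> J)
        (\<lambda>(i, j). tn (b i) (b' j)) \<psi> \<and>
      (\<forall>i\<in>I. \<forall>j\<in>J. \<forall>x\<in>M0. \<forall>y\<in>N0. \<psi> (i, j) (tn x y) = \<phi> i x * \<phi>' j y)"
    using \<psi>(2) by blast
  let ?R = "bilinear_relations sc M sc' N" and ?t = "lincomb sc'' (\<lambda>(x, y). tn x y)"
  have sub: "V.subspace M" "W.subspace N" using M(3) N(3) by auto
  have kill: "?t r = 0" if "r \<in> F.span ?R" for r
    using linear_on_image_span[OF module_free_scale m'' linear_lincomb[OF m''] F.subspace_UNIV _
        U.subspace_single_0 _ that]
      bilinear_relations_lincomb[OF m'' bilinear_on_subset[OF bil M(2) N(2)] _ sub m] by auto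
  let ?G = "(\<lambda>(i, j). (b i, b' j)) ` (I \<times> J)"
  have base: "r \<in> F.span (?R \<union> gen ` ?G)" if "r \<in> ?R" for r
    using that by (intro F.span_base UnI1)
  \<comment> \<open>The formal pair is bilinear modulo the relations, hence congruent to a
    combination of pairs of generators.\<close>
  have gen: "gen (x, y) \<in> F.span (?R \<union> gen ` ?G)" if "x \<in> M" "y \<in> N" for x y
  proof (rule bilinear_generators[OF m module_free_scale F.subspace_span _ _ _ _ _ M(3) N(3) that,
        where F = "\<lambda>x y. gen (x, y)"])
    show "gen (x + x', y) - gen (x, y) - gen (x', y) \<in> F.span (?R \<union> gen ` ?G)"
      if "x \<in> M" "x' \<in> M" "y \<in> N" for x x' y
      by (rule base) (use that in \<open>unfold bilinear_relations_def, blast\<close>)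
    show "gen (x, y + y') - gen (x, y) - gen (x, y') \<in> F.span (?R \<union> gen ` ?G)"
      if "x \<in> M" "y \<in> N" "y' \<in> N" for x y y'
      by (rule base) (use that in \<open>unfold bilinear_relations_def, blast\<close>)
    show "gen (sc c x, y) - free_scale c (gen (x, y)) \<in> F.span (?R \<union> gen ` ?G)"
      "gen (x, sc' c y) - free_scale c (gen (x, y)) \<in> F.span (?R \<union> gen ` ?G)"
      if "x \<in> M" "y \<in> N" for c x y
      by (rule base; use that in \<open>unfold bilinear_relations_def, blast\<close>)+
  next
    fix x y assume "x \<in> b ` I" "y \<in> b' ` J"
    then show "gen (x, y) \<in> F.span (?R \<union> gen ` ?G)"
      by (intro F.span_base UnI2) auto
  qed
  have "f \<in> F.span ?R" if f: "Poly_Mapping.keys f \<subseteq> M \<times> N" "?t f = 0" for f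
  proof -
    have "f \<in> F.span (gen ` (M \<times> N))" using f(1) unfolding span_gen by simp
    also have "\<dots> \<subseteq> F.span (?R \<union> gen ` ?G)"
      by (rule F.span_minimal) (use gen in auto)
    \<comment> \<open>\<open>r\<close> consists of relations and maps to 0; what remains is to see
      that \<open>q\<close>, supported on generator pairs, is 0.\<close>
    finally obtain r q where rq: "f = r + q" "r \<in> F.span ?R" "q \<in> F.span (gen ` ?G)"
      unfolding F.span_Un by auto
    have q: "Poly_Mapping.keys q \<subseteq> ?G" using rq(3) unfolding span_gen by simp
    have tq: "?t q = 0" using f(2) kill[OF rq(2)] by (simp add: rq(1) lincomb_add[OF m''])
    \<comment> \<open>\<open>\<psi> (i, j)\<close> takes the image of \<open>q\<close> to this
      coefficient times a nonzero diagonal entry; all other pairs are killed.\<close>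
    have "Poly_Mapping.lookup q (b i, b' j) = 0" if ij: "i \<in> I" "j \<in> J" for i j
    proof -
      let ?T0 = "tensor_span sc'' tn M0 N0"
      have sT0: "U.subspace ?T0" by (simp add: tensor_span_def)
      have mem: "(case z of (x, y) \<Rightarrow> tn x y) \<in> ?T0" if "z \<in> Poly_Mapping.keys q" for z
      proof -
        have "z \<in> M0 \<times> N0" using that q bM bN M(2) N(2) by fastforce
        then show ?thesis unfolding tensor_span_eq by (intro U.span_base imageI)
      qed
      have "\<psi> (i, j) (?t q) = (\<Sum>z\<in>Poly_Mapping.keys q.
          Poly_Mapping.lookup q z * \<psi> (i, j) (case z of (x, y) \<Rightarrow> tn x y))"
        unfolding lincomb_def using ij
        by (subst linear_on_sum[OF m'' module_mult \<psi>(1) sT0])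
          (auto simp: mem sT0 U.subspace_scale linear_onD(2)[OF \<psi>(1)])
      also have "\<dots> = (\<Sum>z\<in>Poly_Mapping.keys q.
          if z = (b i, b' j) then Poly_Mapping.lookup q z * \<psi> (i, j) (tn (b i) (b' j)) else 0)"
        using q \<psi>b[OF ij] by (intro sum.cong) auto
      also have "\<dots> = Poly_Mapping.lookup q (b i, b' j) * \<psi> (i, j) (tn (b i) (b' j))"
        by (auto simp: in_keys_iff)
      finally have "Poly_Mapping.lookup q (b i, b' j) * \<psi> (i, j) (tn (b i) (b' j)) = 0"
        using tq linear_on_0[OF m'' module_mult \<psi>(1)] sT0 ij by (simp add: U.subspace_0)
      then show ?thesis using \<psi>b[OF ij ij] by simp
    qed
    note zero = this
    have "z \<notin> Poly_Mapping.keys q" for z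
    proof
      assume z: "z \<in> Poly_Mapping.keys q"
      from subsetD[OF q z] obtain i j where "i \<in> I" "j \<in> J" "z = (b i, b' j)" by clarsimp
      then show False using zero z by (simp add: in_keys_iff)
    qed
    then have "Poly_Mapping.keys q = {}" by blast
    then have "q = 0" by simp
    then show ?thesis using rq by simp
  qed
  then show "tensor_product sc M sc' N sc'' tn"
    unfolding tensor_product_def presented_by_def using m'' kill by auto
qed

text \<open>The square inherits a diagonal family, so the argument applies once more to both ways of
  forming the cube.\<close>

lemma tensor_square_cube_restrict:
  fixes sc :: "'k::idom \<Rightarrow> 'h::ab_group_add \<Rightarrow> 'h"
  assumes m: "module sc" and t: "tensor_square_cube sc H0 sc2 tn sc3 tnl tnr"
    and d: "diag_family sc H0 H I b \<phi>"
  shows "tensor_square_cube sc H sc2 tn sc3 tnl tnr"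
proof -
  have t1: "tensor_product sc H0 sc H0 sc2 tn"
    and t2: "tensor_product sc2 (tensor_span sc2 tn H0 H0) sc H0 sc3 tnl"
    and t3: "tensor_product sc H0 sc2 (tensor_span sc2 tn H0 H0) sc3 tnr"
    using t by (auto simp: tensor_square_cube_def)
  have m2: "module sc2" by (rule tensor_product_module[OF t1])
  obtain \<psi> where \<psi>: "diag_family sc2 (tensor_span sc2 tn H0 H0) (tensor_span sc2 tn H H) (I \<times> I)
        (\<lambda>(i, j). tn (b i) (b j)) \<psi>"
    using diag_family_tensor(2)[OF m m t1 d d] by blast
  have "H \<subseteq> H0" using d unfolding diag_family_def by blast
  then show ?thesis
    using diag_family_tensor(1)[OF m m t1 d d] diag_family_tensor(1)[OF m2 m t2 \<psi> d]
      diag_family_tensor(1)[OF m m2 t3 d \<psi>] t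
    unfolding tensor_square_cube_def by auto
qed

subsection \<open>Coordinates\<close>

text \<open>\<open>M\<close> may be a proper submodule of its type, as the tensor square inside
  \<open>'u\<close> can be. The coordinate functions are therefore required to be linear on
  \<open>M\<close> only.\<close>

locale coordinates = module sc for sc :: "'k::comm_ring_1 \<Rightarrow> 'v::ab_group_add \<Rightarrow> 'v" +
  fixes M :: "'v set" and I :: "'i set" and e :: "'i \<Rightarrow> 'v" and c :: "'v \<Rightarrow> 'i \<Rightarrow> 'k"
  assumes span_e: "span (e ` I) = M"
    and linear_c: "linear_on sc M (*) (\<lambda>x. c x i)"
    and c_e: "i \<in> I \<Longrightarrow> c (e i) j = (if i = j then 1 else 0)"
begin

lemma subspace_M: "subspace M"
  using span_e by auto

lemma e_in_M: "i \<in> I \<Longrightarrow> e i \<in> M"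
  using span_e span_base by blast

lemma c_add: "x \<in> M \<Longrightarrow> y \<in> M \<Longrightarrow> c (x + y) i = c x i + c y i"
  by (rule linear_onD(1)[OF linear_c])

lemma c_scale: "x \<in> M \<Longrightarrow> c (sc a x) i = a * c x i"
  by (rule linear_onD(2)[OF linear_c])

lemma c_diff: "x \<in> M \<Longrightarrow> y \<in> M \<Longrightarrow> c (x - y) i = c x i - c y i"
  by (rule linear_on_diff[OF module_axioms module_mult linear_c subspace_M])

lemma c_zero: "c 0 i = 0"
  by (rule linear_on_0[OF module_axioms module_mult linear_c subspace_0[OF subspace_M]])

lemma c_sum: "(\<And>j. j \<in> J \<Longrightarrow> f j \<in> M) \<Longrightarrow> c (\<Sum>j\<in>J. f j) i = (\<Sum>j\<in>J. c (f j) i)"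
  by (rule linear_on_sum[OF module_axioms module_mult linear_c subspace_M])

lemma expansion_aux:
  assumes "x \<in> M"
  shows "finite {i. c x i \<noteq> 0} \<and> {i. c x i \<noteq> 0} \<subseteq> I \<and>
    (\<Sum>i | c x i \<noteq> 0. sc (c x i) (e i)) = x"
  using assms unfolding span_e[symmetric]
proof -
  assume "x \<in> span (e ` I)"
  then obtain p where p: "Poly_Mapping.keys p \<subseteq> I" "x = lincomb sc e p"
    unfolding lincomb_span[OF module_axioms, symmetric] by blast
  have "c x i = Poly_Mapping.lookup p i" for i
  proof -
    have "c x i = (\<Sum>j\<in>Poly_Mapping.keys p. Poly_Mapping.lookup p j * c (e j) i)"
      unfolding p(2) lincomb_def using p(1)
      by (subst c_sum) (auto simp: c_scale e_in_M subspace_M subspace_scale subset_iff)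
    also have "\<dots> = (\<Sum>j\<in>Poly_Mapping.keys p. if j = i then Poly_Mapping.lookup p j else 0)"
      using p(1) by (intro sum.cong) (auto simp: c_e)
    also have "\<dots> = Poly_Mapping.lookup p i" by (auto simp: in_keys_iff)
    finally show ?thesis .
  qed
  then have "{i. c x i \<noteq> 0} = Poly_Mapping.keys p" "c x = Poly_Mapping.lookup p"
    by (auto simp: in_keys_iff)
  then show ?thesis using p by (simp add: lincomb_def)
qed

lemma finite_support: "x \<in> M \<Longrightarrow> finite {i. c x i \<noteq> 0}"
  and support_subset: "x \<in> M \<Longrightarrow> c x i \<noteq> 0 \<Longrightarrow> i \<in> I"
  and expansion: "x \<in> M \<Longrightarrow> (\<Sum>i | c x i \<noteq> 0. sc (c x i) (e i)) = x"
  using expansion_aux by blast+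

lemma c_inject: "x \<in> M \<Longrightarrow> y \<in> M \<Longrightarrow> (\<And>i. i \<in> I \<Longrightarrow> c x i = c y i) \<Longrightarrow> x = y"
proof -
  assume xy: "x \<in> M" "y \<in> M" and eq: "\<And>i. i \<in> I \<Longrightarrow> c x i = c y i"
  have "c x i = c y i" for i
  proof (cases "i \<in> I")
    case False
    then have "c x i = 0" "c y i = 0"
      using support_subset[OF xy(1), of i] support_subset[OF xy(2), of i] by auto
    then show ?thesis by simp
  qed (rule eq)
  then have "c x = c y" by blast
  from trans[OF expansion[OF xy(1), unfolded this, symmetric] expansion[OF xy(2)]] show "x = y" .
qed

definition ext :: "('k \<Rightarrow> 'w::ab_group_add \<Rightarrow> 'w) \<Rightarrow> ('i \<Rightarrow> 'w) \<Rightarrow> 'v \<Rightarrow> 'w" where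
  "ext sc' g x = (\<Sum>i | c x i \<noteq> 0. sc' (c x i) (g i))"

context
  fixes sc' :: "'k \<Rightarrow> 'w::ab_group_add \<Rightarrow> 'w"
  assumes sc': "module sc'"
begin

interpretation W: module sc' by (rule sc')

lemma ext_superset:
  assumes "finite S" "\<And>i. c x i \<noteq> 0 \<Longrightarrow> i \<in> S"
  shows "ext sc' g x = (\<Sum>i\<in>S. sc' (c x i) (g i))"
  unfolding ext_def using assms by (intro sum.mono_neutral_left) auto

lemma linear_ext: "linear_on sc M sc' (ext sc' g)"
proof (rule linear_onI)
  fix x y assume xy: "x \<in> M" "y \<in> M"
  let ?S = "{i. c x i \<noteq> 0} \<union> {i. c y i \<noteq> 0}"
  have "finite ?S" using xy finite_support by simp
  moreover have "i \<in> ?S" if "c (x + y) i \<noteq> 0" for i using that xy by (auto simp: c_add)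
  ultimately have "ext sc' g (x + y) = (\<Sum>i\<in>?S. sc' (c (x + y) i) (g i))"
    "ext sc' g x = (\<Sum>i\<in>?S. sc' (c x i) (g i))" "ext sc' g y = (\<Sum>i\<in>?S. sc' (c y i) (g i))"
    by (auto intro!: ext_superset)
  then show "ext sc' g (x + y) = ext sc' g x + ext sc' g y"
    using xy by (simp only: c_add W.scale_left_distrib sum.distrib)
next
  fix a x assume x: "x \<in> M"
  let ?S = "{i. c x i \<noteq> 0}"
  have "i \<in> ?S" if "c (sc a x) i \<noteq> 0" for i using that x by (auto simp: c_scale)
  then have "ext sc' g (sc a x) = (\<Sum>i\<in>?S. sc' (c (sc a x) i) (g i))"
    by (intro ext_superset finite_support x)
  then show "ext sc' g (sc a x) = sc' a (ext sc' g x)"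
    using x by (simp add: ext_def[of sc' g x] c_scale W.scale_sum_right)
qed

lemma ext_e: "i \<in> I \<Longrightarrow> ext sc' g (e i) = g i"
  by (subst ext_superset[of "{i}"]) (auto simp: c_e split: if_splits)

lemma linear_eqI:
  assumes "linear_on sc M sc' f" "linear_on sc M sc' g" "\<And>i. i \<in> I \<Longrightarrow> f (e i) = g (e i)" "x \<in> M"
  shows "f x = g x"
  using linear_on_eq_on_span[OF module_axioms sc' assms(1,2) subspace_M, of "e ` I" x]
    assms(3,4) span_e e_in_M by auto

lemma bilinear_eqI:
  assumes "bilinear_on sc M sc M sc' f" "bilinear_on sc M sc M sc' g"
    "\<And>i j. i \<in> I \<Longrightarrow> j \<in> I \<Longrightarrow> f (e i) (e j) = g (e i) (e j)" "x \<in> M" "y \<in> M"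
  shows "f x y = g x y"
  by (rule bilinear_on_eq_on_span[OF module_axioms module_axioms sc' assms(1,2) subspace_M _
        subspace_M, of "e ` I" "e ` I"]) (use assms(3-5) span_e e_in_M in auto)

definition ext2 :: "('i \<Rightarrow> 'i \<Rightarrow> 'w) \<Rightarrow> 'v \<Rightarrow> 'v \<Rightarrow> 'w" where
  "ext2 g x y = ext sc' (\<lambda>i. ext sc' (g i) y) x"

lemma bilinear_ext2: "bilinear_on sc M sc M sc' (ext2 g)"
  unfolding bilinear_on_def
proof (intro conjI ballI)
  show "linear_on sc M sc' (\<lambda>x. ext2 g x y)" for y
    unfolding ext2_def by (rule linear_ext)
  show "linear_on sc M sc' (ext2 g x)" for x
    unfolding ext2_def ext_def[of sc' "\<lambda>i. ext sc' (g i) _" x]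
    by (rule linear_onI)
      (simp_all add: linear_onD[OF linear_ext] W.scale_right_distrib sum.distrib W.scale_sum_right
        mult.commute)
qed

lemma ext2_e: "i \<in> I \<Longrightarrow> j \<in> I \<Longrightarrow> ext2 g (e i) (e j) = g i j"
  by (simp add: ext2_def ext_e)

end

end

subsection \<open>The tensor algebra\<close>

lemma the_unique: "P f \<Longrightarrow> (\<And>f g. P f \<Longrightarrow> P g \<Longrightarrow> f = g) \<Longrightarrow> P (THE f. P f)"
  by (rule theI) blast+

definition multilinear ::
  "('k::comm_ring_1 \<Rightarrow> 'v::ab_group_add \<Rightarrow> 'v) \<Rightarrow> ('k \<Rightarrow> 'w::ab_group_add \<Rightarrow> 'w) \<Rightarrow> ('v list \<Rightarrow> 'w) \<Rightarrow> bool"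
  where "multilinear sc sc' h \<longleftrightarrow>
    (\<forall>u v x y. h (u @ [x + y] @ v) = h (u @ [x] @ v) + h (u @ [y] @ v)) \<and>
    (\<forall>c u v x. h (u @ [sc c x] @ v) = sc' c (h (u @ [x] @ v)))"

lemma multilinearD:
  assumes "multilinear sc sc' h"
  shows "h (u @ (x + y) # v) = h (u @ x # v) + h (u @ y # v)"
    and "h (u @ sc c x # v) = sc' c (h (u @ x # v))"
  using assms by (simp_all add: multilinear_def)

lemma tensor_algebra_lift:
  assumes t: "tensor_algebra scV scT tens" and "module sc'" and h: "multilinear scV sc' h"
  shows "\<exists>f. linear_on scT UNIV sc' f \<and> (\<forall>v. f (tens v) = h v)"
proof -
  have "lincomb sc' h r = 0" if "r \<in> multilinear_relations scV" for r
    using that unfolding multilinear_relations_def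
    by (auto simp: lincomb_diff lincomb_scale lincomb_gen \<open>module sc'\<close> multilinearD[OF h])
  then show ?thesis
    using presented_by_lift[of scT UNIV "multilinear_relations scV" tens sc' h] t \<open>module sc'\<close>
    by (simp add: tensor_algebra_def)
qed

lemma tensor_algebra_module: "tensor_algebra scV scT tens \<Longrightarrow> module scT"
  by (simp add: tensor_algebra_def presented_by_def)

lemma tensor_algebra_multilinear:
  assumes t: "tensor_algebra scV scT tens"
  shows "multilinear scV scT tens"
proof -
  interpret F: module free_scale by (rule module_free_scale)
  have m: "module scT" by (rule tensor_algebra_module[OF t])
  have 0: "lincomb scT tens r = 0" if "r \<in> multilinear_relations scV" for r
    using t F.span_base[OF that] unfolding tensor_algebra_def presented_by_def by simp
  have "tens (u @ [x + y] @ v) - tens (u @ [x] @ v) - tens (u @ [y] @ v) = 0" for u v x y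
    using 0[of "gen (u @ [x + y] @ v) - gen (u @ [x] @ v) - gen (u @ [y] @ v)"]
    unfolding lincomb_diff[OF m] lincomb_gen[OF m] multilinear_relations_def by blast
  moreover have "tens (u @ [scV c x] @ v) - scT c (tens (u @ [x] @ v)) = 0" for u v c x
    using 0[of "gen (u @ [scV c x] @ v) - free_scale c (gen (u @ [x] @ v))"]
    unfolding lincomb_diff[OF m] lincomb_gen[OF m] lincomb_scale[OF m] multilinear_relations_def
    by blast
  ultimately show ?thesis
    unfolding multilinear_def by (simp add: diff_eq_eq add.commute)
qed

lemma tensor_algebra_eqI:
  assumes t: "tensor_algebra scV scT tens" and m: "module sc'"
    and "linear_on scT UNIV sc' f" "linear_on scT UNIV sc' g" "\<And>v. f (tens v) = g (tens v)"
  shows "f = g"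
proof
  interpret T: module scT by (rule tensor_algebra_module[OF t])
  show "f x = g x" for x
    using linear_on_eq_on_span[OF T.module_axioms m assms(3,4) T.subspace_UNIV, of "range tens" x]
      assms(5) t by (auto simp: tensor_algebra_def)
qed

text \<open>Lifting in \<open>u\<close> for fixed \<open>v\<close> gives linear maps
  \<open>k v\<close>. They depend multilinearly on \<open>v\<close>, because linear maps on the
  tensor algebra are determined by pure tensors, and a second lifting in \<open>v\<close> gives
  \<open>f\<close>.\<close>

lemma tensor_algebra_lift2:
  assumes t: "tensor_algebra scV scT tens" and m: "module sc'"
    and h: "\<And>v. multilinear scV sc' (\<lambda>u. h u v)" "\<And>u. multilinear scV sc' (h u)"
  shows "\<exists>f. bilinear_on scT UNIV scT UNIV sc' f \<and> (\<forall>u v. f (tens u) (tens v) = h u v)"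
proof -
  interpret W: module sc' by (rule m)
  have "\<forall>v. \<exists>f. linear_on scT UNIV sc' f \<and> (\<forall>u. f (tens u) = h u v)"
    using tensor_algebra_lift[OF t m h(1)] by blast
  then obtain k where k: "\<And>v. linear_on scT UNIV sc' (k v)" "\<And>u v. k v (tens u) = h u v"
    by metis
  have k1: "k (u @ [x + y] @ v) = (\<lambda>z. k (u @ [x] @ v) z + k (u @ [y] @ v) z)" for u v x y
    by (rule tensor_algebra_eqI[OF t m k(1)])
      (auto intro!: linear_onI simp: linear_onD[OF k(1)] k(2) multilinearD[OF h(2)] W.scale_right_distrib)
  have k2: "k (u @ [scV c x] @ v) = (\<lambda>z. sc' c (k (u @ [x] @ v) z))" for u v c x
    by (rule tensor_algebra_eqI[OF t m k(1)])
      (auto intro!: linear_onI simp: linear_onD[OF k(1)] k(2) multilinearD[OF h(2)]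
        W.scale_right_distrib mult.commute)
  have "multilinear scV sc' (\<lambda>v. k v x)" for x
    unfolding multilinear_def using k1 k2 by auto
  then have "\<forall>x. \<exists>f. linear_on scT UNIV sc' f \<and> (\<forall>v. f (tens v) = k v x)"
    using tensor_algebra_lift[OF t m] by blast
  then obtain f where f: "\<And>x. linear_on scT UNIV sc' (f x)" "\<And>x v. f x (tens v) = k v x"
    by metis
  have f1: "f (x + y) = (\<lambda>z. f x z + f y z)" for x y
    by (rule tensor_algebra_eqI[OF t m f(1)])
      (auto intro!: linear_onI simp: linear_onD[OF f(1)] f(2) linear_onD[OF k(1)] W.scale_right_distrib)
  have f2: "f (scT c x) = (\<lambda>z. sc' c (f x z))" for c x
    by (rule tensor_algebra_eqI[OF t m f(1)])
      (auto intro!: linear_onI simp: linear_onD[OF f(1)] f(2) linear_onD[OF k(1)]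
        W.scale_right_distrib mult.commute)
  have "bilinear_on scT UNIV scT UNIV sc' f"
    unfolding bilinear_on_def using f(1) by (auto intro!: linear_onI simp: f1 f2)
  then show ?thesis using f(2) k(2) by auto
qed

subsection \<open>Restriction of superbialgebras to submodules\<close>

lemma tensor_span_subset:
  assumes "tensor_square_cube sc H sc2 tn sc3 tnl tnr" "H' \<subseteq> H"
  shows "tensor_span sc2 tn H' H' \<subseteq> tensor_span sc2 tn H H"
  using assms tensor_span_mono[OF tensor_product_module] unfolding tensor_square_cube_def by blast

text \<open>The auxiliary maps are those of the large superbialgebra, restricted to the span of
  \<open>H \<otimes> H\<close> in the ambient square. What remains to be supplied is closure of
  \<open>H\<close>, its grading, and that \<open>tn\<close> presents the tensor square and cube of
  \<open>H\<close> itself.\<close>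

lemma superbialgebra_restrict:
  assumes sb: "superbialgebra sc sc2 tn sc3 tnl tnr H0 G mul one cop cou"
    and H: "module.subspace sc H" "H \<subseteq> H0"
    and grading: "direct_sum H (H \<inter> G 0) (H \<inter> G 1)"
    and cube: "tensor_square_cube sc H sc2 tn sc3 tnl tnr"
    and one: "one \<in> H" and mul: "\<And>x y. x \<in> H \<Longrightarrow> y \<in> H \<Longrightarrow> mul x y \<in> H"
    and cop: "\<And>i x. x \<in> H \<Longrightarrow> x \<in> G i \<Longrightarrow> cop x \<in> tensor_grading sc2 tn (\<lambda>p. H \<inter> G p) i"
  shows "superbialgebra sc sc2 tn sc3 tnl tnr H (\<lambda>p. H \<inter> G p) mul one cop cou"
proof -
  have alg: "superalgebra sc H0 G mul" and coalg: "supercoalgebra sc sc2 tn sc3 tnl tnr H0 G cop cou"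
    using sb by (simp_all add: superbialgebra_def)
  have gm: "graded_module sc H0 G" using alg by (simp add: superalgebra_def)
  interpret module sc using gm by (simp add: graded_module_def)
  have span: "tensor_span sc2 tn H H \<subseteq> tensor_span sc2 tn H0 H0"
    using coalg H(2) by (intro tensor_span_subset) (auto simp: supercoalgebra_def)
  have gm': "graded_module sc H (\<lambda>p. H \<inter> G p)"
    using gm grading H(1) by (auto simp: graded_module_def module_axioms intro: subspace_inter)
  have alg': "superalgebra sc H (\<lambda>p. H \<inter> G p) mul"
    using alg gm' mul H(2) bilinear_on_subset[of sc H0 sc H0 sc mul H H]
    by (auto simp: superalgebra_def subset_iff)
  note lin = linear_on_subset[OF _ H(2)] linear_on_subset[OF _ span]
  obtain cop_id id_cop where coass: "linear_on sc2 (tensor_span sc2 tn H0 H0) sc3 cop_id"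
      "linear_on sc2 (tensor_span sc2 tn H0 H0) sc3 id_cop"
      "\<forall>x\<in>H0. \<forall>y\<in>H0. cop_id (tn x y) = tnl (cop x) y \<and> id_cop (tn x y) = tnr x (cop y)"
      "\<forall>x\<in>H0. cop_id (cop x) = id_cop (cop x)"
    using coalg unfolding supercoalgebra_def by metis
  obtain cou_id id_cou where couni: "linear_on sc2 (tensor_span sc2 tn H0 H0) sc cou_id"
      "linear_on sc2 (tensor_span sc2 tn H0 H0) sc id_cou"
      "\<forall>x\<in>H0. \<forall>y\<in>H0. cou_id (tn x y) = sc (cou x) y \<and> id_cou (tn x y) = sc (cou y) x"
      "\<forall>x\<in>H0. cou_id (cop x) = x \<and> id_cou (cop x) = x"
    using coalg unfolding supercoalgebra_def by metis
  have coalg': "supercoalgebra sc sc2 tn sc3 tnl tnr H (\<lambda>p. H \<inter> G p) cop cou"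
    unfolding supercoalgebra_def
  proof (intro conjI)
    show "linear_on sc H sc2 cop" "linear_on sc H (*) cou" "\<forall>x\<in>H \<inter> G 1. cou x = 0"
      using coalg lin(1) by (auto simp: supercoalgebra_def)
    show "\<exists>cop_id id_cop.
        linear_on sc2 (tensor_span sc2 tn H H) sc3 cop_id \<and>
        linear_on sc2 (tensor_span sc2 tn H H) sc3 id_cop \<and>
        (\<forall>x\<in>H. \<forall>y\<in>H. cop_id (tn x y) = tnl (cop x) y \<and> id_cop (tn x y) = tnr x (cop y)) \<and>
        (\<forall>x\<in>H. cop_id (cop x) = id_cop (cop x))"
      using coass H(2) by (intro exI[of _ cop_id] exI[of _ id_cop]) (auto intro: lin(2))
    show "\<exists>cou_id id_cou.
        linear_on sc2 (tensor_span sc2 tn H H) sc cou_id \<and>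
        linear_on sc2 (tensor_span sc2 tn H H) sc id_cou \<and>
        (\<forall>x\<in>H. \<forall>y\<in>H. cou_id (tn x y) = sc (cou x) y \<and> id_cou (tn x y) = sc (cou y) x) \<and>
        (\<forall>x\<in>H. cou_id (cop x) = x \<and> id_cou (cop x) = x)"
      using couni H(2) by (intro exI[of _ cou_id] exI[of _ id_cou]) (auto intro: lin(2))
  qed (use gm' cube cop in auto)
  obtain mul2 where mul2:
      "bilinear_on sc2 (tensor_span sc2 tn H0 H0) sc2 (tensor_span sc2 tn H0 H0) sc2 mul2"
      "\<forall>i j. \<forall>x\<in>H0. \<forall>y\<in>G i. \<forall>z\<in>G j. \<forall>w\<in>H0.
           mul2 (tn x y) (tn z w) = sc2 (koszul_sign i j) (tn (mul x z) (mul y w))"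
      "\<forall>x\<in>H0. \<forall>y\<in>H0. cop (mul x y) = mul2 (cop x) (cop y)"
    using sb unfolding superbialgebra_def by metis
  have "\<exists>mul2.
        bilinear_on sc2 (tensor_span sc2 tn H H) sc2 (tensor_span sc2 tn H H) sc2 mul2 \<and>
        (\<forall>i j. \<forall>x\<in>H. \<forall>y\<in>H \<inter> G i. \<forall>z\<in>H \<inter> G j. \<forall>w\<in>H.
           mul2 (tn x y) (tn z w) = sc2 (koszul_sign i j) (tn (mul x z) (mul y w))) \<and>
        (\<forall>x\<in>H. \<forall>y\<in>H. cop (mul x y) = mul2 (cop x) (cop y))"
    using mul2 H(2) bilinear_on_subset[OF mul2(1) span span] by (intro exI[of _ mul2]) blast
  then show ?thesis
    unfolding superbialgebra_def using alg' coalg' sb one H(2)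
    by (auto simp: superbialgebra_def subset_iff)
qed

section \<open>Words in the basis of the matrix superalgebra\<close>

locale matrix_tensors =
  fixes sc :: "'k::{idom, ring_char_0} \<Rightarrow> 'a::ring \<Rightarrow> 'a"
    and A :: "bit \<Rightarrow> 'a set" and \<aa> Ba Bc Bodd :: "'a set"
    and scT :: "'k \<Rightarrow> 't::ab_group_add \<Rightarrow> 't" and tens :: "('a^'n::finite^'n) list \<Rightarrow> 't"
    and sc2 :: "'k \<Rightarrow> 'u::ab_group_add \<Rightarrow> 'u" and tn :: "'t \<Rightarrow> 't \<Rightarrow> 'u"
    and sc3 :: "'k \<Rightarrow> 'w::ab_group_add \<Rightarrow> 'w" and tnl :: "'u \<Rightarrow> 't \<Rightarrow> 'w" and tnr :: "'t \<Rightarrow> 'u \<Rightarrow> 'w"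
  assumes good: "good_pair sc A \<aa>"
    and good_basis: "good_pair_basis sc A \<aa> Ba Bc Bodd"
    and talg: "tensor_algebra (mat_scale sc) scT tens"
    and tcube: "tensor_square_cube scT UNIV sc2 tn sc3 tnl tnr"
begin

abbreviation B :: "'a set" where "B \<equiv> Ba \<union> Bc \<union> Bodd"

lemma module_sc: "module sc" and subspace_A: "module.subspace sc (A i)"
  and direct_sum_A: "direct_sum UNIV (A 0) (A 1)"
  using good by (auto simp: good_pair_def superalgebra_def graded_module_def)

sublocale S: module sc by (rule module_sc)

lemma basis_spans: "\<not> S.dependent (Ba \<union> Bc)" "S.span (Ba \<union> Bc) = A 0"
  "\<not> S.dependent Bodd" "S.span Bodd = A 1"
proof -
  obtain \<cc> where c: "direct_sum (A 0) \<aa> \<cc>" "basis_of sc Ba \<aa>" "basis_of sc Bc \<cc>" "basis_of sc Bodd (A 1)"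
    using good_basis unfolding good_pair_basis_def by blast
  show "\<not> S.dependent (Ba \<union> Bc)"
    by (rule independent_Un[OF module_sc]) (use c in \<open>auto simp: basis_of_def direct_sum_def\<close>)
  show "S.span (Ba \<union> Bc) = A 0"
    using c by (auto simp: basis_of_def direct_sum_def S.span_Un)
  show "\<not> S.dependent Bodd" "S.span Bodd = A 1" using c by (simp_all add: basis_of_def)
qed

lemma B_independent: "\<not> S.dependent B"
  by (rule independent_Un[OF module_sc])
    (use basis_spans direct_sum_A in \<open>auto simp: direct_sum_def\<close>)

lemma B_span: "S.span B = UNIV"
  using direct_sum_A unfolding S.span_Un[of "Ba \<union> Bc" Bodd] basis_spans direct_sum_def by simp

lemma B_nonzero: "0 \<notin> B"
  using S.dependent_zero[of B] B_independent by satx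

lemma B_even_odd: "b \<in> B \<Longrightarrow> b \<in> A 0 \<longleftrightarrow> b \<notin> A 1"
proof -
  assume b: "b \<in> B"
  then have "b \<notin> A 0 \<inter> A 1" using B_nonzero direct_sum_A by (auto simp: direct_sum_def)
  moreover have "b \<in> A 0 \<or> b \<in> A 1"
    using b S.span_base[of b "Ba \<union> Bc"] S.span_base[of b Bodd] by (auto simp: basis_spans)
  ultimately show ?thesis by blast
qed

text \<open>Parity is decided by membership in \<open>A 1\<close> alone, just as in
  \<open>odd_inversions\<close>, so that the two signs agree literally. On letters from the basis it
  is the actual parity, see \<open>par_letter\<close>.\<close>

fun par :: "'a \<times> 'n \<times> 'n \<Rightarrow> bit" where
  "par (a, r, s) = (if a \<in> A 1 then 1 else 0)"

sublocale parity par .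

lemma par_eq: "par x = 1 \<longleftrightarrow> fst x \<in> A 1"
  by (cases x) auto

definition letters :: "('a \<times> 'n \<times> 'n) set" where
  "letters = B \<times> UNIV"

lemma par_letter: "x \<in> letters \<Longrightarrow> par x = p \<longleftrightarrow> fst x \<in> A p"
  using B_even_odd by (cases x; cases p) (auto simp: letters_def)

fun cV :: "'a^'n^'n \<Rightarrow> 'a \<times> 'n \<times> 'n \<Rightarrow> 'k" where
  "cV M (b, r, s) = S.representation B (M $ r $ s) b"

lemma module_mat: "module (mat_scale sc)"
  by unfold_locales
    (simp_all add: mat_scale_def vec_eq_iff S.scale_right_distrib S.scale_left_distrib)

sublocale V: coordinates "mat_scale sc" UNIV letters xi_mat cV
proof -
  interpret V: module "mat_scale sc" by (rule module_mat)
  have entry: "xi_mat (a, r, s) \<in> V.span (xi_mat ` letters)" for a r s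
  proof -
    have "a \<in> S.span B" by (simp add: B_span)
    then show ?thesis
    proof (induction rule: S.span_induct_alt)
      case base
      have "xi_mat (0 :: 'a, r, s) = 0" by (simp add: vec_eq_iff)
      then show ?case by (simp only: V.span_zero)
    next
      case (step c x y)
      have "xi_mat (sc c x + y, r, s) = mat_scale sc c (xi_mat (x, r, s)) + xi_mat (y, r, s)"
        by (simp add: vec_eq_iff mat_scale_def)
      moreover have "xi_mat (x, r, s) \<in> V.span (xi_mat ` letters)"
        using step by (intro V.span_base imageI) (simp add: letters_def)
      ultimately show ?case using step by (simp only: V.span_add V.span_scale)
    qed
  qed
  show "coordinates (mat_scale sc) UNIV letters xi_mat cV"
  proof
    show "V.span (xi_mat ` letters) = UNIV"
    proof (intro set_eqI iffI UNIV_I)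
      fix M :: "'a^'n^'n"
      have "M = (\<Sum>r\<in>UNIV. \<Sum>s\<in>UNIV. xi_mat (M $ r $ s, r, s))"
      proof -
        have "(\<Sum>s\<in>UNIV. if i = r \<and> j = s then M $ r $ s else 0) = (if i = r then M $ r $ j else 0)" for r i j
          by (cases "i = r") auto
        then show ?thesis by (simp add: vec_eq_iff sum_component)
      qed
      also have "\<dots> \<in> V.span (xi_mat ` letters)"
        by (intro V.span_sum entry)
      finally show "M \<in> V.span (xi_mat ` letters)" .
    qed
    show "linear_on (mat_scale sc) UNIV (*) (\<lambda>x. cV x i)" for i
      by (cases i)
        (auto intro!: linear_onI simp: mat_scale_def S.representation_add[OF B_independent]
          S.representation_scale[OF B_independent] B_span)
    show "cV (xi_mat i) j = (if i = j then 1 else 0)" if "i \<in> letters" for i j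
      using that S.representation_basis[OF B_independent, of "fst i"]
      by (cases i; cases j) (auto simp: letters_def S.representation_zero)
  qed
qed

text \<open>A homogeneous entry lies in the span of the basis elements of its parity, and its
  expansion there is also its expansion in \<open>B\<close> by uniqueness.\<close>

lemma cV_parity:
  assumes "M \<in> mat_grading A p" "cV M x \<noteq> 0"
  shows "par x = p"
proof -
  obtain b r s where x: "x = (b, r, s)" by (cases x)
  have b: "b \<in> B" using V.support_subset[OF UNIV_I assms(2)] by (simp add: x letters_def)
  let ?B = "if p = 0 then Ba \<union> Bc else Bodd"
  have "M $ r $ s \<in> S.span ?B" using assms(1) basis_spans by (cases p) (auto simp: mat_grading_def)
  then have "S.representation B (M $ r $ s) = S.representation ?B (M $ r $ s)"
    by (intro S.representation_extend B_independent) auto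
  then have "b \<in> ?B" using assms(2) S.representation_ne_zero by (fastforce simp: x)
  then have "b \<in> A p" using basis_spans S.span_base[of b ?B] by (cases p) auto
  then show ?thesis using b par_letter[of x p] by (simp add: x letters_def)
qed

text \<open>The future coordinate of a pure tensor at a word. It is multilinear in the matrices and
  so extends to a functional on the tensor algebra, which is \<open>crd\<close>.\<close>

fun tcoef :: "('a^'n^'n) list \<Rightarrow> ('a \<times> 'n \<times> 'n) list \<Rightarrow> 'k" where
  "tcoef [] [] = 1"
| "tcoef (m # v) (x # w) = cV m x * tcoef v w"
| "tcoef _ _ = 0"

lemma tcoef_prod:
  "tcoef v w = (if length v = length w then \<Prod>i<length w. cV (v ! i) (w ! i) else 0)"
  by (induction v w rule: tcoef.induct) (simp_all add: lessThan_Suc_eq_insert_0 prod.reindex)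

lemma tcoef_length: "tcoef v w \<noteq> 0 \<Longrightarrow> length w = length v"
  by (auto simp: tcoef_prod split: if_splits)

lemma tcoef_multilinear: "multilinear (mat_scale sc) (*) (\<lambda>v. tcoef v w)"
proof -
  have "tcoef (u @ (x + y) # v) w = tcoef (u @ x # v) w + tcoef (u @ y # v) w" for u x y v
    by (induction u w rule: tcoef.induct; cases w) (auto simp: V.c_add algebra_simps)
  moreover have "tcoef (u @ mat_scale sc c x # v) w = c * tcoef (u @ x # v) w" for u x c v
    by (induction u w rule: tcoef.induct; cases w) (auto simp: V.c_scale algebra_simps)
  ultimately show ?thesis by (simp add: multilinear_def)
qed

lemma tcoef_append:
  "length u = d \<Longrightarrow> tcoef (u @ v) w = tcoef u (take d w) * tcoef v (drop d w)"
proof (induction u arbitrary: d w)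
  case (Cons m u)
  then show ?case by (cases w) (auto simp: algebra_simps)
qed simp

lemma tcoef_xi:
  "w \<in> lists letters \<Longrightarrow> tcoef (map xi_mat w) w' = (if w = w' then 1 else 0)"
proof (induction w arbitrary: w')
  case Nil
  then show ?case by (cases w') auto
next
  case (Cons x w)
  then show ?case by (cases w') (auto simp: V.c_e)
qed

definition crd :: "'t \<Rightarrow> ('a \<times> 'n \<times> 'n) list \<Rightarrow> 'k" where
  "crd x w = (SOME f. linear_on scT UNIV (*) f \<and> (\<forall>v. f (tens v) = tcoef v w)) x"

lemma linear_crd: "linear_on scT UNIV (*) (\<lambda>x. crd x w)"
  and crd_tens: "crd (tens v) w = tcoef v w"
  unfolding crd_def
  using someI_ex[OF tensor_algebra_lift[OF talg module_mult tcoef_multilinear[of w]]] by simp_all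

definition bas :: "('a \<times> 'n \<times> 'n) list \<Rightarrow> 't" where
  "bas w = tens (map xi_mat w)"

lemma module_T: "module scT"
  by (rule tensor_algebra_module[OF talg])

lemmas tens_multilinear = multilinearD[OF tensor_algebra_multilinear[OF talg]]

sublocale T: coordinates scT UNIV "lists letters" bas crd
proof -
  interpret T: module scT by (rule module_T)
  \<comment> \<open>The prefix \<open>u\<close> already consists of basis letters and
    \<open>v\<close> is still arbitrary; expanding the head of \<open>v\<close> moves it into the
    prefix.\<close>
  have "tens (map xi_mat u @ v) \<in> T.span (bas ` lists letters)" if "u \<in> lists letters" for u v
    using that
  proof (induction v arbitrary: u)
    case Nil
    then show ?case by (auto simp: bas_def intro!: T.span_base)
  next
    case (Cons m v)
    have lin: "linear_on (mat_scale sc) UNIV scT (\<lambda>m. tens (map xi_mat u @ m # v))"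
      by (rule linear_onI) (simp_all add: tens_multilinear)
    show ?case
    proof (rule linear_on_image_span[OF module_mat module_T lin V.subspace_UNIV _ T.subspace_span])
      show "m \<in> V.span (xi_mat ` letters)" by (simp add: V.span_e)
      fix m assume "m \<in> xi_mat ` letters"
      then obtain x where "x \<in> letters" "m = xi_mat x" by auto
      then show "tens (map xi_mat u @ m # v) \<in> T.span (bas ` lists letters)"
        using Cons.IH[of "u @ [x]"] Cons.prems by simp
    qed simp
  qed
  from this[of "[]"] have "range tens \<subseteq> T.span (bas ` lists letters)" by auto
  then have "T.span (range tens) \<subseteq> T.span (bas ` lists letters)"
    by (rule T.span_minimal) simp
  then have "T.span (bas ` lists letters) = UNIV"
    using talg by (auto simp: tensor_algebra_def)
  then show "coordinates scT UNIV (lists letters) bas crd"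
    by unfold_locales (simp_all add: linear_crd bas_def crd_tens tcoef_xi)
qed

lemma T_tensor: "tensor_product scT UNIV scT UNIV sc2 tn"
  using tcube by (simp add: tensor_square_cube_def)

lemma module_U: "module sc2"
  by (rule tensor_product_module[OF T_tensor])

abbreviation U0 :: "'u set" where "U0 \<equiv> tensor_span sc2 tn UNIV UNIV"

lemma bilinear_tn: "bilinear_on scT UNIV scT UNIV sc2 tn"
  by (rule tensor_bilinear[OF T_tensor module_T module_T T.subspace_UNIV T.subspace_UNIV])

lemmas tn_simps = linear_onD[OF bilinear_onD(1)[OF bilinear_tn], simplified]
  linear_onD[OF bilinear_onD(2)[OF bilinear_tn], simplified]

definition crd2 :: "'u \<Rightarrow> ('a \<times> 'n \<times> 'n) list \<times> ('a \<times> 'n \<times> 'n) list \<Rightarrow> 'k" where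
  "crd2 p uv = (SOME f. linear_on sc2 U0 (*) f \<and>
    (\<forall>x y. f (tn x y) = crd x (fst uv) * crd y (snd uv))) p"

lemma linear_crd2: "linear_on sc2 U0 (*) (\<lambda>p. crd2 p uv)"
  and crd2_tn: "crd2 (tn x y) uv = crd x (fst uv) * crd y (snd uv)"
proof -
  have "bilinear_on scT UNIV scT UNIV (*) (\<lambda>x y. crd x (fst uv) * crd y (snd uv))"
    unfolding bilinear_on_def by (auto intro!: linear_onI simp: T.c_add T.c_scale algebra_simps)
  from tensor_lift[OF T_tensor module_T module_T module_mult T.subspace_UNIV T.subspace_UNIV this]
  have "\<exists>f. linear_on sc2 U0 (*) f \<and> (\<forall>x y. f (tn x y) = crd x (fst uv) * crd y (snd uv))"
    by simp
  from someI_ex[OF this] show "linear_on sc2 U0 (*) (\<lambda>p. crd2 p uv)"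
    "crd2 (tn x y) uv = crd x (fst uv) * crd y (snd uv)"
    unfolding crd2_def by simp_all
qed

lemma diag_family_T: "diag_family scT UNIV UNIV (lists letters) bas (\<lambda>w x. crd x w)"
  unfolding diag_family_def by (auto simp: T.span_e linear_crd T.c_e)

sublocale U: coordinates sc2 U0 "lists letters \<times> lists letters" "\<lambda>(u, v). tn (bas u) (bas v)" crd2
proof -
  interpret U: module sc2 by (rule module_U)
  obtain \<psi> where "diag_family sc2 U0 U0 (lists letters \<times> lists letters)
      (\<lambda>(u, v). tn (bas u) (bas v)) \<psi>"
    using diag_family_tensor(2)[OF module_T module_T T_tensor diag_family_T diag_family_T] by blast
  then have "U.span ((\<lambda>(u, v). tn (bas u) (bas v)) ` (lists letters \<times> lists letters)) = U0"
    by (simp add: diag_family_def)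
  then show "coordinates sc2 U0 (lists letters \<times> lists letters) (\<lambda>(u, v). tn (bas u) (bas v)) crd2"
  proof unfold_locales
    fix i j :: "('a \<times> 'n \<times> 'n) list \<times> ('a \<times> 'n \<times> 'n) list"
    assume "i \<in> lists letters \<times> lists letters"
    then obtain u v where i: "i = (u, v)" and uv: "u \<in> lists letters" "v \<in> lists letters"
      by (cases i) simp
    show "crd2 (case i of (u, v) \<Rightarrow> tn (bas u) (bas v)) j = (if i = j then 1 else 0)"
      by (cases j) (simp add: i crd2_tn T.c_e[OF uv(1)] T.c_e[OF uv(2)])
  qed (simp_all add: linear_crd2)
qed

lemma tn_in_U0: "tn x y \<in> U0"
  unfolding tensor_span_def by (rule U.span_base) auto

section \<open>The star product and the coproduct in coordinates\<close>

lemma concat_tensor_spec: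
  shows bilinear_concat: "bilinear_on scT UNIV scT UNIV scT (concat_tensor scT tens)"
    and concat_tens: "concat_tensor scT tens (tens u) (tens v) = tens (u @ v)"
proof -
  let ?P = "\<lambda>f. bilinear_on scT UNIV scT UNIV scT f \<and> (\<forall>u v. f (tens u) (tens v) = tens (u @ v))"
  have "multilinear (mat_scale sc) scT (\<lambda>u. tens (u @ v))"
    "multilinear (mat_scale sc) scT (\<lambda>v. tens (u @ v))" for u v
    unfolding multilinear_def
    using tens_multilinear[of "u @ _"] by (simp_all add: tens_multilinear)
  from tensor_algebra_lift2[OF talg module_T this] obtain f where f: "?P f" by blast
  have "?P (concat_tensor scT tens)"
    unfolding concat_tensor_def
  proof (rule the_unique[where P = ?P])
    show "?P f" by (rule f)
    fix f g assume *: "?P f" "?P g"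
    have "f x y = g x y" for x y
      by (rule T.bilinear_eqI[OF module_T]) (use * in \<open>auto simp: bas_def\<close>)
    then show "f = g" by blast
  qed
  then show "bilinear_on scT UNIV scT UNIV scT (concat_tensor scT tens)"
    "concat_tensor scT tens (tens u) (tens v) = tens (u @ v)" by auto
qed

section \<open>The signed action of the symmetric group in coordinates\<close>

lemma tcoef_permute:
  assumes "\<sigma> permutes {..<length w}" "length v = length w"
  shows "tcoef (permute_list \<sigma> v) (permute_list \<sigma> w) = tcoef v w"
proof -
  have "(\<Prod>i<length w. cV (v ! \<sigma> i) (w ! \<sigma> i)) = (\<Prod>i<length w. cV (v ! i) (w ! i))"
    using prod.permute[OF assms(1), of "\<lambda>i. cV (v ! i) (w ! i)"] by (simp add: o_def)
  then show ?thesis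
    using assms by (simp add: tcoef_prod permute_list_nth)
qed

lemma psign_cong: "map par w = map par w' \<Longrightarrow> psign w \<sigma> = (psign w' \<sigma> :: 'k)"
proof -
  assume "map par w = map par w'"
  then have "length w = length w'" "\<And>i. i < length w \<Longrightarrow> par (w ! i) = par (w' ! i)"
    by (metis length_map, metis length_map nth_map)
  then have "{(k, l). k < l \<and> l < length w \<and> inv \<sigma> k > inv \<sigma> l \<and> par (w ! k) = 1 \<and> par (w ! l) = 1}
    = {(k, l). k < l \<and> l < length w' \<and> inv \<sigma> k > inv \<sigma> l \<and> par (w' ! k) = 1 \<and> par (w' ! l) = 1}"
    by auto
  then show ?thesis unfolding psign_def by simp
qed

lemma odd_inversions_psign: "(-1) ^ odd_inversions A w \<sigma> = psign w \<sigma>"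
  unfolding odd_inversions_def psign_def par_eq by (simp only: conj_assoc)

lemma xi_mat_grading:
  assumes "fst x \<in> A 0 \<union> A 1"
  shows "xi_mat x \<in> mat_grading A (par x)"
proof -
  have "0 \<in> A p" for p using subspace_A by (simp add: S.subspace_0)
  then show ?thesis using assms by (cases x) (auto simp: mat_grading_def)
qed

lemma letter_homogeneous: "x \<in> letters \<Longrightarrow> fst x \<in> A 0 \<union> A 1"
  using B_even_odd by (auto simp: letters_def)

text \<open>The action is prescribed on all homogeneous matrix units and not only on basis words.
  Expanding such a tensor in the basis keeps the sequence of parities, so one sign serves for all
  its terms.\<close>

lemma tcoef_homogeneous_par:
  assumes "fst ` set w \<subseteq> A 0 \<union> A 1" "tcoef (map xi_mat w) w' \<noteq> 0"
  shows "map par w' = map par w"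
  using assms
proof (induction w arbitrary: w')
  case Nil
  then show ?case by (cases w') auto
next
  case (Cons x w)
  then obtain y w1 where w': "w' = y # w1" by (cases w') auto
  have y: "cV (xi_mat x) y \<noteq> 0" and w1: "tcoef (map xi_mat w) w1 \<noteq> 0"
    using Cons.prems(2) w' by auto
  have "par y = par x"
    by (rule cV_parity[OF xi_mat_grading y]) (use Cons.prems(1) in simp)
  moreover have "map par w1 = map par w" using Cons w1 by simp
  ultimately show ?case by (simp add: w')
qed

text \<open>The candidate permutes basis words with the sign \<open>psign\<close>. The prescription
  for arbitrary homogeneous entries is checked in coordinates; uniqueness holds because basis words
  have homogeneous letters.\<close>

lemma act_spec:
  assumes \<sigma>: "\<sigma> permutes {..<d}"
  shows linear_act: "linear_on scT UNIV scT (act A scT tens d \<sigma>)"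
    and crd_act: "length w = d \<Longrightarrow>
      crd (act A scT tens d \<sigma> x) (permute_list \<sigma> w) = psign w \<sigma> * crd x w"
    and crd_act_other: "length w \<noteq> d \<Longrightarrow> crd (act A scT tens d \<sigma> x) w = 0"
    and act_bas: "w \<in> lists letters \<Longrightarrow> length w = d \<Longrightarrow>
      act A scT tens d \<sigma> (bas w) = scT (psign w \<sigma>) (bas (permute_list \<sigma> w))"
proof -
  let ?P = "\<lambda>f. linear_on scT UNIV scT f \<and>
     (\<forall>w. length w = d \<and> fst ` set w \<subseteq> A 0 \<union> A 1 \<longrightarrow>
        f (tens (map xi_mat w)) =
          scT ((-1) ^ odd_inversions A w \<sigma>) (tens (map xi_mat (permute_list \<sigma> w)))) \<and>
     (\<forall>v. length v \<noteq> d \<longrightarrow> f (tens v) = 0)"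
  define f where "f = T.ext scT (\<lambda>w. if length w = d then scT (psign w \<sigma>) (bas (permute_list \<sigma> w)) else 0)"
  have lin: "linear_on scT UNIV scT f" unfolding f_def by (rule T.linear_ext[OF module_T])
  have f_bas: "f (bas w) = (if length w = d then scT (psign w \<sigma>) (bas (permute_list \<sigma> w)) else 0)"
    if "w \<in> lists letters" for w
    unfolding f_def by (rule T.ext_e[OF module_T that])
  have perm: "permute_list \<sigma> w \<in> lists letters" if "w \<in> lists letters" "length w = d" for w
    using that set_permute_list[of \<sigma> w] \<sigma> by auto
  have crd_f: "crd (f x) (permute_list \<sigma> w) = psign w \<sigma> * crd x w" if "length w = d" for x w
  proof (rule T.linear_eqI[OF module_mult, where x = x])
    show "linear_on scT UNIV (*) (\<lambda>x. crd (f x) (permute_list \<sigma> w))"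
      "linear_on scT UNIV (*) (\<lambda>x. psign w \<sigma> * crd x w)"
      by (auto intro!: linear_onI simp: linear_onD[OF lin] T.c_add T.c_scale algebra_simps)
    fix v assume v: "v \<in> lists letters"
    show "crd (f (bas v)) (permute_list \<sigma> w) = psign w \<sigma> * crd (bas v) w"
    proof (cases "length v = d")
      case True
      then have "permute_list \<sigma> v = permute_list \<sigma> w \<longleftrightarrow> v = w"
        using permute_list_inj[of \<sigma> v w] \<sigma> that by simp
      then show ?thesis using v perm[OF v True] True by (simp add: f_bas T.c_scale T.c_e del: in_lists_conv_set)
    next
      case False
      then show ?thesis using v that by (auto simp: f_bas T.c_e T.c_zero simp del: in_lists_conv_set)
    qed
  qed simp
  have crd_f0: "crd (f x) w = 0" if "length w \<noteq> d" for x w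
  proof (rule T.linear_eqI[OF module_mult, where x = x])
    show "linear_on scT UNIV (*) (\<lambda>x. crd (f x) w)" "linear_on scT UNIV (*) (\<lambda>x. 0)"
      by (auto intro!: linear_onI simp: linear_onD[OF lin] T.c_add T.c_scale)
    show "crd (f (bas v)) w = 0" if "v \<in> lists letters" for v
      using that perm[of v] \<open>length w \<noteq> d\<close>
      by (auto simp: f_bas T.c_e T.c_zero T.c_scale simp del: in_lists_conv_set)
  qed simp
  have "?P f"
  proof (intro conjI allI impI lin)
    fix w :: "('a \<times> 'n \<times> 'n) list" assume w: "length w = d \<and> fst ` set w \<subseteq> A 0 \<union> A 1"
    show "f (tens (map xi_mat w)) =
      scT ((-1) ^ odd_inversions A w \<sigma>) (tens (map xi_mat (permute_list \<sigma> w)))"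
    proof (rule T.c_inject)
      fix v :: "('a \<times> 'n \<times> 'n) list"
      show "crd (f (tens (map xi_mat w))) v =
        crd (scT ((-1) ^ odd_inversions A w \<sigma>) (tens (map xi_mat (permute_list \<sigma> w)))) v"
      proof (cases "length v = d")
        case True
        define v' where "v' = permute_list (inv \<sigma>) v"
        have v: "v = permute_list \<sigma> v'" "length v' = d"
          using permute_list_inv(2)[of \<sigma> v] \<sigma> True by (simp_all add: v'_def)
        have eq: "tcoef (map xi_mat (permute_list \<sigma> w)) v = tcoef (map xi_mat w) v'"
          using tcoef_permute[of \<sigma> v' "map xi_mat w"] \<sigma> v w
            permute_list_map[of \<sigma> w xi_mat] by simp
        \<comment> \<open>Either the coefficient vanishes, or \<open>v'\<close> has the parities of
          \<open>w\<close> and hence the same sign.\<close>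
        have "psign v' \<sigma> * tcoef (map xi_mat w) v' = psign w \<sigma> * tcoef (map xi_mat w) v'"
          using psign_cong[OF tcoef_homogeneous_par[of w v']] w
          by (cases "tcoef (map xi_mat w) v' = 0") auto
        then show ?thesis
          using crd_f[OF v(2), of "tens (map xi_mat w)"] v(1)
          by (simp add: T.c_scale crd_tens odd_inversions_psign eq[unfolded v(1)])
      next
        case False
        then show ?thesis using w tcoef_length[of "map xi_mat (permute_list \<sigma> w)" v]
          by (auto simp: crd_f0 T.c_scale crd_tens)
      qed
    qed simp_all
  next
    fix v :: "('a^'n^'n) list" assume "length v \<noteq> d"
    show "f (tens v) = 0"
    proof (rule T.c_inject)
      fix w :: "('a \<times> 'n \<times> 'n) list"
      show "crd (f (tens v)) w = crd 0 w"
      proof (cases "length w = d")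
        case True
        define w' where "w' = permute_list (inv \<sigma>) w"
        have "w = permute_list \<sigma> w'" "length w' = d"
          using permute_list_inv(2)[of \<sigma> w] \<sigma> True by (simp_all add: w'_def)
        then show ?thesis
          using crd_f[of w' "tens v"] tcoef_length[of v w'] \<open>length v \<noteq> d\<close>
          by (auto simp: crd_tens T.c_zero)
      qed (simp add: crd_f0 T.c_zero)
    qed simp_all
  qed
  moreover have "f' = f" if "?P f'" for f'
  proof -
    have "f' x = f x" for x
    proof (rule T.linear_eqI[OF module_T, where f = f' and g = f])
      show "linear_on scT UNIV scT f'" using that by blast
      show "f' (bas w) = f (bas w)" if w: "w \<in> lists letters" for w
      proof (cases "length w = d")
        case True
        have "fst ` set w \<subseteq> A 0 \<union> A 1"
          using w letter_homogeneous by blast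
        then show ?thesis using \<open>?P f'\<close> f_bas[OF w] True
          by (simp add: bas_def odd_inversions_psign)
      next
        case False
        then have "f' (tens (map xi_mat w)) = 0" using \<open>?P f'\<close> by simp
        then show ?thesis using f_bas[OF w] False by (simp add: bas_def)
      qed
    qed (simp_all add: lin)
    then show ?thesis by blast
  qed
  ultimately have act: "act A scT tens d \<sigma> = f"
    unfolding act_def by (rule the_equality)
  show "linear_on scT UNIV scT (act A scT tens d \<sigma>)" unfolding act by (rule lin)
  show "length w = d \<Longrightarrow> crd (act A scT tens d \<sigma> x) (permute_list \<sigma> w) = psign w \<sigma> * crd x w"
    unfolding act by (rule crd_f)
  show "length w \<noteq> d \<Longrightarrow> crd (act A scT tens d \<sigma> x) w = 0"
    unfolding act by (rule crd_f0)
  show "w \<in> lists letters \<Longrightarrow> length w = d \<Longrightarrow>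
      act A scT tens d \<sigma> (bas w) = scT (psign w \<sigma>) (bas (permute_list \<sigma> w))"
    unfolding act by (simp add: f_bas del: in_lists_conv_set)
qed

lemma span_bas:
  assumes "\<And>w. crd x w \<noteq> 0 \<Longrightarrow> bas w \<in> X"
  shows "x \<in> T.span X"
proof -
  have "(\<Sum>w | crd x w \<noteq> 0. scT (crd x w) (bas w)) \<in> T.span X"
    by (intro T.span_sum T.span_scale T.span_base assms) simp
  then show ?thesis by (simp add: T.expansion)
qed

lemma subspace_support: "T.subspace {x. \<forall>w. crd x w \<noteq> 0 \<longrightarrow> Q w}"
proof (rule T.subspaceI)
  fix x y assume "x \<in> {x. \<forall>w. crd x w \<noteq> 0 \<longrightarrow> Q w}" "y \<in> {x. \<forall>w. crd x w \<noteq> 0 \<longrightarrow> Q w}"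
  moreover have "crd x w \<noteq> 0 \<or> crd y w \<noteq> 0" if "crd (x + y) w \<noteq> 0" for w
    using that by (auto simp: T.c_add)
  ultimately show "x + y \<in> {x. \<forall>w. crd x w \<noteq> 0 \<longrightarrow> Q w}" by blast
qed (auto simp: T.c_zero T.c_scale)

lemma tensor_power_eq: "tensor_power scT tens d = {x. \<forall>w. crd x w \<noteq> 0 \<longrightarrow> length w = d}"
proof
  show "tensor_power scT tens d \<subseteq> {x. \<forall>w. crd x w \<noteq> 0 \<longrightarrow> length w = d}"
    unfolding tensor_power_def
    by (rule T.span_minimal[OF _ subspace_support]) (auto simp: crd_tens dest: tcoef_length)
  show "{x. \<forall>w. crd x w \<noteq> 0 \<longrightarrow> length w = d} \<subseteq> tensor_power scT tens d"
    unfolding tensor_power_def by (auto intro!: span_bas simp: bas_def)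
qed

lemma bas_in_tensor_power: "bas w \<in> tensor_power scT tens (length w)"
  unfolding tensor_power_def bas_def by (rule T.span_base) auto

lemma tensor_parity_eq: "tensor_parity A scT tens p = {x. homogeneous p (crd x)}"
proof
  show "tensor_parity A scT tens p \<subseteq> {x. homogeneous p (crd x)}"
    unfolding tensor_parity_def homogeneous_def
  proof (rule T.span_minimal[OF _ subspace_support], clarify)
    fix v ps w
    assume "list_all2 (\<lambda>M q. M \<in> mat_grading A q) v ps" "crd (tens v) w \<noteq> 0"
    then show "wpar w = sum_list ps"
      unfolding crd_tens
    proof (induction v ps arbitrary: w rule: list_all2_induct)
      case Nil
      then show ?case by (cases w) auto
    next
      case (Cons m v q ps)
      then show ?case using cV_parity by (cases w) auto
    qed
  qed
  show "{x. homogeneous p (crd x)} \<subseteq> tensor_parity A scT tens p"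
    unfolding tensor_parity_def
  proof (clarify, rule span_bas, clarify)
    fix x w assume x: "homogeneous p (crd x)" and w: "crd x w \<noteq> 0"
    have "wpar w = p" using x w by (simp add: homogeneous_def)
    moreover have "w \<in> lists letters" by (rule T.support_subset[OF UNIV_I w])
    then have "list_all2 (\<lambda>M q. M \<in> mat_grading A q) (map xi_mat w) (map par w)"
      by (induction w) (simp_all add: xi_mat_grading[OF letter_homogeneous])
    ultimately show "\<exists>v. bas w = tens v \<and>
        (\<exists>ps. list_all2 (\<lambda>M q. M \<in> mat_grading A q) v ps \<and> sum_list ps = p)"
      unfolding bas_def wpar_def by blast
  qed
qed

text \<open>In coordinates the action is the signed permutation of words, so invariance becomes
  \<open>adjinv_iff_permute\<close>; words of length other than \<open>d\<close> have coefficient 0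
  on both sides.\<close>

lemma invariants_eq:
  "invariants A scT tens d = {x. (\<forall>w. crd x w \<noteq> 0 \<longrightarrow> length w = d) \<and> adjinv (crd x)}"
proof -
  have "(\<forall>\<sigma>. \<sigma> permutes {..<d} \<longrightarrow> act A scT tens d \<sigma> x = x) \<longleftrightarrow> adjinv (crd x)"
    if x: "\<And>w. crd x w \<noteq> 0 \<Longrightarrow> length w = d" for x
  proof
    assume *: "\<forall>\<sigma>. \<sigma> permutes {..<d} \<longrightarrow> act A scT tens d \<sigma> x = x"
    show "adjinv (crd x)" unfolding adjinv_iff_permute
    proof (intro allI impI)
      fix w :: "('a \<times> 'n \<times> 'n) list" and \<sigma> assume \<sigma>: "\<sigma> permutes {..<length w}"
      show "crd x (permute_list \<sigma> w) = psign w \<sigma> * crd x w"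
      proof (cases "length w = d")
        case True
        then show ?thesis using crd_act[of \<sigma> d w x] * \<sigma> by simp
      next
        case False
        then show ?thesis using x[of w] x[of "permute_list \<sigma> w"] by (metis length_permute_list mult_zero_right)
      qed
    qed
  next
    assume adj: "adjinv (crd x)"
    show "\<forall>\<sigma>. \<sigma> permutes {..<d} \<longrightarrow> act A scT tens d \<sigma> x = x"
    proof (intro allI impI T.c_inject UNIV_I)
      fix \<sigma> and w :: "('a \<times> 'n \<times> 'n) list" assume \<sigma>: "\<sigma> permutes {..<d}"
      show "crd (act A scT tens d \<sigma> x) w = crd x w"
      proof (cases "length w = d")
        case True
        define w' where "w' = permute_list (inv \<sigma>) w"
        have w: "w = permute_list \<sigma> w'" "length w' = d"
          using permute_list_inv(2)[of \<sigma> w] \<sigma> True by (simp_all add: w'_def)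
        then show ?thesis using crd_act[OF \<sigma> w(2)] adj \<sigma> by (simp add: adjinv_iff_permute)
      next
        case False
        then show ?thesis using x[of w] crd_act_other[OF \<sigma>] by metis
      qed
    qed
  qed
  then show ?thesis unfolding invariants_def tensor_power_eq by blast
qed

section \<open>The star product in coordinates\<close>

lemma star_spec:
  shows bilinear_star: "bilinear_on scT UNIV scT UNIV scT (star A scT tens)"
    and star_power: "x \<in> tensor_power scT tens d \<Longrightarrow> y \<in> tensor_power scT tens e \<Longrightarrow>
      star A scT tens x y = (\<Sum>\<sigma>\<in>shortest_reps d e. act A scT tens (d + e) \<sigma> (concat_tensor scT tens x y))"
proof -
  let ?s = "\<lambda>d e x y. \<Sum>\<sigma>\<in>shortest_reps d e. act A scT tens (d + e) \<sigma> (concat_tensor scT tens x y)"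
  let ?P = "\<lambda>f. bilinear_on scT UNIV scT UNIV scT f \<and>
     (\<forall>d e. \<forall>x\<in>tensor_power scT tens d. \<forall>y\<in>tensor_power scT tens e. f x y = ?s d e x y)"
  \<comment> \<open>On basis words the degrees can be read off as lengths; bilinearity then gives
    the formula on all pairs of tensor powers.\<close>
  define f where "f = T.ext2 scT (\<lambda>u v. ?s (length u) (length v) (bas u) (bas v))"
  note c = linear_onD[OF bilinear_onD(1)[OF bilinear_concat], simplified]
    linear_onD[OF bilinear_onD(2)[OF bilinear_concat], simplified]
  have perm: "\<sigma> permutes {..<d + e}" if "\<sigma> \<in> shortest_reps d e" for \<sigma> d e
    using that by (simp add: shortest_reps_def)
  note a = linear_onD[OF linear_act[OF perm], simplified]
  have bil_s: "bilinear_on scT UNIV scT UNIV scT (?s d e)" for d e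
    unfolding bilinear_on_def
    by (auto intro!: linear_onI simp: c a sum.distrib T.scale_sum_right cong: sum.cong)
  have bil: "bilinear_on scT UNIV scT UNIV scT f"
    unfolding f_def by (rule T.bilinear_ext2[OF module_T])
  have "f x y = ?s d e x y" if x: "x \<in> tensor_power scT tens d" and y: "y \<in> tensor_power scT tens e"
    for x y d e
  proof (rule bilinear_on_eq_on_span[OF module_T module_T module_T bil bil_s[of d e]])
    show "x \<in> T.span (bas ` {w \<in> lists letters. length w = d})"
      "y \<in> T.span (bas ` {w \<in> lists letters. length w = e})"
      using x y T.support_subset by (auto intro!: span_bas simp: tensor_power_eq)
    fix u v assume "u \<in> bas ` {w \<in> lists letters. length w = d}" "v \<in> bas ` {w \<in> lists letters. length w = e}"
    then obtain u' v' where uv: "u' \<in> lists letters" "v' \<in> lists letters" "u = bas u'" "v = bas v'"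
        "length u' = d" "length v' = e"
      by blast
    show "f u v = ?s d e u v"
      unfolding f_def uv(3,4) T.ext2_e[OF module_T uv(1,2)] uv(5,6) ..
  qed simp_all
  then have "?P f" using bil by blast
  then have "?P (star A scT tens)"
    unfolding star_def
  proof (rule the_unique[where P = ?P])
    fix f g assume *: "?P f" "?P g"
    have "f x y = g x y" for x y
    proof (rule T.bilinear_eqI[OF module_T, where f = f and g = g])
      show "f (bas u) (bas v) = g (bas u) (bas v)" for u v
        using * bas_in_tensor_power[of u] bas_in_tensor_power[of v] by metis
    qed (use * in auto)
    then show "f = g" by blast
  qed
  then show "bilinear_on scT UNIV scT UNIV scT (star A scT tens)"
    "x \<in> tensor_power scT tens d \<Longrightarrow> y \<in> tensor_power scT tens e \<Longrightarrow>
      star A scT tens x y = ?s d e x y" by blast+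
qed

lemmas star_simps = linear_onD[OF bilinear_onD(1)[OF bilinear_star], simplified]
  linear_onD[OF bilinear_onD(2)[OF bilinear_star], simplified]

text \<open>Both sides are bilinear, so basis words \<open>u\<close> and \<open>v\<close> suffice.
  There the sum over representatives is the one in \<open>sum_shortest_reps\<close>, and a word
  \<open>w\<close> of the wrong length gives 0 on both sides.\<close>

lemma crd_star: "crd (star A scT tens x y) w = shuf (crd x) (crd y) w"
proof (rule T.bilinear_eqI[OF module_mult, of "\<lambda>x y. crd (star A scT tens x y) w"
      "\<lambda>x y. shuf (crd x) (crd y) w"])
  show "bilinear_on scT UNIV scT UNIV (*) (\<lambda>x y. crd (star A scT tens x y) w)"
    unfolding bilinear_on_def by (auto intro!: linear_onI simp: star_simps T.c_add T.c_scale)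
  have "crd (x + y) = (\<lambda>w. crd x w + crd y w)" "crd (scT c x) = (\<lambda>w. c * crd x w)" for x y c
    by (auto simp: T.c_add T.c_scale)
  then show "bilinear_on scT UNIV scT UNIV (*) (\<lambda>x y. shuf (crd x) (crd y) w)"
    unfolding bilinear_on_def
    by (auto intro!: linear_onI simp: shuf_add_left shuf_add_right shuf_scale_left shuf_scale_right)
next
  fix u v assume uv: "u \<in> lists letters" "v \<in> lists letters"
  define d e where "d = length u" and "e = length v"
  have u: "length x = d" if "crd (bas u) x \<noteq> 0" for x
    using that T.c_e[OF uv(1)] by (auto simp: d_def split: if_splits)
  have v: "length x = e" if "crd (bas v) x \<noteq> 0" for x
    using that T.c_e[OF uv(2)] by (auto simp: e_def split: if_splits)
  have perm: "\<sigma> permutes {..<d + e}" if "\<sigma> \<in> shortest_reps d e" for \<sigma>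
    using that by (simp add: shortest_reps_def)
  have star: "star A scT tens (bas u) (bas v)
      = (\<Sum>\<sigma>\<in>shortest_reps d e. act A scT tens (d + e) \<sigma> (tens (map xi_mat u @ map xi_mat v)))"
    using star_power[OF bas_in_tensor_power[of u] bas_in_tensor_power[of v]]
    by (simp add: d_def e_def bas_def concat_tens)
  show "crd (star A scT tens (bas u) (bas v)) w = shuf (crd (bas u)) (crd (bas v)) w"
  proof (cases "length w = d + e")
    case True
    have "crd (act A scT tens (d + e) \<sigma> (tens (map xi_mat u @ map xi_mat v))) w
      = psign (permute_list (inv \<sigma>) w) \<sigma> * (crd (bas u) (take d (permute_list (inv \<sigma>) w))
          * crd (bas v) (drop d (permute_list (inv \<sigma>) w)))"
      if "\<sigma> \<in> shortest_reps d e" for \<sigma>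
    proof -
      let ?w = "permute_list (inv \<sigma>) w"
      have "permute_list \<sigma> ?w = w" using permute_list_inv(2)[of \<sigma> w] perm[OF that] True by simp
      then show ?thesis
        using crd_act[OF perm[OF that], of ?w "tens (map xi_mat u @ map xi_mat v)"] True
        by (simp add: crd_tens tcoef_append[of _ d] d_def bas_def)
    qed
    then show ?thesis
      unfolding star by (simp add: T.c_sum sum_shortest_reps[of w d e, OF True u] cong: sum.cong)
  next
    case False
    then have "crd (act A scT tens (d + e) \<sigma> z) w = 0" if "\<sigma> \<in> shortest_reps d e" for \<sigma> z
      using crd_act_other[OF perm[OF that]] by simp
    then show ?thesis
      unfolding star using shuf_length[of "crd (bas u)" d "crd (bas v)" e w, OF u v False]
      by (simp add: T.c_sum)
  qed
qed simp_all

section \<open>The coproduct and the counit in coordinates\<close>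

lemma nabla_spec:
  shows linear_nabla: "linear_on scT UNIV sc2 (nabla scT tens sc2 tn)"
    and nabla_tens: "nabla scT tens sc2 tn (tens v) = (\<Sum>l\<le>length v. tn (tens (take l v)) (tens (drop l v)))"
proof -
  let ?h = "\<lambda>v. \<Sum>l\<le>length v. tn (tens (take l v)) (tens (drop l v))"
  let ?P = "\<lambda>f. linear_on scT UNIV sc2 f \<and> (\<forall>v. f (tens v) = ?h v)"
  have "multilinear (mat_scale sc) sc2 ?h"
    unfolding multilinear_def
  proof (intro conjI allI)
    fix u v x y
    \<comment> \<open>Each cut leaves the modified entry in exactly one of the two factors, so the
      sums can be compared term by term.\<close>
    show "?h (u @ [x + y] @ v) = ?h (u @ [x] @ v) + ?h (u @ [y] @ v)"
      unfolding length_append list.size sum.distrib[symmetric]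
      by (rule sum.cong) (auto simp: take_append drop_append take_Cons' drop_Cons' tens_multilinear tn_simps)
  next
    fix c u v x
    show "?h (u @ [mat_scale sc c x] @ v) = sc2 c (?h (u @ [x] @ v))"
      unfolding length_append list.size U.scale_sum_right
      by (rule sum.cong) (auto simp: take_append drop_append take_Cons' drop_Cons' tens_multilinear tn_simps)
  qed
  then obtain f where f: "?P f" using tensor_algebra_lift[OF talg module_U] by blast
  have "?P (nabla scT tens sc2 tn)"
    unfolding nabla_def
    by (rule the_unique[where P = ?P, OF f]) (use tensor_algebra_eqI[OF talg module_U] in metis)
  then show "linear_on scT UNIV sc2 (nabla scT tens sc2 tn)"
    "nabla scT tens sc2 tn (tens v) = ?h v" by blast+
qed

lemma nabla_in_U0: "nabla scT tens sc2 tn x \<in> U0"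
proof (rule linear_on_image_span[OF module_T module_U linear_nabla T.subspace_UNIV _ U.subspace_M])
  show "x \<in> T.span (range tens)" using talg by (simp add: tensor_algebra_def)
  show "nabla scT tens sc2 tn y \<in> U0" if "y \<in> range tens" for y
    using that by (auto simp: nabla_tens intro!: U.subspace_sum U.subspace_M tn_in_U0)
qed simp

text \<open>For a basis word \<open>w\<close>, the cut at \<open>l\<close> produces the pair
  \<open>(u, v)\<close> only if \<open>l = length u\<close> and \<open>w = u @ v\<close>, so at most
  one term survives.\<close>

lemma crd2_nabla: "crd2 (nabla scT tens sc2 tn x) (u, v) = crd x (u @ v)"
proof (rule T.linear_eqI[OF module_mult, where x = x])
  show "linear_on scT UNIV (*) (\<lambda>x. crd2 (nabla scT tens sc2 tn x) (u, v))"
    by (auto intro!: linear_onI simp: linear_onD[OF linear_nabla] U.c_add U.c_scale nabla_in_U0)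
  fix w assume w: "w \<in> lists letters"
  have "crd2 (nabla scT tens sc2 tn (bas w)) (u, v)
      = (\<Sum>l\<le>length w. crd (bas (take l w)) u * crd (bas (drop l w)) v)"
    unfolding bas_def nabla_tens
    by (subst U.c_sum) (auto simp: tn_in_U0 crd2_tn take_map drop_map)
  also have "\<dots> = (\<Sum>l\<le>length w. if l = length u then (if w = u @ v then 1 else 0) else 0)"
  proof (rule sum.cong)
    fix l assume l: "l \<in> {..length w}"
    have t: "take l w \<in> lists letters" "drop l w \<in> lists letters"
      using w by (auto dest: in_set_takeD in_set_dropD)
    have iff: "take l w = u \<and> drop l w = v \<longleftrightarrow> l = length u \<and> w = u @ v"
    proof
      assume *: "take l w = u \<and> drop l w = v"
      then have "w = u @ v" using append_take_drop_id[of l w] by simp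
      moreover have "l = length u" using * l by auto
      ultimately show "l = length u \<and> w = u @ v" by simp
    qed simp
    have "crd (bas (take l w)) u * crd (bas (drop l w)) v
        = (if take l w = u \<and> drop l w = v then 1 else 0)"
      unfolding T.c_e[OF t(1)] T.c_e[OF t(2)] by simp
    also have "\<dots> = (if l = length u then (if w = u @ v then 1 else 0) else 0)"
      unfolding iff by simp
    finally show "crd (bas (take l w)) u * crd (bas (drop l w)) v
        = (if l = length u then (if w = u @ v then 1 else 0) else 0)" .
  qed simp
  also have "\<dots> = crd (bas w) (u @ v)" unfolding T.c_e[OF w] by auto
  finally show "crd2 (nabla scT tens sc2 tn (bas w)) (u, v) = crd (bas w) (u @ v)" .
qed (simp_all add: linear_crd)

lemma counit_eq: "counit scT tens x = crd x []"
proof -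
  have "counit scT tens = (\<lambda>x. crd x [])"
    unfolding counit_def
  proof (rule the_equality)
    have *: "tcoef v [] = (if v = [] then 1 else 0)" for v by (cases v) auto
    then show "linear_on scT UNIV (*) (\<lambda>x. crd x []) \<and> (\<forall>v. crd (tens v) [] = (if v = [] then 1 else 0))"
      by (simp add: linear_crd crd_tens)
    show "f = (\<lambda>x. crd x [])"
      if "linear_on scT UNIV (*) f \<and> (\<forall>v. f (tens v) = (if v = [] then 1 else 0))" for f
      by (rule tensor_algebra_eqI[OF talg module_mult]) (use that linear_crd * in \<open>auto simp: crd_tens\<close>)
  qed
  then show ?thesis by simp
qed

section \<open>The tensor superbialgebra\<close>

abbreviation P :: "bit \<Rightarrow> 't set" where "P \<equiv> tensor_parity A scT tens"

abbreviation star_prod :: "'t \<Rightarrow> 't \<Rightarrow> 't" (infixl "\<star>" 70) where "(\<star>) \<equiv> star A scT tens"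

abbreviation cop :: "'t \<Rightarrow> 'u" where "cop \<equiv> nabla scT tens sc2 tn"

lemma subspace_P: "T.subspace (P p)"
  unfolding tensor_parity_eq homogeneous_def by (rule subspace_support)

lemma P_disjoint: "P 0 \<inter> P 1 = {0}"
proof -
  have "x = 0" if x: "homogeneous 0 (crd x)" "homogeneous 1 (crd x)" for x
  proof (rule T.c_inject)
    show "crd x w = crd 0 w" for w
      using x unfolding homogeneous_def T.c_zero by (metis zero_neq_one)
  qed simp_all
  moreover have "homogeneous p (crd 0)" for p by (simp add: homogeneous_def T.c_zero)
  ultimately show ?thesis unfolding tensor_parity_eq by auto
qed

lemma bas_homogeneous: "w \<in> lists letters \<Longrightarrow> homogeneous (wpar w) (crd (bas w))"
  unfolding homogeneous_def by (simp only: T.c_e) simp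

lemma bas_in_P: "w \<in> lists letters \<Longrightarrow> bas w \<in> P (wpar w)"
  unfolding tensor_parity_eq using bas_homogeneous by blast

text \<open>Sorting the generators of a linear combination by parity splits it into homogeneous
  parts that stay in \<open>H\<close>.\<close>

lemma direct_sum_P:
  assumes H: "H = T.span X" "X \<subseteq> P 0 \<union> P 1"
  shows "direct_sum H (H \<inter> P 0) (H \<inter> P 1)"
proof -
  have "\<exists>y z. x = y + z \<and> y \<in> H \<inter> P 0 \<and> z \<in> H \<inter> P 1" if "x \<in> H" for x
    using that unfolding H(1)
  proof (induction rule: T.span_induct_alt)
    case base
    then show ?case using subspace_P by (intro exI[of _ 0]) (simp add: T.span_zero T.subspace_0)
  next
    case (step c x y)
    then obtain y0 y1 where y: "y = y0 + y1" "y0 \<in> T.span X \<inter> P 0" "y1 \<in> T.span X \<inter> P 1"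
      by blast
    have x: "scT c x \<in> T.span X" using step(1) by (intro T.span_scale T.span_base)
    consider "x \<in> P 0" | "x \<in> P 1" using step(1) H(2) by blast
    then show ?case
    proof cases
      case 1
      then have "scT c x + y0 \<in> T.span X \<inter> P 0"
        using x y subspace_P by (auto intro!: T.span_add T.subspace_add T.subspace_scale)
      then show ?thesis using y by (intro exI[of _ "scT c x + y0"] exI[of _ y1]) (simp add: algebra_simps)
    next
      case 2
      then have "scT c x + y1 \<in> T.span X \<inter> P 1"
        using x y subspace_P by (auto intro!: T.span_add T.subspace_add T.subspace_scale)
      then show ?thesis using y by (intro exI[of _ y0] exI[of _ "scT c x + y1"]) (simp add: algebra_simps)
    qed
  qed
  moreover have "y + z \<in> H" if "y \<in> H" "z \<in> H" for y z using that H(1) T.span_add by blast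
  moreover have "0 \<in> H" using H(1) T.span_zero by blast
  ultimately show ?thesis unfolding direct_sum_def using P_disjoint by blast
qed

lemma crd_one: "crd (tens []) w = (if w = [] then 1 else 0)"
  unfolding crd_tens by (cases w) auto

lemma crd_star': "crd (x \<star> y) = shuf (crd x) (crd y)"
  using crd_star by blast

lemma superalgebra_T: "superalgebra scT UNIV P (\<star>)"
  unfolding superalgebra_def graded_module_def
proof (intro conjI allI ballI)
  show "direct_sum UNIV (P 0) (P 1)"
  proof -
    have "bas ` lists letters \<subseteq> P 0 \<union> P 1"
    proof (rule image_subsetI)
      fix w assume "w \<in> lists letters"
      from bas_in_P[OF this] show "bas w \<in> P 0 \<union> P 1" by (cases "wpar w") auto
    qed
    from direct_sum_P[OF T.span_e[symmetric] this] show ?thesis by simp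
  qed
  show "x \<star> y \<in> P (i + j)" if "x \<in> P i" "y \<in> P j" for x y i j
    using that shuf_homogeneous unfolding tensor_parity_eq by (simp add: crd_star')
  show "x \<star> y \<star> z = x \<star> (y \<star> z)" for x y z
    by (rule T.c_inject) (simp_all add: crd_star' shuf_assoc)
qed (simp_all add: module_T subspace_P bilinear_star)

lemma nabla_bas:
  "cop (bas w) = (\<Sum>l\<le>length w. tn (bas (take l w)) (bas (drop l w)))"
  by (simp add: bas_def nabla_tens take_map drop_map)

lemma nabla_parity:
  assumes "x \<in> P i"
  shows "cop x \<in> tensor_grading sc2 tn P i"
proof (rule linear_on_image_span[OF module_T module_U linear_nabla T.subspace_UNIV])
  show "x \<in> T.span (bas ` {w \<in> lists letters. wpar w = i})"
    using assms T.support_subset by (intro span_bas) (auto simp: tensor_parity_eq homogeneous_def)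
  show "U.subspace (tensor_grading sc2 tn P i)" by (simp add: tensor_grading_def)
  fix y assume "y \<in> bas ` {w \<in> lists letters. wpar w = i}"
  then obtain w where w: "w \<in> lists letters" "wpar w = i" "y = bas w" by auto
  have "tn (bas (take l w)) (bas (drop l w)) \<in> tensor_grading sc2 tn P i" for l
  proof -
    have "take l w \<in> lists letters" "drop l w \<in> lists letters"
      using w(1) by (auto dest: in_set_takeD in_set_dropD)
    then have "bas (take l w) \<in> P (wpar (take l w))" "bas (drop l w) \<in> P (wpar (drop l w))"
      using bas_in_P by auto
    moreover have "wpar (take l w) + wpar (drop l w) = i"
      unfolding wpar_simps(3)[symmetric] append_take_drop_id by (rule w(2))
    ultimately show ?thesis unfolding tensor_grading_def by (intro U.span_base) blast
  qed
  then show "cop y \<in> tensor_grading sc2 tn P i"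
    unfolding w(3) nabla_bas by (intro U.subspace_sum) (simp_all add: tensor_grading_def)
qed simp_all

section \<open>Coassociativity and the counit axioms\<close>

lemma T_cube:
  shows tnl_product: "tensor_product sc2 U0 scT UNIV sc3 tnl"
    and tnr_product: "tensor_product scT UNIV sc2 U0 sc3 tnr"
    and tnl_tnr: "tnl (tn x y) z = tnr x (tn y z)"
  using tcube by (auto simp: tensor_square_cube_def)

lemma module_W: "module sc3"
  by (rule tensor_product_module[OF tnl_product])

sublocale W: module sc3 by (rule module_W)

lemma bilinear_tnl: "bilinear_on sc2 U0 scT UNIV sc3 tnl"
  by (rule tensor_bilinear[OF tnl_product module_U module_T U.subspace_M T.subspace_UNIV])

lemma bilinear_tnr: "bilinear_on scT UNIV sc2 U0 sc3 tnr"
  by (rule tensor_bilinear[OF tnr_product module_T module_U T.subspace_UNIV U.subspace_M])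

lemmas tnl_simps = linear_onD[OF bilinear_onD(1)[OF bilinear_tnl], simplified]
  linear_onD[OF bilinear_onD(2)[OF bilinear_tnl], simplified]

lemmas tnr_simps = linear_onD[OF bilinear_onD(1)[OF bilinear_tnr], simplified]
  linear_onD[OF bilinear_onD(2)[OF bilinear_tnr], simplified]

lemmas nabla_simps = linear_onD[OF linear_nabla, simplified]

text \<open>Both sides run over the ways to cut \<open>v\<close> into three pieces; they differ in
  which of the two cuts is made first.\<close>

lemma sum_split_thrice:
  "(\<Sum>l\<le>length v. \<Sum>m\<le>l. F (take m v) (drop m (take l v)) (drop l v))
    = (\<Sum>l\<le>length v. \<Sum>m\<le>length v - l. F (take l v) (take m (drop l v)) (drop m (drop l v)))"
  unfolding sum.Sigma[OF finite_atMost ballI[OF finite_atMost]]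
  by (rule sum.reindex_bij_witness[of _ "\<lambda>(l, m). (l + m, l)" "\<lambda>(l, m). (m, l - m)"])
    (auto simp: drop_take)

text \<open>On pure tensors both composites are the sum over all cuts into three pieces, compared
  through the identification of the two cubes.\<close>

lemma coassociative:
  "\<exists>cop_id id_cop.
    linear_on sc2 U0 sc3 cop_id \<and> linear_on sc2 U0 sc3 id_cop \<and>
    (\<forall>x y. cop_id (tn x y) = tnl (cop x) y \<and> id_cop (tn x y) = tnr x (cop y)) \<and>
    (\<forall>x. cop_id (cop x) = id_cop (cop x))"
proof -
  have "bilinear_on scT UNIV scT UNIV sc3 (\<lambda>x y. tnl (cop x) y)"
    "bilinear_on scT UNIV scT UNIV sc3 (\<lambda>x y. tnr x (cop y))"
    unfolding bilinear_on_def
    by (auto intro!: linear_onI simp: tnl_simps tnr_simps nabla_simps nabla_in_U0)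
  from this[THEN tensor_lift[OF T_tensor module_T module_T module_W T.subspace_UNIV T.subspace_UNIV]]
  obtain cop_id id_cop where
    l: "linear_on sc2 U0 sc3 cop_id" "linear_on sc2 U0 sc3 id_cop" and
    eq: "\<And>x y. cop_id (tn x y) = tnl (cop x) y" "\<And>x y. id_cop (tn x y) = tnr x (cop y)"
    by auto
  have "(\<lambda>x. cop_id (cop x)) = (\<lambda>x. id_cop (cop x))"
  proof (rule tensor_algebra_eqI[OF talg module_W])
    show "linear_on scT UNIV sc3 (\<lambda>x. cop_id (cop x))" "linear_on scT UNIV sc3 (\<lambda>x. id_cop (cop x))"
      by (auto intro!: linear_onI simp: nabla_simps linear_onD[OF l(1)] linear_onD[OF l(2)] nabla_in_U0)
    fix v
    have "cop_id (cop (tens v)) = (\<Sum>l\<le>length v. tnl (cop (tens (take l v))) (tens (drop l v)))"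
      unfolding nabla_tens[of v]
      by (simp add: linear_on_sum[OF module_U module_W l(1) U.subspace_M] tn_in_U0 eq)
    also have "\<dots> = (\<Sum>l\<le>length v. \<Sum>m\<le>l.
        tnl (tn (tens (take m v)) (tens (drop m (take l v)))) (tens (drop l v)))"
      unfolding nabla_tens
      by (rule sum.cong) (auto simp: min_def tn_in_U0
          linear_on_sum[OF module_U module_W bilinear_onD(1)[OF bilinear_tnl UNIV_I] U.subspace_M])
    also have "\<dots> = (\<Sum>l\<le>length v. \<Sum>m\<le>length v - l.
        tnl (tn (tens (take l v)) (tens (take m (drop l v)))) (tens (drop m (drop l v))))"
      by (rule sum_split_thrice)
    also have "\<dots> = (\<Sum>l\<le>length v. tnr (tens (take l v)) (cop (tens (drop l v))))"
      unfolding nabla_tens tnl_tnr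
      by (rule sum.cong) (auto simp: tn_in_U0
          linear_on_sum[OF module_U module_W bilinear_onD(2)[OF bilinear_tnr UNIV_I] U.subspace_M])
    also have "\<dots> = id_cop (cop (tens v))"
      unfolding nabla_tens[of v]
      by (simp add: linear_on_sum[OF module_U module_W l(2) U.subspace_M] tn_in_U0 eq)
    finally show "cop_id (cop (tens v)) = id_cop (cop (tens v))" .
  qed
  then have "cop_id (cop x) = id_cop (cop x)" for x by meson
  then show ?thesis using l eq by blast
qed

lemma counital:
  "\<exists>cou_id id_cou.
    linear_on sc2 U0 scT cou_id \<and> linear_on sc2 U0 scT id_cou \<and>
    (\<forall>x y. cou_id (tn x y) = scT (crd x []) y \<and> id_cou (tn x y) = scT (crd y []) x) \<and>
    (\<forall>x. cou_id (cop x) = x \<and> id_cou (cop x) = x)"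
proof -
  have "bilinear_on scT UNIV scT UNIV scT (\<lambda>x y. scT (crd x []) y)"
    "bilinear_on scT UNIV scT UNIV scT (\<lambda>x y. scT (crd y []) x)"
    unfolding bilinear_on_def
    by (auto intro!: linear_onI simp: T.c_add T.c_scale T.scale_left_distrib T.scale_right_distrib
        mult.commute)
  from this[THEN tensor_lift[OF T_tensor module_T module_T module_T T.subspace_UNIV T.subspace_UNIV]]
  obtain cou_id id_cou where
    l: "linear_on sc2 U0 scT cou_id" "linear_on sc2 U0 scT id_cou" and
    eq: "\<And>x y. cou_id (tn x y) = scT (crd x []) y" "\<And>x y. id_cou (tn x y) = scT (crd y []) x"
    by auto
  have lin_id: "linear_on scT UNIV scT (\<lambda>x. x)" by (rule linear_onI) simp_all
  have empty: "crd (tens v) [] = (if v = [] then 1 else 0)" for v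
    unfolding crd_tens by (cases v) auto
  have "(\<lambda>x. cou_id (cop x)) = (\<lambda>x. x)"
  proof (rule tensor_algebra_eqI[OF talg module_T _ lin_id])
    show "linear_on scT UNIV scT (\<lambda>x. cou_id (cop x))"
      by (auto intro!: linear_onI simp: nabla_simps linear_onD[OF l(1)] nabla_in_U0)
    fix v
    have "cou_id (cop (tens v)) = (\<Sum>l\<le>length v. scT (crd (tens (take l v)) []) (tens (drop l v)))"
      unfolding nabla_tens[of v]
      by (simp add: linear_on_sum[OF module_U module_T l(1) U.subspace_M] tn_in_U0 eq)
    also have "\<dots> = (\<Sum>l\<le>length v. if l = 0 then tens v else 0)"
      unfolding empty by (rule sum.cong) auto
    finally show "cou_id (cop (tens v)) = tens v" by simp
  qed
  moreover have "(\<lambda>x. id_cou (cop x)) = (\<lambda>x. x)"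
  proof (rule tensor_algebra_eqI[OF talg module_T _ lin_id])
    show "linear_on scT UNIV scT (\<lambda>x. id_cou (cop x))"
      by (auto intro!: linear_onI simp: nabla_simps linear_onD[OF l(2)] nabla_in_U0)
    fix v
    have "id_cou (cop (tens v)) = (\<Sum>l\<le>length v. scT (crd (tens (drop l v)) []) (tens (take l v)))"
      unfolding nabla_tens[of v]
      by (simp add: linear_on_sum[OF module_U module_T l(2) U.subspace_M] tn_in_U0 eq)
    also have "\<dots> = (\<Sum>l\<le>length v. if l = length v then tens v else 0)"
      unfolding empty by (rule sum.cong) auto
    finally show "id_cou (cop (tens v)) = tens v" by simp
  qed
  ultimately have "cou_id (cop x) = x \<and> id_cou (cop x) = x" for x by meson
  then show ?thesis using l eq by blast
qed

text \<open>Prescribed on basis words, which are homogeneous, so that the Koszul sign makes sense;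
  \<open>mul2_tn\<close> recovers the rule for all homogeneous middle factors.\<close>

definition mul2 :: "'u \<Rightarrow> 'u \<Rightarrow> 'u" where
  "mul2 = U.ext2 sc2 (\<lambda>(a, b) (a', b').
     sc2 (koszul_sign (wpar b) (wpar a')) (tn (bas a \<star> bas a') (bas b \<star> bas b')))"

lemma bilinear_mul2: "bilinear_on sc2 U0 sc2 U0 sc2 mul2"
  unfolding mul2_def by (rule U.bilinear_ext2[OF module_U])

lemma mul2_in_U0: "mul2 p q \<in> U0"
  unfolding mul2_def U.ext2_def[OF module_U] U.ext_def
  by (intro U.subspace_sum U.subspace_scale U.subspace_M)
    (auto intro!: U.subspace_scale U.subspace_M tn_in_U0 split: prod.split)

text \<open>Both sides are bilinear, and on basis words the identity is
  \<open>shuf2_tensor\<close>.\<close>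

lemma crd2_mul2:
  assumes "p \<in> U0" "q \<in> U0"
  shows "crd2 (mul2 p q) (u, v) = shuf2 (\<lambda>u v. crd2 p (u, v)) (\<lambda>u v. crd2 q (u, v)) u v"
proof (rule U.bilinear_eqI[OF module_mult _ _ _ assms, of "\<lambda>p q. crd2 (mul2 p q) (u, v)"
      "\<lambda>p q. shuf2 (\<lambda>u v. crd2 p (u, v)) (\<lambda>u v. crd2 q (u, v)) u v"])
  note m = linear_onD[OF bilinear_onD(1)[OF bilinear_mul2]] linear_onD[OF bilinear_onD(2)[OF bilinear_mul2]]
  show "bilinear_on sc2 U0 sc2 U0 (*) (\<lambda>p q. crd2 (mul2 p q) (u, v))"
    unfolding bilinear_on_def
    by (auto intro!: linear_onI simp: m U.c_add U.c_scale mul2_in_U0)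
  show "bilinear_on sc2 U0 sc2 U0 (*) (\<lambda>p q. shuf2 (\<lambda>u v. crd2 p (u, v)) (\<lambda>u v. crd2 q (u, v)) u v)"
    unfolding bilinear_on_def
    by (auto intro!: linear_onI simp: U.c_add U.c_scale shuf2_add_left shuf2_add_right
        shuf2_scale_left shuf2_scale_right)
next
  fix i j assume "i \<in> lists letters \<times> lists letters" "j \<in> lists letters \<times> lists letters"
  then obtain a b a' b' where ij: "i = (a, b)" "j = (a', b')"
    and l: "a \<in> lists letters" "b \<in> lists letters" "a' \<in> lists letters" "b' \<in> lists letters"
    by (cases i; cases j) simp
  have "mul2 (tn (bas a) (bas b)) (tn (bas a') (bas b'))
      = sc2 (koszul_sign (wpar b) (wpar a')) (tn (bas a \<star> bas a') (bas b \<star> bas b'))"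
    using U.ext2_e[OF module_U, of "(a, b)" "(a', b')"] l unfolding mul2_def by simp
  then show "crd2 (mul2 (case i of (u, v) \<Rightarrow> tn (bas u) (bas v)) (case j of (u, v) \<Rightarrow> tn (bas u) (bas v))) (u, v)
    = shuf2 (\<lambda>u v. crd2 (case i of (u, v) \<Rightarrow> tn (bas u) (bas v)) (u, v))
        (\<lambda>ua v. crd2 (case j of (u, v) \<Rightarrow> tn (bas u) (bas v)) (ua, v)) u v"
    using shuf2_tensor[OF bas_homogeneous[OF l(2)] bas_homogeneous[OF l(3)]]
    by (simp add: ij U.c_scale tn_in_U0 crd2_tn crd_star')
qed

lemma mul2_tn:
  assumes "y \<in> P i" "z \<in> P j"
  shows "mul2 (tn x y) (tn z w) = sc2 (koszul_sign i j) (tn (x \<star> z) (y \<star> w))"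
proof (rule U.c_inject)
  fix uv :: "('a \<times> 'n \<times> 'n) list \<times> ('a \<times> 'n \<times> 'n) list"
  obtain u v where uv: "uv = (u, v)" by (cases uv)
  have "homogeneous i (crd y)" "homogeneous j (crd z)"
    using assms unfolding tensor_parity_eq by auto
  from shuf2_tensor[OF this] show
    "crd2 (mul2 (tn x y) (tn z w)) uv = crd2 (sc2 (koszul_sign i j) (tn (x \<star> z) (y \<star> w))) uv"
    by (simp add: uv crd2_mul2 tn_in_U0 U.c_scale crd2_tn crd_star')
qed (auto intro!: mul2_in_U0 U.subspace_scale U.subspace_M tn_in_U0)

text \<open>Read at a pair of words, this is \<open>shuf_append\<close>.\<close>

lemma nabla_star: "cop (x \<star> y) = mul2 (cop x) (cop y)"
proof (rule U.c_inject)
  fix uv :: "('a \<times> 'n \<times> 'n) list \<times> ('a \<times> 'n \<times> 'n) list"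
  obtain u v where uv: "uv = (u, v)" by (cases uv)
  show "crd2 (cop (x \<star> y)) uv = crd2 (mul2 (cop x) (cop y)) uv"
    by (simp add: uv crd2_mul2 nabla_in_U0 crd2_nabla crd_star' shuf_append)
qed (auto intro!: mul2_in_U0 nabla_in_U0)

lemma superbialgebra_T:
  "superbialgebra scT sc2 tn sc3 tnl tnr UNIV P (\<star>) (tens []) cop (counit scT tens)"
proof -
  have cou: "counit scT tens = (\<lambda>x. crd x [])" using counit_eq by blast
  have "crd x [] = 0" if "x \<in> P 1" for x
    using that unfolding tensor_parity_eq homogeneous_def
    by (metis (mono_tags, lifting) mem_Collect_eq wpar_simps(1) zero_neq_one)
  then have coalg: "supercoalgebra scT sc2 tn sc3 tnl tnr UNIV P cop (counit scT tens)"
    unfolding supercoalgebra_def cou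
    using superalgebra_T tcube linear_nabla nabla_parity linear_crd coassociative counital
    by (simp add: superalgebra_def)
  have "tens [] \<in> P 0"
    unfolding tensor_parity_eq by (auto simp: homogeneous_def crd_one)
  moreover have "tens [] \<star> x = x" "x \<star> tens [] = x" for x
    by (rule T.c_inject; simp add: crd_star' crd_one[abs_def] shuf_unit_left shuf_unit_right)+
  moreover have "cop (tens []) = tn (tens []) (tens [])" by (simp add: nabla_tens)
  moreover have "crd (x \<star> y) [] = crd x [] * crd y []" for x y by (simp add: crd_star')
  moreover have "\<exists>mul2. bilinear_on sc2 U0 sc2 U0 sc2 mul2 \<and>
        (\<forall>i j. \<forall>x\<in>UNIV. \<forall>y\<in>P i. \<forall>z\<in>P j. \<forall>w\<in>UNIV.
           mul2 (tn x y) (tn z w) = sc2 (koszul_sign i j) (tn (x \<star> z) (y \<star> w))) \<and>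
        (\<forall>x\<in>UNIV. \<forall>y\<in>UNIV. cop (x \<star> y) = mul2 (cop x) (cop y))"
    using bilinear_mul2 mul2_tn nabla_star by blast
  ultimately show ?thesis
    unfolding superbialgebra_def using superalgebra_T coalg by (simp add: cou crd_one)
qed

section \<open>The submodules of invariant and divisible elements\<close>

lemma Tri_lists: "w \<in> Tri A B \<Longrightarrow> w \<in> lists letters"
  by (auto simp: Tri_def letters_def)

lemma Tri_even:
  assumes "w \<in> Tri A B" "k < length w" "l < length w" "k \<noteq> l" "w ! k = w ! l"
  shows "par (w ! k) = 0"
proof -
  have "w ! k \<in> letters" using Tri_lists[OF assms(1)] assms(2) by auto
  moreover have "fst (w ! k) \<in> A 0" using assms by (simp add: Tri_def)
  ultimately show ?thesis by (simp add: par_letter)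
qed

text \<open>Cosets of the stabilizer are indexed by the distinct rearrangements of \<open>w\<close>,
  and each rearrangement receives the sign of an arbitrarily chosen permutation.\<close>

lemma xi_expansion:
  assumes w: "w \<in> lists letters"
  defines "cls \<equiv> \<lambda>v. {\<rho>. \<rho> permutes {..<length w} \<and> permute_list \<rho> w = v}"
  shows "xi A scT tens w = (\<Sum>v\<in>(\<lambda>\<sigma>. permute_list \<sigma> w) ` {\<sigma>. \<sigma> permutes {..<length w}}.
    scT (psign w (SOME \<sigma>. \<sigma> \<in> cls v)) (bas v))"
proof -
  let ?R = "(\<lambda>\<sigma>. permute_list \<sigma> w) ` {\<sigma>. \<sigma> permutes {..<length w}}"
  have some: "(SOME \<sigma>. \<sigma> \<in> cls v) \<in> cls v" if "v \<in> ?R" for v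
  proof -
    obtain \<sigma> where "\<sigma> \<in> cls v" using \<open>v \<in> ?R\<close> by (auto simp: cls_def)
    then show ?thesis by (rule someI[of "\<lambda>\<sigma>. \<sigma> \<in> cls v"])
  qed
  have image: "{f \<sigma> | \<sigma>. Q \<sigma>} = g ` {\<sigma>. Q \<sigma>}" if "\<And>\<sigma>. Q \<sigma> \<Longrightarrow> f \<sigma> = g \<sigma>"
    for f g :: "(nat \<Rightarrow> nat) \<Rightarrow> (nat \<Rightarrow> nat) set" and Q
    using that by auto
  have "stabilizer_cosets w = (\<lambda>\<sigma>. cls (permute_list \<sigma> w)) ` {\<sigma>. \<sigma> permutes {..<length w}}"
    unfolding stabilizer_cosets_def by (rule image) (simp add: cls_def stabilizer_coset)
  also have "\<dots> = cls ` ?R" by (simp only: image_image)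
  finally have "stabilizer_cosets w = cls ` ?R" .
  moreover have "inj_on cls ?R"
  proof (rule inj_onI)
    fix u v assume "u \<in> ?R" "v \<in> ?R" "cls u = cls v"
    then show "u = v" using some[of u] some[of v] unfolding cls_def by force
  qed
  ultimately have "xi A scT tens w
      = (\<Sum>v\<in>?R. act A scT tens (length w) (SOME \<sigma>. \<sigma> \<in> cls v) (tens (map xi_mat w)))"
    unfolding xi_def by (simp add: sum.reindex)
  also have "\<dots> = (\<Sum>v\<in>?R. scT (psign w (SOME \<sigma>. \<sigma> \<in> cls v)) (bas v))"
  proof (rule sum.cong)
    fix v assume "v \<in> ?R"
    from some[OF this] show "act A scT tens (length w) (SOME \<sigma>. \<sigma> \<in> cls v) (tens (map xi_mat w))
      = scT (psign w (SOME \<sigma>. \<sigma> \<in> cls v)) (bas v)"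
      using act_bas[of "SOME \<sigma>. \<sigma> \<in> cls v" "length w" w] w by (simp add: cls_def bas_def)
  qed simp
  finally show ?thesis .
qed

lemma crd_xi_other:
  assumes "w \<in> lists letters" "mset v \<noteq> mset w"
  shows "crd (xi A scT tens w) v = 0"
  unfolding xi_expansion[OF assms(1)]
proof (subst T.c_sum, simp, rule sum.neutral, rule ballI)
  fix u assume "u \<in> (\<lambda>\<sigma>. permute_list \<sigma> w) ` {\<sigma>. \<sigma> permutes {..<length w}}"
  then have "mset u = mset w" "u \<in> lists letters"
    using assms(1) by (auto simp: permute_list_lists)
  then show "crd (scT (psign w (SOME \<sigma>. \<sigma> \<in> {\<rho>. \<rho> permutes {..<length w} \<and> permute_list \<rho> w = u})) (bas u)) v = 0"
    using assms(2) by (auto simp: T.c_scale T.c_e simp del: in_lists_conv_set)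
qed

text \<open>By \<open>psign_eq\<close> the sign chosen in \<open>xi_expansion\<close> is that of
  every permutation with the same effect on \<open>w\<close>; here it matters that the odd letters
  of \<open>w\<close> are distinct.\<close>

lemma crd_xi:
  assumes w: "w \<in> Tri A B" and \<sigma>: "\<sigma> permutes {..<length w}"
  shows "crd (xi A scT tens w) (permute_list \<sigma> w) = psign w \<sigma>"
proof -
  let ?R = "(\<lambda>\<sigma>. permute_list \<sigma> w) ` {\<sigma>. \<sigma> permutes {..<length w}}"
  let ?s = "\<lambda>v. SOME \<sigma>. \<sigma> \<in> {\<rho>. \<rho> permutes {..<length w} \<and> permute_list \<rho> w = v}"
  have fin: "finite ?R" by (intro finite_imageI finite_permutations) simp
  have l: "u \<in> lists letters" if "u \<in> ?R" for u
    using that Tri_lists[OF w] by (auto simp: permute_list_lists)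
  have "crd (xi A scT tens w) (permute_list \<sigma> w)
      = (\<Sum>v\<in>?R. if v = permute_list \<sigma> w then psign w (?s v) else 0)"
    unfolding xi_expansion[OF Tri_lists[OF w]]
    by (subst T.c_sum, simp, rule sum.cong) (use l in \<open>auto simp: T.c_scale T.c_e simp del: in_lists_conv_set\<close>)
  also have "\<dots> = psign w (?s (permute_list \<sigma> w))"
    using fin \<sigma> by simp
  also have "\<dots> = psign w \<sigma>"
  proof -
    have "?s (permute_list \<sigma> w) \<in> {\<rho>. \<rho> permutes {..<length w} \<and> permute_list \<rho> w = permute_list \<sigma> w}"
      (is "_ \<in> ?S")
      using \<sigma> by (intro someI[of "\<lambda>\<sigma>. \<sigma> \<in> ?S" \<sigma>]) simp
    then show ?thesis
      using \<sigma> Tri_even[OF w] by (intro psign_eq) auto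
  qed
  finally show ?thesis .
qed

text \<open>Each rearrangement \<open>v\<close> of \<open>w\<close> is reached by some
  \<open>\<rho>\<close>, and the cocycle identity for \<open>\<rho> \<circ> \<sigma>\<close> yields
  the sign; at other words both coordinates vanish.\<close>

lemma adjinv_xi:
  assumes w: "w \<in> Tri A B"
  shows "adjinv (crd (xi A scT tens w))"
  unfolding adjinv_iff_permute
proof (intro allI impI)
  fix v :: "('a \<times> 'n \<times> 'n) list" and \<sigma> assume \<sigma>: "\<sigma> permutes {..<length v}"
  show "crd (xi A scT tens w) (permute_list \<sigma> v) = psign v \<sigma> * crd (xi A scT tens w) v"
  proof (cases "mset v = mset w")
    case True
    then obtain \<rho> where \<rho>: "\<rho> permutes {..<length w}" "permute_list \<rho> w = v"
      by (rule mset_eq_permutation)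
    have \<sigma>': "\<sigma> permutes {..<length w}" using \<sigma> mset_eq_length[OF True] by simp
    have "permute_list \<sigma> v = permute_list (\<rho> \<circ> \<sigma>) w"
      using permute_list_compose[OF \<sigma>', of \<rho>] \<rho>(2) by simp
    then have "crd (xi A scT tens w) (permute_list \<sigma> v) = psign w (\<rho> \<circ> \<sigma>)"
      using crd_xi[OF w permutes_compose[OF \<sigma>' \<rho>(1)]] by simp
    also have "\<dots> = psign v \<sigma> * psign w \<rho>"
      using psign_comp[OF \<rho>(1) \<sigma>'] \<rho>(2) by (simp add: mult.commute)
    also have "psign w \<rho> = crd (xi A scT tens w) v"
      using crd_xi[OF w \<rho>(1)] \<rho>(2) by simp
    finally show ?thesis .
  next
    case False
    then show ?thesis
      using crd_xi_other[OF Tri_lists[OF w]] \<sigma> by simp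
  qed
qed

lemma c_factorial_eq: "c_factorial C w = letter_factorial {x. fst x \<in> C} w"
  unfolding c_factorial_def letter_factorial_def by (rule prod.cong) auto

lemma crd_eta: "crd (eta A C scT tens w) v = of_nat (c_factorial C w) * crd (xi A scT tens w) v"
  by (simp add: eta_def T.c_scale)

text \<open>
  \<open>divisible {}\<close> is the coordinate description of \<open>S\<^sup>A(n)\<close>, and \<open>divisible Bc\<close> that of \<open>T\<^sup>A\<^sub>\<aa>(n)\<close>.
\<close>

definition divisible :: "'a set \<Rightarrow> 't set" where
  "divisible C = {x. adjinv (crd x) \<and> (\<forall>w. of_nat (c_factorial C w) dvd crd x w)}"

lemma subspace_divisible: "T.subspace (divisible C)"
proof (rule T.subspaceI)
  show "0 \<in> divisible C" by (simp add: divisible_def adjinv_def T.c_zero)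
  have "crd (x + y) = (\<lambda>w. crd x w + crd y w)" "crd (scT c x) = (\<lambda>w. c * crd x w)" for x y c
    by (auto simp: T.c_add T.c_scale)
  then show "x + y \<in> divisible C" "scT c x \<in> divisible C"
    if "x \<in> divisible C" "y \<in> divisible C" for x y c
    using that by (auto simp: divisible_def adjinv_add adjinv_scale)
qed

lemma eta_divisible:
  assumes w: "w \<in> Tri A B"
  shows "eta A C scT tens w \<in> divisible C"
proof -
  have "crd (eta A C scT tens w) = (\<lambda>v. of_nat (c_factorial C w) * crd (xi A scT tens w) v)"
    by (rule ext) (rule crd_eta)
  then have "adjinv (crd (eta A C scT tens w))" by (simp add: adjinv_scale adjinv_xi[OF w])
  moreover have "of_nat (c_factorial C v) dvd crd (eta A C scT tens w) v" for v
  proof (cases "mset v = mset w")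
    case True
    then show ?thesis using letter_factorial_mset[OF True] by (simp add: crd_eta c_factorial_eq)
  next
    case False
    then show ?thesis by (simp add: crd_eta crd_xi_other[OF Tri_lists[OF w]])
  qed
  ultimately show ?thesis by (simp add: divisible_def)
qed

lemma eta_parity:
  assumes w: "w \<in> Tri A B"
  shows "eta A C scT tens w \<in> P (wpar w)"
  unfolding tensor_parity_eq homogeneous_def
proof (clarify)
  fix v assume "crd (eta A C scT tens w) v \<noteq> 0"
  then have "mset v = mset w" using crd_xi_other[OF Tri_lists[OF w]] by (auto simp: crd_eta)
  then show "wpar v = wpar w" by (rule wpar_mset)
qed

section \<open>A diagonal basis of the invariant divisible elements\<close>

lemma adjinv_support:
  assumes f: "adjinv f" "f w \<noteq> (0 :: 'k)" and w: "w \<in> lists letters"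
  shows "w \<in> Tri A B"
proof -
  have "fst (w ! k) \<in> A 0" if kl: "k < length w" "l < length w" "k \<noteq> l" "w ! k = w ! l" for k l
  proof (rule ccontr)
    assume "fst (w ! k) \<notin> A 0"
    moreover have "w ! k \<in> letters" using w kl by auto
    ultimately have odd: "par (w ! k) = 1" using par_letter[of "w ! k" 0] by auto
    have "{k, l} \<subseteq> {i. i < length w \<and> w ! k = w ! i}" using kl by auto
    then have "card {k, l} \<le> card {i. i < length w \<and> w ! k = w ! i}"
      by (intro card_mono) auto
    then have "count (mset w) (w ! k) \<ge> 2"
      using kl by (simp add: count_mset count_list_eq_length_filter length_filter_conv_card)
    then show False using adjinv_odd_repeat[OF f(1) odd] f(2) by simp
  qed
  moreover have "fst ` set w \<subseteq> B" using w by (auto simp: letters_def)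
  ultimately show ?thesis unfolding Tri_def by blast
qed

text \<open>One word is kept from each class of rearrangements in \<open>Tri\<close>, since the
  elements \<open>eta\<close> of rearranged words agree up to sign. The choice depends only on the
  multiset of letters, which gives \<open>canonical_mset_inject\<close>.\<close>

definition canonical :: "('a \<times> 'n \<times> 'n) list set" where
  "canonical = {w \<in> Tri A B. (SOME v. mset v = mset w \<and> v \<in> Tri A B) = w}"

lemma canonical_Tri: "w \<in> canonical \<Longrightarrow> w \<in> Tri A B"
  by (simp add: canonical_def)

lemma canonical_mset_inject: "v \<in> canonical \<Longrightarrow> w \<in> canonical \<Longrightarrow> mset v = mset w \<Longrightarrow> v = w"
  unfolding canonical_def by auto

text \<open>An invariant function is supported on \<open>Tri\<close>, and its values on a class of
  rearrangements agree up to sign. So it is 0 as soon as it vanishes on canonical words.\<close>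

lemma canonical_nonzero:
  assumes f: "adjinv f" "f u \<noteq> (0 :: 'k)" and u: "u \<in> lists letters"
  shows "\<exists>w\<in>canonical. f w \<noteq> 0"
proof -
  let ?w = "SOME v. mset v = mset u \<and> v \<in> Tri A B"
  have *: "mset ?w = mset u \<and> ?w \<in> Tri A B"
    by (rule someI_ex) (use adjinv_support[OF f u] in blast)
  then have "?w \<in> canonical" by (simp add: canonical_def)
  moreover have "f ?w \<noteq> 0" using adjinv_mset[OF f(1), of ?w u] * f(2) by auto
  ultimately show ?thesis by blast
qed

lemma crd_eta_canonical:
  assumes "v \<in> canonical" "w \<in> canonical"
  shows "crd (eta A C scT tens v) w = (if v = w then of_nat (c_factorial C v) else 0)"
proof (cases "v = w")
  case True
  then show ?thesis
    using crd_xi[OF canonical_Tri[OF assms(1)] permutes_id] by (simp add: crd_eta)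
next
  case False
  then have "mset w \<noteq> mset v" using canonical_mset_inject assms by metis
  then show ?thesis
    using crd_xi_other[OF Tri_lists[OF canonical_Tri[OF assms(1)]]] False by (simp add: crd_eta)
qed

text \<open>The coefficient at \<open>eta w\<close> is the coordinate at \<open>w\<close> divided by
  \<open>c_factorial C w\<close>. The resulting combination agrees with \<open>x\<close> on
  canonical words, hence everywhere, because the difference is invariant.\<close>

lemma divisible_eq_span: "divisible C = T.span (eta A C scT tens ` canonical)"
proof
  show "T.span (eta A C scT tens ` canonical) \<subseteq> divisible C"
    by (rule T.span_minimal[OF _ subspace_divisible]) (use eta_divisible canonical_Tri in blast)
  show "divisible C \<subseteq> T.span (eta A C scT tens ` canonical)"
  proof
    fix x assume x: "x \<in> divisible C"
    let ?Z = "{w \<in> canonical. crd x w \<noteq> 0}"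
    have fin: "finite ?Z" by (rule finite_subset[OF _ T.finite_support[of x]]) auto
    have "\<forall>w. \<exists>q. crd x w = of_nat (c_factorial C w) * q"
      using x by (auto simp: divisible_def dvd_def)
    then obtain q where q: "\<And>w. crd x w = of_nat (c_factorial C w) * q w" by metis
    define y where "y = (\<Sum>w\<in>?Z. scT (q w) (eta A C scT tens w))"
    have y: "y \<in> T.span (eta A C scT tens ` canonical)"
      unfolding y_def by (intro T.span_sum T.span_scale T.span_base) auto
    have yd: "y \<in> divisible C"
      unfolding y_def using eta_divisible canonical_Tri
      by (intro T.subspace_sum[OF subspace_divisible] T.subspace_scale[OF subspace_divisible]) auto
    have crd_y: "crd y w = crd x w" if w: "w \<in> canonical" for w
    proof -
      have "crd y w = (\<Sum>v\<in>?Z. q v * crd (eta A C scT tens v) w)"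
        by (simp add: y_def T.c_sum T.c_scale)
      also have "\<dots> = (\<Sum>v\<in>?Z. if v = w then q v * of_nat (c_factorial C v) else 0)"
        by (rule sum.cong) (auto simp: crd_eta_canonical w)
      also have "\<dots> = crd x w" using fin w by (auto simp: q)
      finally show ?thesis .
    qed
    have "x - y \<in> divisible C" by (rule T.subspace_diff[OF subspace_divisible x yd])
    then have adj: "adjinv (crd (x - y))" by (simp add: divisible_def)
    have "x = y"
    proof (rule T.c_inject)
      fix u assume u: "u \<in> lists letters"
      have "crd (x - y) w = 0" if "w \<in> canonical" for w
        using crd_y[OF that] by (simp add: T.c_diff)
      then have "crd (x - y) u = 0" using canonical_nonzero[OF adj _ u] by blast
      then show "crd x u = crd y u" by (simp add: T.c_diff)
    qed simp_all
    then show "x \<in> T.span (eta A C scT tens ` canonical)" using y by simp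
  qed
qed

lemma diag_family_divisible:
  "diag_family scT UNIV (divisible C) canonical (eta A C scT tens) (\<lambda>w x. crd x w)"
  unfolding diag_family_def
proof (intro conjI ballI)
  fix v w assume "v \<in> canonical" "w \<in> canonical"
  then show "crd (eta A C scT tens w) v \<noteq> 0 \<longleftrightarrow> v = w"
    using letter_factorial_pos[of "{x. fst x \<in> C}" w] by (auto simp: crd_eta_canonical c_factorial_eq)
qed (simp_all add: divisible_eq_span linear_crd)

section \<open>Closure under the structure maps\<close>

lemma direct_sum_divisible: "direct_sum (divisible C) (divisible C \<inter> P 0) (divisible C \<inter> P 1)"
proof (rule direct_sum_P[OF divisible_eq_span], rule image_subsetI)
  fix w assume "w \<in> canonical"
  from eta_parity[OF canonical_Tri[OF this]] show "eta A C scT tens w \<in> P 0 \<union> P 1"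
    by (cases "wpar w") auto
qed

lemma one_divisible: "tens [] \<in> divisible C"
  by (auto simp: divisible_def adjinv_def crd_one c_factorial_def)

text \<open>Letters with entry in \<open>C\<close> are even, because \<open>Ba\<close> and
  \<open>Bc\<close> span the even part; this is what the Leibniz argument of \<open>shuf_dvd\<close>
  requires.\<close>

lemma star_divisible:
  assumes C: "C \<subseteq> Ba \<union> Bc" and "x \<in> divisible C" "y \<in> divisible C"
  shows "x \<star> y \<in> divisible C"
proof -
  have "par z = 0" if "z \<in> {x. fst x \<in> C}" for z
  proof -
    have "z \<in> letters" using that C by (cases z) (auto simp: letters_def)
    moreover have "fst z \<in> A 0" using that C basis_spans(2) S.span_base by blast
    ultimately show ?thesis by (simp add: par_letter)
  qed
  then show ?thesis
    using assms(2,3) by (auto simp: divisible_def crd_star' c_factorial_eq intro!: adjinv_shuf shuf_dvd)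
qed

text \<open>The coefficient of \<open>eta u \<otimes> eta v\<close> in the coproduct is
  \<open>crd x (u @ v)\<close> divided by both factorials. It lies in the ground ring because their
  product divides \<open>c_factorial C (u @ v)\<close>.\<close>

lemma nabla_divisible:
  assumes x: "x \<in> divisible C" "x \<in> P i"
  shows "cop x \<in> tensor_grading sc2 tn (\<lambda>p. divisible C \<inter> P p) i"
proof -
  let ?eta = "eta A C scT tens"
  let ?F = "\<lambda>u v. crd x (u @ v)"
  let ?Z = "{uv \<in> canonical \<times> canonical. crd2 (cop x) uv \<noteq> 0}"
  have fin: "finite ?Z" by (rule finite_subset[OF _ U.finite_support[OF nabla_in_U0]]) auto
  have "of_nat (c_factorial C u) * of_nat (c_factorial C v) dvd ?F u v" for u v
  proof -
    obtain k where "c_factorial C (u @ v) = c_factorial C u * c_factorial C v * k"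
      unfolding c_factorial_eq using letter_factorial_append_dvd by (rule dvdE)
    then have "of_nat (c_factorial C u) * of_nat (c_factorial C v) dvd (of_nat (c_factorial C (u @ v)) :: 'k)"
      by simp
    then show ?thesis using x(1) by (auto simp: divisible_def intro: dvd_trans)
  qed
  then have "\<forall>u v. \<exists>q. ?F u v = of_nat (c_factorial C u) * of_nat (c_factorial C v) * q"
    by (auto simp: dvd_def)
  then obtain q where q: "\<And>u v. ?F u v = of_nat (c_factorial C u) * of_nat (c_factorial C v) * q u v"
    by metis
  define y where "y = (\<Sum>(u, v)\<in>?Z. sc2 (q u v) (tn (?eta u) (?eta v)))"
  \<comment> \<open>Invariance in each of the two words separately. It holds for the coproduct and
    for \<open>eta u \<otimes> eta v\<close>, and it lets equality be tested on canonical
    pairs.\<close>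
  define Inv where "Inv = {p \<in> U0. (\<forall>v. adjinv (\<lambda>u. crd2 p (u, v))) \<and> (\<forall>u. adjinv (\<lambda>v. crd2 p (u, v)))}"
  have sub: "U.subspace Inv"
  proof (rule U.subspaceI)
    show "0 \<in> Inv" by (simp add: Inv_def U.subspace_0[OF U.subspace_M] U.c_zero adjinv_def)
    show "p + p' \<in> Inv" if "p \<in> Inv" "p' \<in> Inv" for p p'
      using that by (auto simp: Inv_def U.subspace_add[OF U.subspace_M] U.c_add adjinv_add)
    show "sc2 c p \<in> Inv" if "p \<in> Inv" for c p
      using that by (auto simp: Inv_def U.subspace_scale[OF U.subspace_M] U.c_scale adjinv_scale)
  qed
  have adj: "adjinv (crd x)" using x(1) by (simp add: divisible_def)
  have "cop x \<in> Inv"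
    using adjinv_append[OF adj] adjinv_append_right[OF adj]
    by (simp add: Inv_def nabla_in_U0 crd2_nabla)
  moreover have "tn (?eta u) (?eta v) \<in> Inv" if "u \<in> canonical" "v \<in> canonical" for u v
  proof -
    have "adjinv (crd (?eta u))" "adjinv (crd (?eta v))"
      using eta_divisible canonical_Tri that by (auto simp: divisible_def)
    note adj = this
    have "adjinv (\<lambda>w. crd (?eta u) w * c)" for c
      using adjinv_scale[OF adj(1), of c] by (simp only: mult.commute)
    then show ?thesis
      using adjinv_scale[OF adj(2)] by (simp add: Inv_def tn_in_U0 crd2_tn)
  qed
  then have y: "y \<in> Inv"
    unfolding y_def by (intro U.subspace_sum[OF sub]) (auto intro: U.subspace_scale[OF sub])
  ultimately have d: "cop x - y \<in> Inv" by (rule U.subspace_diff[OF sub])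
  have yU: "y \<in> U0" and dU: "cop x - y \<in> U0" using y d by (simp_all add: Inv_def)
  have crd_y: "crd2 y (u, v) = crd2 (cop x) (u, v)" if uv: "u \<in> canonical" "v \<in> canonical" for u v
  proof -
    have "crd2 y (u, v) = (\<Sum>(a, b)\<in>?Z. q a b * (crd (?eta a) u * crd (?eta b) v))"
      unfolding y_def
      by (subst U.c_sum)
        (auto simp: U.c_scale tn_in_U0 crd2_tn U.subspace_scale[OF U.subspace_M] intro!: sum.cong)
    also have "\<dots> = (\<Sum>ab\<in>?Z. if ab = (u, v) then ?F u v else 0)"
      by (rule sum.cong) (auto simp: crd_eta_canonical uv q split: if_splits)
    also have "\<dots> = crd2 (cop x) (u, v)" using fin uv by (auto simp: crd2_nabla)
    finally show ?thesis .
  qed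
  have zero: "crd2 (cop x - y) (u, v) = 0" if "u \<in> canonical" "v \<in> canonical" for u v
    using crd_y[OF that] by (simp add: U.c_diff nabla_in_U0 yU)
  have "cop x = y"
  proof (rule U.c_inject[OF nabla_in_U0 yU])
    fix uv assume "uv \<in> lists letters \<times> lists letters"
    then obtain u v where uv: "uv = (u, v)" "u \<in> lists letters" "v \<in> lists letters" by (cases uv) simp
    have "crd2 (cop x - y) (u, v) = 0"
    \<comment> \<open>A nonzero coordinate is moved to canonical words in one variable at a
      time.\<close>
    proof (rule ccontr)
      assume "crd2 (cop x - y) (u, v) \<noteq> 0"
      moreover have "adjinv (\<lambda>u. crd2 (cop x - y) (u, v))" using d by (simp add: Inv_def)
      ultimately obtain u' where u': "u' \<in> canonical" "crd2 (cop x - y) (u', v) \<noteq> 0"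
        using canonical_nonzero[of "\<lambda>u. crd2 (cop x - y) (u, v)" u] uv by blast
      moreover have "adjinv (\<lambda>v. crd2 (cop x - y) (u', v))" using d by (simp add: Inv_def)
      ultimately obtain v' where "v' \<in> canonical" "crd2 (cop x - y) (u', v') \<noteq> 0"
        using canonical_nonzero[of "\<lambda>v. crd2 (cop x - y) (u', v)" v] uv by blast
      then show False using zero u' by blast
    qed
    then show "crd2 (cop x) uv = crd2 y uv" by (simp add: uv U.c_diff nabla_in_U0 yU)
  qed
  also have "y \<in> tensor_grading sc2 tn (\<lambda>p. divisible C \<inter> P p) i"
    unfolding y_def tensor_grading_def
  proof (rule U.span_sum, clarify, rule U.span_scale, rule U.span_base)
    fix u v assume uv: "u \<in> canonical" "v \<in> canonical" "crd2 (cop x) (u, v) \<noteq> 0"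
    \<comment> \<open>Nonzero coefficients of \<open>x\<close> occur only at words of parity
      \<open>i\<close>, so every term of the sum has total parity \<open>i\<close>.\<close>
    then have "wpar (u @ v) = i"
      using x(2) unfolding tensor_parity_eq by (auto simp: homogeneous_def crd2_nabla)
    then have "wpar u + wpar v = i" by simp
    moreover have "?eta u \<in> divisible C \<inter> P (wpar u)" "?eta v \<in> divisible C \<inter> P (wpar v)"
      using uv canonical_Tri eta_divisible eta_parity by blast+
    ultimately show "tn (?eta u) (?eta v) \<in> {tn x y |x y. \<exists>j k. j + k = i \<and>
        x \<in> divisible C \<inter> P j \<and> y \<in> divisible C \<inter> P k}"
      by blast
  qed
  finally show ?thesis .
qed

lemma superbialgebra_divisible:
  assumes "C \<subseteq> Ba \<union> Bc"
  shows "superbialgebra scT sc2 tn sc3 tnl tnr (divisible C) (\<lambda>p. divisible C \<inter> P p)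
    (\<star>) (tens []) cop (counit scT tens)"
  by (rule superbialgebra_restrict[OF superbialgebra_T subspace_divisible subset_UNIV
        direct_sum_divisible tensor_square_cube_restrict[OF module_T tcube diag_family_divisible]
        one_divisible star_divisible[OF assms] nabla_divisible])

text \<open>For empty \<open>C\<close> all factorials are 1, so only invariance remains; the degree
  of a spanning element \<open>eta\<close> is the length of its word.\<close>

lemma S_total_eq: "S_total A scT tens = divisible {}"
proof
  show "S_total A scT tens \<subseteq> divisible {}"
    unfolding S_total_def
    by (rule T.span_minimal[OF _ subspace_divisible])
      (auto simp: invariants_eq divisible_def c_factorial_def)
  have "eta A {} scT tens w \<in> invariants A scT tens (length w)" if w: "w \<in> canonical" for w
  proof -
    have "length v = length w" if "crd (eta A {} scT tens w) v \<noteq> 0" for v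
      using that crd_xi_other[OF Tri_lists[OF canonical_Tri[OF w]]]
      by (metis crd_eta mset_eq_length mult_zero_right)
    moreover have "eta A {} scT tens w \<in> divisible {}" by (rule eta_divisible[OF canonical_Tri[OF w]])
    ultimately show ?thesis by (auto simp: invariants_eq divisible_def)
  qed
  then show "divisible {} \<subseteq> S_total A scT tens"
    unfolding S_total_def divisible_eq_span by (intro T.span_mono) auto
qed

text \<open>\<open>T_degree\<close> uses all words of \<open>Tri\<close> and the basis only
  canonical ones; the other elements \<open>eta\<close> are divisible as well, hence lie in the same
  span.\<close>

lemma T_total_eq: "T_total A B Bc scT tens = divisible Bc"
proof
  show "T_total A B Bc scT tens \<subseteq> divisible Bc"
    unfolding T_total_def T_degree_def
    by (intro T.span_minimal[OF _ subspace_divisible] UN_least) (use eta_divisible in blast)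
  show "divisible Bc \<subseteq> T_total A B Bc scT tens"
    unfolding T_total_def T_degree_def divisible_eq_span
  proof (rule T.span_mono, rule image_subsetI)
    fix w assume "w \<in> canonical"
    then have "eta A Bc scT tens w \<in> {eta A Bc scT tens v | v. v \<in> Tri A B \<and> length v = length w}"
      using canonical_Tri by blast
    from T.span_base[OF this]
    show "eta A Bc scT tens w \<in> (\<Union>d. T.span {eta A Bc scT tens w |w. w \<in> Tri A B \<and> length w = d})"
      by blast
  qed
qed

end

theorem corollary4p4:
  fixes sc :: "'k::{idom, ring_char_0} \<Rightarrow> 'a::ring \<Rightarrow> 'a"
    and A :: "bit \<Rightarrow> 'a set" and \<aa> Ba Bc Bodd :: "'a set"
    and scT :: "'k \<Rightarrow> 't::ab_group_add \<Rightarrow> 't" and tens :: "('a^'n::finite^'n) list \<Rightarrow> 't"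
    and sc2 :: "'k \<Rightarrow> 'u::ab_group_add \<Rightarrow> 'u" and tn :: "'t \<Rightarrow> 't \<Rightarrow> 'u"
    and sc3 :: "'k \<Rightarrow> 'w::ab_group_add \<Rightarrow> 'w" and tnl :: "'u \<Rightarrow> 't \<Rightarrow> 'w" and tnr :: "'t \<Rightarrow> 'u \<Rightarrow> 'w"
  assumes "good_pair sc A \<aa>"
    and "good_pair_basis sc A \<aa> Ba Bc Bodd"
    and "tensor_algebra (mat_scale sc) scT tens"
    and "tensor_square_cube scT UNIV sc2 tn sc3 tnl tnr"
  shows
    "superbialgebra scT sc2 tn sc3 tnl tnr
       (S_total A scT tens)
       (\<lambda>p. S_total A scT tens \<inter> tensor_parity A scT tens p)
       (star A scT tens) (tens []) (nabla scT tens sc2 tn) (counit scT tens) \<and>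
     superbialgebra scT sc2 tn sc3 tnl tnr
       (T_total A (Ba \<union> Bc \<union> Bodd) Bc scT tens)
       (\<lambda>p. T_total A (Ba \<union> Bc \<union> Bodd) Bc scT tens \<inter> tensor_parity A scT tens p)
       (star A scT tens) (tens []) (nabla scT tens sc2 tn) (counit scT tens)"
proof -
  interpret matrix_tensors sc A \<aa> Ba Bc Bodd scT tens sc2 tn sc3 tnl tnr
    using assms by unfold_locales
  show ?thesis
    unfolding S_total_eq T_total_eq by (intro conjI superbialgebra_divisible) auto
qed

end
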